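(* Suppose learned-symmetric markets $\mathcal M,\widetilde{\mathcal M}$ (with endogenous prices) are identical, except that $\widetilde{\mathcal M}$ has a reduced search cost $\tilde c<c$. Then $\widetilde{\mathcal M}$ has weakly higher canonical consumer welfare and canonical total welfare: $U(\mathcal M)\le U(\widetilde{\mathcal M})$ and $\mathrm{Wel}(\mathcal M)\le\mathrm{Wel}(\widetilde{\mathcal M})$, almost surely over some coupling between the histories of the two markets.
   Context: A market $\mathcal M$ with endogenous prices consists of: $m$ businesses $j\in[m]$ with parameters $\pi_j\in(0,1)$ (fit probability) and $Q_j\in[0,1]$ (quality); a value distribution $\mathcal D^V$ on $[0,\infty)$ that is regular (with CDF $\Psi$ and density $\psi$, $v-(1-\Psi(v))/\psi(v)$ is non-decreasing), has a density, and has bounded support with maximum $\overline V$; a common prior under which all $\pi_j,Q_j$ are independent; a search cost $c\ge 0$; and for each business a demand-responsive pricing rule. The parameters are fixed and are a potential realization of the prior (lie in its support). Dynamics: in round $i=1,2,\dots$ each business sets a publicly observed price $P_{ij}\ge0$ as a (possibly randomized) function of the past history $H^{\mathcal M}_{i-1}$, and consumer $i$ arrives with value $V_i\sim\mathcal D^V$ (i.i.d.). For each $j$, fit $F_{ij}\sim\mathrm{Bernoulli}(\pi_j)$, quality realization $q_{ij}\sim\mathrm{Bernoulli}(Q_j)$, all independent. She sequentially inspects businesses at cost $c$ each, observing $F_{ij}$, and transacts with at most one inspected business; transacting with $j$ gives expected utility $V_iQ_jF_{ij}-P_{ij}$ given $F_{ij}$; total utility subtracts search costs. The history records prices, inspected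 businesses with $F_{ij}$, and the transacted business with $q_{ij}$. Let $\hat\pi_{ij},\hat Q_{ij}$ be the posterior means given $H^{\mathcal M}_{i-1}$ (no inference from prices) and $\sigma_j(P,\hat\pi,\hat Q,V)=V\hat Q-P-c/\hat\pi$. Optimal search: inspect businesses with $\sigma_j(P_{ij},\hat\pi_{ij},\hat Q_{ij},V_i)>0$ in decreasing order of index, transact with the first that fits. Demand-responsive: $P_{ij}$ is such that $\sigma_j(P_{ij},\hat\pi_{ij},\hat Q_{ij},\overline V)>0$ whenever some price $\ge0$ achieves this. Business $j$ is learned if the posteriors of $(\pi_j,Q_j)$ converge (in probability, as $i\to\infty$) to the true values; it is lost if $\sigma_j(0,\hat\pi_{ij},\hat Q_{ij},\overline V)\le0$ for some $i$ and all later ones. $S^{\mathrm{lnd}}(\mathcal M)$ is the random set of learned businesses. $\mathcal M$ is learned-symmetric if, almost surely over the realization $S$ of $S^{\mathrm{lnd}}(\mathcal M)$, all businesses in $S$ have the same type: $\pi_j=\pi_{j'}$, $Q_j=Q_{j'}$ for all $j,j'\in S$. A (steady-state) market equilibrium specifies limit beliefs and price distributions $(\Gamma_j)_{j\in[m]}$ such that (1) each business is either learned (beliefs are point masses at $(\pi_j,Q_j)$) or lost (index at price $0$ and value $\overline V$ is $\le0$); (2) for each $j$, fixing the others' price distributions, each price in the support of $\Gamma_j$ maximizes $j$'s expected revenue from a consumer with the limit beliefs and value drawn from $\mathcal D^V$ who searches optimally. It is symmetric if all learned businesses use the same price distribution. For a learned-symmetric market and realization $S$ of the learned set there is almost surely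 a unique symmetric market equilibrium with learned set $S$, denoted $\Phi(\mathcal M,S)$: with $n=|S|$, common type $(\pi,Q)$, $W=0$ with probability $1-\pi$ and $W=VQ-c/\pi$, $V\sim\mathcal D^V$, otherwise, $D(p)=\Pr[W>p]$, and $p^*$ a maximizer of $pD(p)$, each learned business draws its price from $[\underline p,p^*]$ with CDF $G(p)=\frac1\pi\bigl[1-(1-\pi)\bigl(\frac{p^*D(p^* )}{pD(p)}\bigr)^{1/(n-1)}\bigr]$, $\underline p$ being the maximum value with $G(\underline p)=0$ (for $n=1$, the business charges the monopoly price $p^*$). The canonical equilibrium is $\Phi_{\mathrm{can}}(\mathcal M)=\Phi(\mathcal M,S^{\mathrm{lnd}}(\mathcal M))$, a random object via the history. For an equilibrium $\Phi$, $U(\mathcal M,\Phi)$ is the expected total utility (net of price and search costs) of a consumer with the limit beliefs, value from $\mathcal D^V$, searching optimally when prices are drawn from $\Phi$; $\mathrm{Wel}(\mathcal M,\Phi)$ is the expected total welfare (consumer utility plus the sum of business revenues). Canonical consumer welfare: $U(\mathcal M)=U(\mathcal M,\Phi_{\mathrm{can}}(\mathcal M))$. Canonical total welfare: $\mathrm{Wel}(\mathcal M)=\mathrm{Wel}(\mathcal M,\Phi_{\mathrm{can}}(\mathcal M))$. A coupling of two random objects is a joint distribution with the correct marginals. *)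

theory Defs
  imports "HOL-Probability.Probability"
begin

text \<open>
  Businesses are numbered \<open>0, \<dots>, m - 1\<close> and rounds \<open>0, 1, \<dots>\<close>; functions of a business
  are only meaningful below \<open>m\<close>.

  What the history records about a round: the posted prices; for each business, \<open>None\<close> if it
  was not inspected and \<open>Some f\<close> if inspection revealed the fit \<open>f\<close>; and the business
  transacted with, if any, together with the quality realization.
\<close>

type_synonym outcome = "(nat \<Rightarrow> real) \<times> (nat \<Rightarrow> bool option) \<times> (nat \<times> bool) option"

text \<open>
  \<open>price_rule M j i h u\<close> is the price of business \<open>j\<close> after a history \<open>h\<close> of \<open>i\<close> rounds. A randomized
  price is a function of the history and of a fresh seed \<open>u\<close>, uniform on the unit interval.
  The common prior makes all \<open>\<pi>\<^sub>j\<close> and \<open>Q\<^sub>j\<close> independent, so it is specified by its marginals.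
\<close>

record market =
  nbiz :: nat
  fit_prob :: "nat \<Rightarrow> real"
  quality :: "nat \<Rightarrow> real"
  value_dist :: "real measure"
  fit_prior :: "nat \<Rightarrow> real measure"
  quality_prior :: "nat \<Rightarrow> real measure"
  search_cost :: real
  price_rule :: "nat \<Rightarrow> nat \<Rightarrow> (nat \<Rightarrow> outcome) \<Rightarrow> real \<Rightarrow> real"

definition msupport :: "'a::topological_space measure \<Rightarrow> 'a set" where
  "msupport N = {x. \<forall>U. open U \<and> x \<in> U \<longrightarrow> emeasure N U > 0}"

definition max_value :: "market \<Rightarrow> real" where
  "max_value M = Sup (msupport (value_dist M))"

text \<open>
  The virtual value is taken in the extended reals, so that it is \<open>-\<infinity>\<close> where the density
  vanishes but the upper tail does not. Where the upper tail is zero it is not constrained.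
\<close>

definition regular_dist :: "real measure \<Rightarrow> bool" where
  "regular_dist D \<longleftrightarrow> (\<exists>\<psi>\<in>borel_measurable borel.
     (\<forall>v. 0 \<le> \<psi> v) \<and> D = density lborel (\<lambda>v. ennreal (\<psi> v)) \<and>
     mono_on {v. 0 \<le> v \<and> cdf D v < 1}
       (\<lambda>v. ereal v - ereal (1 - cdf D v) / ereal (\<psi> v)))"


subsection \<open>Beliefs\<close>

text \<open>
  Likelihood, under \<open>\<theta> = (\<pi>\<^sub>j, Q\<^sub>j)\<close>, of what the first \<open>i\<close> rounds of \<open>h\<close> reveal about business
  \<open>j\<close>. Prices do not enter (no inference from prices), and since the prior is a product the
  observations on other businesses cancel in Bayes' rule.
\<close>

definition likelihood :: "nat \<Rightarrow> nat \<Rightarrow> (nat \<Rightarrow> outcome) \<Rightarrow> real \<times> real \<Rightarrow> real" where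
  "likelihood j i h = (\<lambda>(p, x). \<Prod>r<i.
     (case fst (snd (h r)) j of None \<Rightarrow> 1 | Some f \<Rightarrow> if f then p else 1 - p) *
     (case snd (snd (h r)) of None \<Rightarrow> 1
        | Some (k, good) \<Rightarrow> if k = j then (if good then x else 1 - x) else 1))"

definition prior :: "market \<Rightarrow> nat \<Rightarrow> (real \<times> real) measure" where
  "prior M j = fit_prior M j \<Otimes>\<^sub>M quality_prior M j"

text \<open>Bayes' rule; the null measure if \<open>h\<close> is impossible under the prior.\<close>

definition posterior :: "market \<Rightarrow> nat \<Rightarrow> nat \<Rightarrow> (nat \<Rightarrow> outcome) \<Rightarrow> (real \<times> real) measure" where
  "posterior M j i h = density (prior M j)
     (\<lambda>\<theta>. ennreal (likelihood j i h \<theta> / (\<integral>\<theta>'. likelihood j i h \<theta>' \<partial>prior M j)))"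

definition mean_fit :: "(real \<times> real) measure \<Rightarrow> real" where
  "mean_fit B = (\<integral>\<theta>. fst \<theta> \<partial>B)"

definition mean_quality :: "(real \<times> real) measure \<Rightarrow> real" where
  "mean_quality B = (\<integral>\<theta>. snd \<theta> \<partial>B)"


subsection \<open>Consumer search\<close>

text \<open>The index of a business with price \<open>P\<close> about which the consumer of value \<open>V\<close> has belief \<open>B\<close>.\<close>

definition search_index :: "market \<Rightarrow> real \<Rightarrow> (real \<times> real) measure \<Rightarrow> real \<Rightarrow> real" where
  "search_index M P B V = V * mean_quality B - P - search_cost M / mean_fit B"

text \<open>Ties between equal indices are broken in favour of the smaller business number.\<close>

definition precedes :: "(nat \<Rightarrow> real) \<Rightarrow> nat \<Rightarrow> nat \<Rightarrow> bool" where
  "precedes \<sigma> k j \<longleftrightarrow> \<sigma> k > \<sigma> j \<or> (\<sigma> k = \<sigma> j \<and> k < j)"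

definition inspects :: "nat \<Rightarrow> (nat \<Rightarrow> real) \<Rightarrow> (nat \<Rightarrow> bool) \<Rightarrow> nat \<Rightarrow> bool" where
  "inspects m \<sigma> F j \<longleftrightarrow> j < m \<and> \<sigma> j > 0 \<and> (\<forall>k<m. precedes \<sigma> k j \<longrightarrow> \<not> F k)"

definition transacts :: "nat \<Rightarrow> (nat \<Rightarrow> real) \<Rightarrow> (nat \<Rightarrow> bool) \<Rightarrow> nat \<Rightarrow> bool" where
  "transacts m \<sigma> F j \<longleftrightarrow> inspects m \<sigma> F j \<and> F j"


subsection \<open>Dynamics\<close>

text \<open>
  The exogenous randomness of a round: the value, fits and quality realizations of the arriving
  consumer, and the seeds of the businesses' randomized prices, all independent.
\<close>

type_synonym shock = "real \<times> (nat \<Rightarrow> bool) \<times> (nat \<Rightarrow> bool) \<times> (nat \<Rightarrow> real)"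

definition shock_space :: "market \<Rightarrow> shock measure" where
  "shock_space M = value_dist M \<Otimes>\<^sub>M
     (PiM {..<nbiz M} (\<lambda>j. measure_pmf (bernoulli_pmf (fit_prob M j))) \<Otimes>\<^sub>M
     (PiM {..<nbiz M} (\<lambda>j. measure_pmf (bernoulli_pmf (quality M j))) \<Otimes>\<^sub>M
      PiM {..<nbiz M} (\<lambda>j. uniform_measure lborel {0..1})))"

definition outcome_space :: "market \<Rightarrow> outcome measure" where
  "outcome_space M = PiM {..<nbiz M} (\<lambda>_. borel) \<Otimes>\<^sub>M
     (PiM {..<nbiz M} (\<lambda>_. count_space UNIV) \<Otimes>\<^sub>M count_space UNIV)"

definition history_space :: "market \<Rightarrow> nat set \<Rightarrow> (nat \<Rightarrow> outcome) measure" where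
  "history_space M R = PiM R (\<lambda>_. outcome_space M)"

definition play_round :: "market \<Rightarrow> nat \<Rightarrow> (nat \<Rightarrow> outcome) \<Rightarrow> shock \<Rightarrow> outcome" where
  "play_round M i h = (\<lambda>(V, F, q, u).
     let P = (\<lambda>j\<in>{..<nbiz M}. price_rule M j i h (u j));
         \<sigma> = (\<lambda>j. search_index M (P j) (posterior M j i h) V)
     in (P,
         (\<lambda>j\<in>{..<nbiz M}. if inspects (nbiz M) \<sigma> F j then Some (F j) else None),
         (if \<exists>j. transacts (nbiz M) \<sigma> F j
          then (let j = (THE j. transacts (nbiz M) \<sigma> F j) in Some (j, q j)) else None)))"

primrec history_prefix :: "market \<Rightarrow> (nat \<Rightarrow> shock) \<Rightarrow> nat \<Rightarrow> nat \<Rightarrow> outcome" where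
  "history_prefix M \<omega> 0 = (\<lambda>_. undefined)"
| "history_prefix M \<omega> (Suc i) =
     (history_prefix M \<omega> i)(i := play_round M i (history_prefix M \<omega> i) (\<omega> i))"

definition history :: "market \<Rightarrow> (nat \<Rightarrow> shock) \<Rightarrow> nat \<Rightarrow> outcome" where
  "history M \<omega> i = history_prefix M \<omega> (Suc i) i"

definition history_law :: "market \<Rightarrow> (nat \<Rightarrow> outcome) measure" where
  "history_law M = distr (PiM UNIV (\<lambda>_. shock_space M)) (history_space M UNIV) (history M)"

definition demand_responsive :: "market \<Rightarrow> nat \<Rightarrow> bool" where
  "demand_responsive M j \<longleftrightarrow> (\<forall>i. \<forall>h\<in>space (history_space M {..<i}).
     (\<exists>p\<ge>0. search_index M p (posterior M j i h) (max_value M) > 0) \<longrightarrow>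
     (AE u in uniform_measure lborel {0..1}.
        search_index M (price_rule M j i h u) (posterior M j i h) (max_value M) > 0))"

definition wf_market :: "market \<Rightarrow> bool" where
  "wf_market M \<longleftrightarrow>
     prob_space (value_dist M) \<and> (AE v in value_dist M. 0 \<le> v) \<and>
     regular_dist (value_dist M) \<and> bounded (msupport (value_dist M)) \<and>
     0 \<le> search_cost M \<and>
     (\<forall>j<nbiz M.
        fit_prob M j \<in> {0<..<1} \<and> quality M j \<in> {0..1} \<and>
        prob_space (fit_prior M j) \<and> sets (fit_prior M j) = sets borel \<and>
        (AE p in fit_prior M j. p \<in> {0<..<1}) \<and> fit_prob M j \<in> msupport (fit_prior M j) \<and>
        prob_space (quality_prior M j) \<and> sets (quality_prior M j) = sets borel \<and>
        (AE x in quality_prior M j. x \<in> {0..1}) \<and> quality M j \<in> msupport (quality_prior M j) \<and>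
        (\<forall>i. (\<lambda>(h, u). price_rule M j i h u)
                \<in> borel_measurable (history_space M {..<i} \<Otimes>\<^sub>M borel)) \<and>
        (\<forall>i. \<forall>h\<in>space (history_space M {..<i}). \<forall>u\<in>{0..1}. 0 \<le> price_rule M j i h u) \<and>
        demand_responsive M j)"


subsection \<open>Learned businesses\<close>

text \<open>
  Along an infinite history \<open>H\<close>, the posteriors of \<open>(\<pi>\<^sub>j, Q\<^sub>j)\<close>, seen as laws of random points,
  converge in probability to the true parameters.
\<close>

definition learned :: "market \<Rightarrow> (nat \<Rightarrow> outcome) \<Rightarrow> nat \<Rightarrow> bool" where
  "learned M H j \<longleftrightarrow> (\<forall>\<epsilon>>0.
     (\<lambda>i. measure (posterior M j i (restrict H {..<i})) (ball (fit_prob M j, quality M j) \<epsilon>))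
       \<longlonglongrightarrow> 1)"

definition learned_set :: "market \<Rightarrow> (nat \<Rightarrow> outcome) \<Rightarrow> nat set" where
  "learned_set M H = {j. j < nbiz M \<and> learned M H j}"

definition learned_symmetric :: "market \<Rightarrow> bool" where
  "learned_symmetric M \<longleftrightarrow> (AE H in history_law M.
     \<forall>j\<in>learned_set M H. \<forall>k\<in>learned_set M H.
       fit_prob M j = fit_prob M k \<and> quality M j = quality M k)"


subsection \<open>Market equilibria and welfare\<close>

record equilibrium =
  limit_belief :: "nat \<Rightarrow> (real \<times> real) measure"
  price_dist :: "nat \<Rightarrow> real measure"

text \<open>A consumer's value and fits, independent of the prices \<open>P\<close> drawn from the equilibrium.\<close>

definition consumer_space :: "market \<Rightarrow> equilibrium \<Rightarrow>
    ((nat \<Rightarrow> real) \<times> real \<times> (nat \<Rightarrow> bool)) measure" where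
  "consumer_space M \<Phi> = PiM {..<nbiz M} (price_dist \<Phi>) \<Otimes>\<^sub>M (value_dist M \<Otimes>\<^sub>M
     PiM {..<nbiz M} (\<lambda>j. measure_pmf (bernoulli_pmf (fit_prob M j))))"

definition eq_index :: "market \<Rightarrow> equilibrium \<Rightarrow> (nat \<Rightarrow> real) \<Rightarrow> real \<Rightarrow> nat \<Rightarrow> real" where
  "eq_index M \<Phi> P V j = search_index M (P j) (limit_belief \<Phi> j) V"

text \<open>Expected revenue of \<open>j\<close> when it charges \<open>p\<close> and the others follow \<open>\<Phi>\<close>.\<close>

definition deviation_revenue :: "market \<Rightarrow> equilibrium \<Rightarrow> nat \<Rightarrow> real \<Rightarrow> real" where
  "deviation_revenue M \<Phi> j p =
     (\<integral>(P, V, F). (if transacts (nbiz M) (eq_index M \<Phi> (P(j := p)) V) F j then p else 0)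
        \<partial>consumer_space M \<Phi>)"

definition revenue :: "market \<Rightarrow> equilibrium \<Rightarrow> nat \<Rightarrow> real" where
  "revenue M \<Phi> j =
     (\<integral>(P, V, F). (if transacts (nbiz M) (eq_index M \<Phi> P V) F j then P j else 0)
        \<partial>consumer_space M \<Phi>)"

text \<open>Market equilibria with learned set \<open>S\<close>; the businesses outside \<open>S\<close> are lost.\<close>

definition market_equilibrium :: "market \<Rightarrow> nat set \<Rightarrow> equilibrium \<Rightarrow> bool" where
  "market_equilibrium M S \<Phi> \<longleftrightarrow> S \<subseteq> {..<nbiz M} \<and>
     (\<forall>j<nbiz M.
        prob_space (limit_belief \<Phi> j) \<and> sets (limit_belief \<Phi> j) = sets borel \<and>
        (AE \<theta> in limit_belief \<Phi> j. fst \<theta> \<in> {0<..<1} \<and> snd \<theta> \<in> {0..1}) \<and>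
        (if j \<in> S then limit_belief \<Phi> j = return borel (fit_prob M j, quality M j)
         else search_index M 0 (limit_belief \<Phi> j) (max_value M) \<le> 0) \<and>
        prob_space (price_dist \<Phi> j) \<and> sets (price_dist \<Phi> j) = sets borel \<and>
        (AE p in price_dist \<Phi> j. 0 \<le> p) \<and>
        (\<forall>p\<in>msupport (price_dist \<Phi> j). \<forall>p'\<ge>0.
           deviation_revenue M \<Phi> j p' \<le> deviation_revenue M \<Phi> j p))"

text \<open>
  The symmetric equilibrium \<open>\<Phi>(M, S)\<close> at the realized learned set \<open>S\<close>. It is a predicate
  because \<open>\<Phi>\<close> is unique only up to what has no effect on trade (what is believed about, and
  charged by, a business that is never inspected) and up to the choice of the monopoly price
  if a single learned business has several.
\<close>

definition canonical_equilibrium :: "market \<Rightarrow> (nat \<Rightarrow> outcome) \<Rightarrow> equilibrium \<Rightarrow> bool" where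
  "canonical_equilibrium M H \<Phi> \<longleftrightarrow> market_equilibrium M (learned_set M H) \<Phi> \<and>
     (\<forall>j\<in>learned_set M H. \<forall>k\<in>learned_set M H. price_dist \<Phi> j = price_dist \<Phi> k)"

definition consumer_welfare :: "market \<Rightarrow> equilibrium \<Rightarrow> real" where
  "consumer_welfare M \<Phi> = (\<integral>(P, V, F). (\<Sum>j<nbiz M.
       (if transacts (nbiz M) (eq_index M \<Phi> P V) F j then V * quality M j - P j else 0) -
       (if inspects (nbiz M) (eq_index M \<Phi> P V) F j then search_cost M else 0))
     \<partial>consumer_space M \<Phi>)"

definition total_welfare :: "market \<Rightarrow> equilibrium \<Rightarrow> real" where
  "total_welfare M \<Phi> = consumer_welfare M \<Phi> + (\<Sum>j<nbiz M. revenue M \<Phi> j)"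

definition coupling :: "('a \<times> 'b) measure \<Rightarrow> 'a measure \<Rightarrow> 'b measure \<Rightarrow> bool" where
  "coupling K A B \<longleftrightarrow> sets K = sets (A \<Otimes>\<^sub>M B) \<and> distr K A fst = A \<and> distr K B snd = B"

end

theory Submission
  imports Defs
begin

text \<open>
  The data on a business can be read from a tape of i.i.d. entries, one for each inspection, without
  changing the law of the history. Let both markets read the same tapes. If a business is
  learned in \<open>M\<close> and its true index at the maximal value is positive, then all posteriors along its
  tape have positive index at the high search cost. By demand responsiveness its price in
  \<open>Mt\<close> then leaves a margin of at least the cost difference, so that it is inspected infinitely often and
  is learned in \<open>Mt\<close> as well. Hence the learned set of \<open>Mt\<close> contains that of \<open>M\<close>, unless there is no trade in \<open>M\<close>.

  In a symmetric equilibrium the welfare depends only on the number \<open>n\<close> of learned businesses and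
  on the full price (price plus \<open>c / \<pi>\<close>) of the cheapest fitting one. Revealed preference of the business
  that loses all ties, applied to deviations between the two markets at equal full prices, shows that this full
  price decreases stochastically if \<open>n\<close> increases and \<open>c\<close> decreases.
\<close>

section \<open>Measure-preserving maps\<close>

text \<open>Sharing the shocks round by round would not couple the beliefs: a lower cost changes who
  is inspected and when, so the two consumers of a round see different businesses. If the data are
  indexed by inspections instead of rounds, the belief about a business is a function of its tape
  and of its number of inspections alone. Learning in \<open>Mt\<close> then only requires this
  number to tend to infinity.

  Since \<open>Mt\<close> differs from \<open>M\<close> only in the cost, both have the same price
  rules, and \<open>demand_responsive M\<close> constrains these after every history, including
  those that arise in \<open>Mt\<close>. This makes the index at the high cost and the maximal value
  positive, but by an amount that may shrink to zero over time. The fixed difference of the costs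
  supplies a margin that does not depend on the round, so that one event of positive probability,
  repeated independently, forces further inspections.\<close>

definition measure_preserving :: "'a measure \<Rightarrow> 'b measure \<Rightarrow> ('a \<Rightarrow> 'b) \<Rightarrow> bool" where
  "measure_preserving A B f \<longleftrightarrow> f \<in> A \<rightarrow>\<^sub>M B \<and> distr A B f = B"

lemma measure_preservingI:
  assumes [measurable]: "f \<in> A \<rightarrow>\<^sub>M B"
    and "\<And>g. g \<in> borel_measurable B \<Longrightarrow> (\<integral>\<^sup>+x. g (f x) \<partial>A) = (\<integral>\<^sup>+y. g y \<partial>B)"
  shows "measure_preserving A B f"
proof -
  have "distr A B f = B"
  proof (rule measure_eqI)
    fix X assume "X \<in> sets (distr A B f)"
    then have [measurable]: "X \<in> sets B" by simp
    have "emeasure (distr A B f) X = (\<integral>\<^sup>+y. indicator X y \<partial>distr A B f)" by simp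
    also have "\<dots> = (\<integral>\<^sup>+x. indicator X (f x) \<partial>A)" by (subst nn_integral_distr) auto
    also have "\<dots> = (\<integral>\<^sup>+y. indicator X y \<partial>B)" by (rule assms(2)) auto
    finally show "emeasure (distr A B f) X = emeasure B X" by simp
  qed simp
  then show ?thesis by (simp add: measure_preserving_def)
qed

lemma measure_preserving_nn_integral:
  assumes "measure_preserving A B f" "g \<in> borel_measurable B"
  shows "(\<integral>\<^sup>+x. g (f x) \<partial>A) = (\<integral>\<^sup>+y. g y \<partial>B)"
proof -
  have "(\<integral>\<^sup>+y. g y \<partial>B) = (\<integral>\<^sup>+y. g y \<partial>distr A B f)" using assms by (simp add: measure_preserving_def)
  also have "\<dots> = (\<integral>\<^sup>+x. g (f x) \<partial>A)"
    using assms by (intro nn_integral_distr) (auto simp: measure_preserving_def)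
  finally show ?thesis by simp
qed

lemma AE_measure_preserving:
  "measure_preserving A B f \<Longrightarrow> AE y in B. P y \<Longrightarrow> AE x in A. P (f x)"
  unfolding measure_preserving_def by (metis AE_distrD)

lemma measure_preserving_measurable: "measure_preserving A B f \<Longrightarrow> f \<in> A \<rightarrow>\<^sub>M B"
  by (simp add: measure_preserving_def)

lemma measure_preserving_comp:
  assumes "measure_preserving A B f" "measure_preserving B C g"
  shows "measure_preserving A C (\<lambda>x. g (f x))"
  using assms distr_distr[of g B C f A]
  by (auto simp: measure_preserving_def comp_def intro: measurable_compose)

lemma nn_integral_pair:
  assumes "prob_space B" "f \<in> borel_measurable (A \<Otimes>\<^sub>M B)"
  shows "(\<integral>\<^sup>+z. f z \<partial>(A \<Otimes>\<^sub>M B)) = (\<integral>\<^sup>+x. \<integral>\<^sup>+y. f (x, y) \<partial>B \<partial>A)"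
proof -
  interpret B: prob_space B by fact
  show ?thesis using assms(2) by (simp add: B.nn_integral_fst)
qed

lemma prob_space_pair_measure:
  assumes "prob_space A" "prob_space B"
  shows "prob_space (A \<Otimes>\<^sub>M B)"
proof -
  interpret A: prob_space A by fact
  interpret B: prob_space B by fact
  interpret pair_prob_space A B ..
  show ?thesis by unfold_locales
qed

lemma measure_preserving_id: "measure_preserving A A (\<lambda>x. x)"
  by (simp add: measure_preserving_def distr_id)

lemma measure_preserving_map_prod:
  assumes f: "measure_preserving A B f" and g: "measure_preserving C D g"
    and "prob_space C" "prob_space D"
  shows "measure_preserving (A \<Otimes>\<^sub>M C) (B \<Otimes>\<^sub>M D) (\<lambda>z. (f (fst z), g (snd z)))"
proof (rule measure_preservingI)
  note [measurable] = measure_preserving_measurable[OF f] measure_preserving_measurable[OF g]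
  interpret C: prob_space C by fact
  interpret D: prob_space D by fact
  show "(\<lambda>z. (f (fst z), g (snd z))) \<in> A \<Otimes>\<^sub>M C \<rightarrow>\<^sub>M B \<Otimes>\<^sub>M D" by measurable
  fix h :: "_ \<Rightarrow> ennreal" assume [measurable]: "h \<in> borel_measurable (B \<Otimes>\<^sub>M D)"
  have "(\<integral>\<^sup>+z. h (f (fst z), g (snd z)) \<partial>(A \<Otimes>\<^sub>M C)) = (\<integral>\<^sup>+x. \<integral>\<^sup>+y. h (f x, g y) \<partial>C \<partial>A)"
    by (subst nn_integral_pair[OF \<open>prob_space C\<close>]) auto
  also have "\<dots> = (\<integral>\<^sup>+x. \<integral>\<^sup>+y. h (f x, y) \<partial>D \<partial>A)"
  proof (rule nn_integral_cong)
    fix x assume "x \<in> space A"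
    then have "f x \<in> space B" using measurable_space[of f A B] by simp
    then show "(\<integral>\<^sup>+y. h (f x, g y) \<partial>C) = (\<integral>\<^sup>+y. h (f x, y) \<partial>D)"
      by (intro measure_preserving_nn_integral[OF g]) auto
  qed
  also have "\<dots> = (\<integral>\<^sup>+x. \<integral>\<^sup>+y. h (x, y) \<partial>D \<partial>B)"
    by (rule measure_preserving_nn_integral[OF f]) measurable
  also have "\<dots> = (\<integral>\<^sup>+z. h z \<partial>(B \<Otimes>\<^sub>M D))"
    by (rule nn_integral_pair[OF \<open>prob_space D\<close>, symmetric]) auto
  finally show "(\<integral>\<^sup>+z. h (f (fst z), g (snd z)) \<partial>(A \<Otimes>\<^sub>M C)) = (\<integral>\<^sup>+z. h z \<partial>(B \<Otimes>\<^sub>M D))" .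
qed

lemma measure_preserving_swap:
  assumes "prob_space A" "prob_space B"
  shows "measure_preserving (A \<Otimes>\<^sub>M B) (B \<Otimes>\<^sub>M A) (\<lambda>z. (snd z, fst z))"
proof -
  interpret A: prob_space A by fact
  interpret B: prob_space B by fact
  interpret pair_sigma_finite B A ..
  show ?thesis
    using distr_pair_swap by (simp add: measure_preserving_def split_beta')
qed

lemma measure_preserving_assoc:
  assumes "prob_space A" "prob_space B" "prob_space C"
  shows "measure_preserving ((A \<Otimes>\<^sub>M B) \<Otimes>\<^sub>M C) (A \<Otimes>\<^sub>M (B \<Otimes>\<^sub>M C))
      (\<lambda>z. (fst (fst z), (snd (fst z), snd z)))" (is ?L)
    and "measure_preserving (A \<Otimes>\<^sub>M (B \<Otimes>\<^sub>M C)) ((A \<Otimes>\<^sub>M B) \<Otimes>\<^sub>M C)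
      (\<lambda>z. ((fst z, fst (snd z)), snd (snd z)))" (is ?R)
proof -
  note [simp] = assms prob_space_pair_measure
  interpret C: prob_space C by fact
  interpret BC: prob_space "B \<Otimes>\<^sub>M C" by simp
  show ?L
  proof (rule measure_preservingI)
    fix h :: "_ \<Rightarrow> ennreal" assume [measurable]: "h \<in> borel_measurable (A \<Otimes>\<^sub>M (B \<Otimes>\<^sub>M C))"
    show "(\<integral>\<^sup>+z. h (fst (fst z), (snd (fst z), snd z)) \<partial>((A \<Otimes>\<^sub>M B) \<Otimes>\<^sub>M C)) =
      (\<integral>\<^sup>+z. h z \<partial>(A \<Otimes>\<^sub>M (B \<Otimes>\<^sub>M C)))"
      by (auto simp: nn_integral_pair intro!: nn_integral_cong)
  qed simp
  show ?R
  proof (rule measure_preservingI)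
    fix h :: "_ \<Rightarrow> ennreal" assume [measurable]: "h \<in> borel_measurable ((A \<Otimes>\<^sub>M B) \<Otimes>\<^sub>M C)"
    show "(\<integral>\<^sup>+z. h ((fst z, fst (snd z)), snd (snd z)) \<partial>(A \<Otimes>\<^sub>M (B \<Otimes>\<^sub>M C))) =
      (\<integral>\<^sup>+z. h z \<partial>((A \<Otimes>\<^sub>M B) \<Otimes>\<^sub>M C))"
      by (auto simp: nn_integral_pair intro!: nn_integral_cong)
  qed simp
qed

context
  fixes A :: "'a measure" and B :: "'b measure" and X :: "'x measure" and \<psi>
  assumes P: "prob_space A" "prob_space B" "prob_space X"
    and \<psi>: "measure_preserving (A \<Otimes>\<^sub>M X) (A \<Otimes>\<^sub>M X) \<psi>"
begin

text \<open>Shocks and tapes are nested pairs, while an exchange concerns one component of each.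
  Here \<open>A\<close> is a component of the shock, \<open>X\<close> the matching component of the
  tape and \<psi> will be \<open>read_heads\<close>; this lemma and the next three carry \<psi> out
  through the nesting by swaps and reassociations.\<close>

lemma measure_preserving_on_fst_right:
  "measure_preserving (A \<Otimes>\<^sub>M (X \<Otimes>\<^sub>M B)) (A \<Otimes>\<^sub>M (X \<Otimes>\<^sub>M B))
    (\<lambda>z. let y = \<psi> (fst z, fst (snd z)) in (fst y, (snd y, snd (snd z))))"
  using measure_preserving_comp[OF measure_preserving_assoc(2)[OF P(1,3,2)]
      measure_preserving_comp[OF measure_preserving_map_prod[OF \<psi> measure_preserving_id P(2,2)]
        measure_preserving_assoc(1)[OF P(1,3,2)]]]
  by (simp add: Let_def)

lemma measure_preserving_on_snd_right:
  "measure_preserving (A \<Otimes>\<^sub>M (B \<Otimes>\<^sub>M X)) (A \<Otimes>\<^sub>M (B \<Otimes>\<^sub>M X))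
    (\<lambda>z. let y = \<psi> (fst z, snd (snd z)) in (fst y, (fst (snd z), snd y)))"
proof -
  note PP = prob_space_pair_measure[OF P(2,3)] prob_space_pair_measure[OF P(3,2)]
  show ?thesis
  using measure_preserving_comp[OF
      measure_preserving_map_prod[OF measure_preserving_id measure_preserving_swap[OF P(2,3)] PP]
      measure_preserving_comp[OF measure_preserving_on_fst_right
      measure_preserving_map_prod[OF measure_preserving_id measure_preserving_swap[OF P(3,2)] PP(2,1)]]]
  by (simp add: Let_def)
qed

lemma measure_preserving_on_fst_left:
  "measure_preserving ((A \<Otimes>\<^sub>M B) \<Otimes>\<^sub>M X) ((A \<Otimes>\<^sub>M B) \<Otimes>\<^sub>M X)
    (\<lambda>z. let y = \<psi> (fst (fst z), snd z) in ((fst y, snd (fst z)), snd y))"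
  using measure_preserving_comp[OF measure_preserving_assoc(1)[OF P]
      measure_preserving_comp[OF measure_preserving_on_snd_right measure_preserving_assoc(2)[OF P]]]
  by (simp add: Let_def)

lemma measure_preserving_on_snd_left:
  "measure_preserving ((B \<Otimes>\<^sub>M A) \<Otimes>\<^sub>M X) ((B \<Otimes>\<^sub>M A) \<Otimes>\<^sub>M X)
    (\<lambda>z. let y = \<psi> (snd (fst z), snd z) in ((fst (fst z), fst y), snd y))"
  using measure_preserving_comp[OF measure_preserving_assoc(1)[OF P(2,1,3)]
      measure_preserving_comp[OF measure_preserving_map_prod[OF measure_preserving_id \<psi>]
        measure_preserving_assoc(2)[OF P(2,1,3)]]] prob_space_pair_measure[OF P(1,3)]
  by (simp add: Let_def)

end

text \<open>The choice \<open>i x\<close> of the map may depend on the very data that the map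
  rearranges. The label \<open>l\<close> recovers the choice from the image: the piece where
  \<open>f k\<close> is used is the preimage of \<open>{l = k}\<close> under \<open>f k\<close>, so
  each piece can be integrated over its image, and the images partition \<open>B\<close>.\<close>

lemma measure_preserving_piecewise:
  assumes K: "finite K"
    and mp: "\<And>k. k \<in> K \<Longrightarrow> measure_preserving A B (f k)"
    and meas: "(\<lambda>x. f (i x) x) \<in> A \<rightarrow>\<^sub>M B"
    and k[measurable]: "\<And>k. k \<in> K \<Longrightarrow> {y \<in> space B. l y = k} \<in> sets B"
    and ik: "\<And>x. x \<in> space A \<Longrightarrow> i x \<in> K" "\<And>y. y \<in> space B \<Longrightarrow> l y \<in> K"
    and il: "\<And>x k. x \<in> space A \<Longrightarrow> k \<in> K \<Longrightarrow> i x = k \<longleftrightarrow> l (f k x) = k"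
  shows "measure_preserving A B (\<lambda>x. f (i x) x)"
proof (rule measure_preservingI[OF meas])
  fix g :: "_ \<Rightarrow> ennreal" assume [measurable]: "g \<in> borel_measurable B"
  let ?h = "\<lambda>k y. g y * indicator {y \<in> space B. l y = k} y"
  have fB: "f k x \<in> space B" if "k \<in> K" "x \<in> space A" for k x
    using measurable_space[OF measure_preserving_measurable[OF mp]] that by blast
  have "(\<integral>\<^sup>+x. g (f (i x) x) \<partial>A) = (\<integral>\<^sup>+x. (\<Sum>k\<in>K. ?h k (f k x)) \<partial>A)"
  proof (rule nn_integral_cong)
    fix x assume x: "x \<in> space A"
    have "(\<Sum>k\<in>K. ?h k (f k x)) = (\<Sum>k\<in>K. if k = i x then g (f k x) else 0)"
    proof (intro sum.cong refl)
      fix k assume "k \<in> K"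
      then show "?h k (f k x) = (if k = i x then g (f k x) else 0)"
        using il[OF x, of k] fB[OF _ x, of k] by (simp add: indicator_def eq_commute)
    qed
    also have "\<dots> = g (f (i x) x)" using K ik(1)[OF x] by simp
    finally show "g (f (i x) x) = (\<Sum>k\<in>K. ?h k (f k x))" by simp
  qed
  also have "\<dots> = (\<Sum>k\<in>K. \<integral>\<^sup>+x. ?h k (f k x) \<partial>A)"
    by (intro nn_integral_sum measurable_compose[OF measure_preserving_measurable[OF mp]]) auto
  also have "\<dots> = (\<Sum>k\<in>K. \<integral>\<^sup>+y. ?h k y \<partial>B)"
    by (intro sum.cong measure_preserving_nn_integral[OF mp]) auto
  also have "\<dots> = (\<integral>\<^sup>+y. (\<Sum>k\<in>K. ?h k y) \<partial>B)"
    by (intro nn_integral_sum[symmetric]) auto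
  also have "\<dots> = (\<integral>\<^sup>+y. g y \<partial>B)"
  proof (rule nn_integral_cong)
    fix y assume y: "y \<in> space B"
    have "(\<Sum>k\<in>K. ?h k y) = (\<Sum>k\<in>K. if k = l y then g y else 0)"
      using y by (intro sum.cong) (auto simp: indicator_def)
    also have "\<dots> = g y" using K ik(2)[OF y] by simp
    finally show "(\<Sum>k\<in>K. ?h k y) = g y" .
  qed
  finally show "(\<integral>\<^sup>+x. g (f (i x) x) \<partial>A) = (\<integral>\<^sup>+y. g y \<partial>B)" .
qed

lemma measure_preserving_fibrewise:
  assumes "prob_space B" "prob_space C"
    and [measurable]: "case_prod f \<in> A \<Otimes>\<^sub>M B \<rightarrow>\<^sub>M C"
    and mp: "\<And>x. x \<in> space A \<Longrightarrow> measure_preserving B C (f x)"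
  shows "measure_preserving (A \<Otimes>\<^sub>M B) (A \<Otimes>\<^sub>M C) (\<lambda>z. (fst z, f (fst z) (snd z)))"
proof (rule measure_preservingI)
  interpret B: prob_space B by fact
  interpret C: prob_space C by fact
  show [measurable]: "(\<lambda>z. (fst z, f (fst z) (snd z))) \<in> A \<Otimes>\<^sub>M B \<rightarrow>\<^sub>M A \<Otimes>\<^sub>M C"
    using assms(3) by (simp add: split_beta')
  fix g :: "_ \<Rightarrow> ennreal" assume [measurable]: "g \<in> borel_measurable (A \<Otimes>\<^sub>M C)"
  have "(\<integral>\<^sup>+z. g (fst z, f (fst z) (snd z)) \<partial>(A \<Otimes>\<^sub>M B)) = (\<integral>\<^sup>+x. \<integral>\<^sup>+y. g (x, f x y) \<partial>B \<partial>A)"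
    by (subst nn_integral_pair) (use \<open>prob_space B\<close> in auto)
  also have "\<dots> = (\<integral>\<^sup>+x. \<integral>\<^sup>+y. g (x, y) \<partial>C \<partial>A)"
    by (intro nn_integral_cong measure_preserving_nn_integral[OF mp]) auto
  also have "\<dots> = (\<integral>\<^sup>+z. g z \<partial>(A \<Otimes>\<^sub>M C))"
    by (rule nn_integral_pair[symmetric]) (use \<open>prob_space C\<close> in auto)
  finally show "(\<integral>\<^sup>+z. g (fst z, f (fst z) (snd z)) \<partial>(A \<Otimes>\<^sub>M B)) = (\<integral>\<^sup>+z. g z \<partial>(A \<Otimes>\<^sub>M C))" .
qed

section \<open>Finite products and i.i.d. sequences\<close>

lemma measure_preserving_zip:
  assumes J: "finite J" and A: "\<And>j. prob_space (A j)" and B: "\<And>j. prob_space (B j)"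
  shows "measure_preserving (PiM J A \<Otimes>\<^sub>M PiM J B) (PiM J (\<lambda>j. A j \<Otimes>\<^sub>M B j))
    (\<lambda>z. \<lambda>j\<in>J. (fst z j, snd z j))" (is "measure_preserving ?D ?E ?f")
proof -
  have [measurable]: "?f \<in> ?D \<rightarrow>\<^sub>M ?E" by measurable
  note [simp] = A B
  interpret A: product_prob_space A J
    using A by (simp add: product_prob_space_def product_sigma_finite_def
        product_prob_space_axioms_def prob_space_imp_sigma_finite)
  interpret B: product_prob_space B J
    using B by (simp add: product_prob_space_def product_sigma_finite_def
        product_prob_space_axioms_def prob_space_imp_sigma_finite)
  interpret AB: product_sigma_finite "\<lambda>j. A j \<Otimes>\<^sub>M B j"
    by (simp add: product_sigma_finite_def prob_space_imp_sigma_finite prob_space_pair_measure)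
  have "distr ?D ?E ?f = ?E"
  proof (rule AB.PiM_eqI[OF J])
    fix X assume X: "\<And>j. j \<in> J \<Longrightarrow> X j \<in> sets (A j \<Otimes>\<^sub>M B j)"
    note [measurable] = X
    have "emeasure (distr ?D ?E ?f) (Pi\<^sub>E J X) =
        (\<integral>\<^sup>+z. (\<Prod>j\<in>J. indicator (X j) (fst z j, snd z j)) \<partial>?D)"
    proof -
      have "emeasure (distr ?D ?E ?f) (Pi\<^sub>E J X) = emeasure ?D (?f -` Pi\<^sub>E J X \<inter> space ?D)"
        using J X by (intro emeasure_distr) (auto intro!: sets_PiM_I_finite)
      also have "\<dots> = (\<integral>\<^sup>+z. indicator (?f -` Pi\<^sub>E J X \<inter> space ?D) z \<partial>?D)"
        using J X by (intro nn_integral_indicator[symmetric] measurable_sets[of ?f ?D ?E]) (auto intro!: sets_PiM_I_finite)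
      also have "\<dots> = (\<integral>\<^sup>+z. (\<Prod>j\<in>J. indicator (X j) (fst z j, snd z j)) \<partial>?D)"
      proof (rule nn_integral_cong)
        fix z assume "z \<in> space ?D"
        then have "indicator (?f -` Pi\<^sub>E J X \<inter> space ?D) z = (if \<forall>j\<in>J. (fst z j, snd z j) \<in> X j then 1 else 0::ennreal)"
          by (auto simp: indicator_def PiE_iff)
        also have "\<dots> = (\<Prod>j\<in>J. indicator (X j) (fst z j, snd z j))"
          using J by (auto simp: indicator_def)
        finally show "indicator (?f -` Pi\<^sub>E J X \<inter> space ?D) z =
            (\<Prod>j\<in>J. indicator (X j) (fst z j, snd z j)::ennreal)" .
      qed
      finally show ?thesis .
    qed
    also have "\<dots> = (\<integral>\<^sup>+x. \<integral>\<^sup>+y. (\<Prod>j\<in>J. indicator (X j) (x j, y j)) \<partial>PiM J B \<partial>PiM J A)"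
      by (subst nn_integral_pair) (auto intro!: prob_space_PiM borel_measurable_prod)
    also have "\<dots> = (\<integral>\<^sup>+x. (\<Prod>j\<in>J. \<integral>\<^sup>+y. indicator (X j) (x j, y) \<partial>B j) \<partial>PiM J A)"
    proof (rule nn_integral_cong)
      fix x assume "x \<in> space (PiM J A)"
      then have "\<And>j. j \<in> J \<Longrightarrow> x j \<in> space (A j)" by (auto simp: space_PiM)
      then show "(\<integral>\<^sup>+y. (\<Prod>j\<in>J. indicator (X j) (x j, y j)) \<partial>PiM J B) =
          (\<Prod>j\<in>J. \<integral>\<^sup>+y. indicator (X j) (x j, y) \<partial>B j)"
        using J by (intro B.product_nn_integral_prod) auto
    qed
    also have "\<dots> = (\<Prod>j\<in>J. \<integral>\<^sup>+x. \<integral>\<^sup>+y. indicator (X j) (x, y) \<partial>B j \<partial>A j)"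
      using J by (intro A.product_nn_integral_prod) auto
    also have "\<dots> = (\<Prod>j\<in>J. emeasure (A j \<Otimes>\<^sub>M B j) (X j))"
      by (intro prod.cong refl) (subst nn_integral_pair[symmetric]; simp)
    finally show "emeasure (distr ?D ?E ?f) (Pi\<^sub>E J X) = (\<Prod>j\<in>J. emeasure (A j \<Otimes>\<^sub>M B j) (X j))" .
  qed simp
  then show ?thesis by (simp add: measure_preserving_def)
qed

lemma measure_preserving_unzip:
  assumes J: "finite J" and A: "\<And>j. prob_space (A j)" and B: "\<And>j. prob_space (B j)"
  shows "measure_preserving (PiM J (\<lambda>j. A j \<Otimes>\<^sub>M B j)) (PiM J A \<Otimes>\<^sub>M PiM J B)
    (\<lambda>x. (\<lambda>j\<in>J. fst (x j), \<lambda>j\<in>J. snd (x j)))"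
proof (rule measure_preservingI)
  show "(\<lambda>x. (\<lambda>j\<in>J. fst (x j), \<lambda>j\<in>J. snd (x j))) \<in>
      PiM J (\<lambda>j. A j \<Otimes>\<^sub>M B j) \<rightarrow>\<^sub>M PiM J A \<Otimes>\<^sub>M PiM J B" by measurable
  fix g :: "_ \<Rightarrow> ennreal" assume [measurable]: "g \<in> borel_measurable (PiM J A \<Otimes>\<^sub>M PiM J B)"
  \<comment> \<open>Integrate over the zipped measure instead: there unzipping undoes the map that
    produced it, and no second computation on boxes is required.\<close>
  have "(\<integral>\<^sup>+x. g (\<lambda>j\<in>J. fst (x j), \<lambda>j\<in>J. snd (x j)) \<partial>PiM J (\<lambda>j. A j \<Otimes>\<^sub>M B j)) =
    (\<integral>\<^sup>+z. g (\<lambda>j\<in>J. fst ((\<lambda>j\<in>J. (fst z j, snd z j)) j),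
      \<lambda>j\<in>J. snd ((\<lambda>j\<in>J. (fst z j, snd z j)) j)) \<partial>(PiM J A \<Otimes>\<^sub>M PiM J B))"
    by (rule measure_preserving_nn_integral[OF measure_preserving_zip[OF assms], symmetric]) measurable
  also have "\<dots> = (\<integral>\<^sup>+z. g z \<partial>(PiM J A \<Otimes>\<^sub>M PiM J B))"
  proof (rule nn_integral_cong)
    fix z assume "z \<in> space (PiM J A \<Otimes>\<^sub>M PiM J B)"
    then have "restrict (fst z) J = fst z" "restrict (snd z) J = snd z"
      by (auto simp: space_pair_measure space_PiM PiE_restrict)
    then show "g (\<lambda>j\<in>J. fst ((\<lambda>j\<in>J. (fst z j, snd z j)) j),
      \<lambda>j\<in>J. snd ((\<lambda>j\<in>J. (fst z j, snd z j)) j)) = g z"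
      by (simp add: restrict_def cong: if_cong)
  qed
  finally show "(\<integral>\<^sup>+x. g (\<lambda>j\<in>J. fst (x j), \<lambda>j\<in>J. snd (x j)) \<partial>PiM J (\<lambda>j. A j \<Otimes>\<^sub>M B j)) =
    (\<integral>\<^sup>+z. g z \<partial>(PiM J A \<Otimes>\<^sub>M PiM J B))" .
qed

lemma measure_preserving_PiM:
  assumes J: "finite J" and A: "\<And>j. prob_space (A j)" and B: "\<And>j. prob_space (B j)"
    and f: "\<And>j. j \<in> J \<Longrightarrow> measure_preserving (A j) (B j) (f j)"
  shows "measure_preserving (PiM J A) (PiM J B) (\<lambda>x. \<lambda>j\<in>J. f j (x j))"
proof -
  have [measurable]: "\<And>j. j \<in> J \<Longrightarrow> f j \<in> A j \<rightarrow>\<^sub>M B j"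
    by (rule measure_preserving_measurable[OF f])
  have [measurable]: "(\<lambda>x. \<lambda>j\<in>J. f j (x j)) \<in> PiM J A \<rightarrow>\<^sub>M PiM J B" by measurable
  interpret A: product_sigma_finite A
    using A by (simp add: product_sigma_finite_def prob_space_imp_sigma_finite)
  interpret B: product_sigma_finite B
    using B by (simp add: product_sigma_finite_def prob_space_imp_sigma_finite)
  have "distr (PiM J A) (PiM J B) (\<lambda>x. \<lambda>j\<in>J. f j (x j)) = PiM J B"
  proof (rule B.PiM_eqI[OF J])
    fix X assume X: "\<And>j. j \<in> J \<Longrightarrow> X j \<in> sets (B j)"
    have "emeasure (distr (PiM J A) (PiM J B) (\<lambda>x. \<lambda>j\<in>J. f j (x j))) (Pi\<^sub>E J X) =
      emeasure (PiM J A) ((\<lambda>x. \<lambda>j\<in>J. f j (x j)) -` Pi\<^sub>E J X \<inter> space (PiM J A))"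
      using J X by (intro emeasure_distr) (auto intro!: sets_PiM_I_finite)
    also have "(\<lambda>x. \<lambda>j\<in>J. f j (x j)) -` Pi\<^sub>E J X \<inter> space (PiM J A) =
      Pi\<^sub>E J (\<lambda>j. f j -` X j \<inter> space (A j))"
      by (auto simp: space_PiM PiE_iff)
    also have "emeasure (PiM J A) \<dots> = (\<Prod>j\<in>J. emeasure (A j) (f j -` X j \<inter> space (A j)))"
      using J X by (intro A.emeasure_PiM) auto
    also have "\<dots> = (\<Prod>j\<in>J. emeasure (B j) (X j))"
    proof (intro prod.cong refl)
      fix j assume j: "j \<in> J"
      then have "emeasure (A j) (f j -` X j \<inter> space (A j)) = emeasure (distr (A j) (B j) (f j)) (X j)"
        using X by (intro emeasure_distr[symmetric]) auto
      then show "emeasure (A j) (f j -` X j \<inter> space (A j)) = emeasure (B j) (X j)"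
        using f[OF j] by (simp add: measure_preserving_def)
    qed
    finally show "emeasure (distr (PiM J A) (PiM J B) (\<lambda>x. \<lambda>j\<in>J. f j (x j))) (Pi\<^sub>E J X) =
      (\<Prod>j\<in>J. emeasure (B j) (X j))" .
  qed simp
  then show ?thesis by (simp add: measure_preserving_def)
qed

definition read_heads :: "'i set \<Rightarrow> 'i set \<Rightarrow> ('i \<Rightarrow> 'a) \<times> ('i \<Rightarrow> nat \<Rightarrow> 'a) \<Rightarrow> ('i \<Rightarrow> 'a) \<times> ('i \<Rightarrow> nat \<Rightarrow> 'a)" where
  "read_heads J I = (\<lambda>(x, T). (\<lambda>j\<in>J. if j \<in> I then T j 0 else x j,
     \<lambda>j\<in>J. if j \<in> I then (\<lambda>k. T j (Suc k)) else T j))"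

lemma measure_preserving_uncons:
  assumes "prob_space A"
  shows "measure_preserving (PiM UNIV (\<lambda>_::nat. A)) (A \<Otimes>\<^sub>M PiM UNIV (\<lambda>_::nat. A))
    (\<lambda>T. (T 0, \<lambda>k. T (Suc k)))"
proof -
  interpret sequence_space A
    using assms by (simp add: sequence_space_def product_prob_space_def product_sigma_finite_def
        product_prob_space_axioms_def prob_space_imp_sigma_finite)
  have [measurable]: "(\<lambda>T. (T 0, \<lambda>k. T (Suc k))) \<in> S \<rightarrow>\<^sub>M A \<Otimes>\<^sub>M S"
    by (intro measurable_Pair measurable_PiM_single') (auto simp: space_PiM)
  have "distr S (A \<Otimes>\<^sub>M S) (\<lambda>T. (T 0, \<lambda>k. T (Suc k))) =
    distr (distr (A \<Otimes>\<^sub>M S) S (\<lambda>(s, \<omega>). case_nat s \<omega>)) (A \<Otimes>\<^sub>M S) (\<lambda>T. (T 0, \<lambda>k. T (Suc k)))"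
    by (subst PiM_iter) simp
  also have "\<dots> = distr (A \<Otimes>\<^sub>M S) (A \<Otimes>\<^sub>M S) (\<lambda>z. z)"
    by (subst distr_distr) (auto simp: comp_def split_beta' intro!: distr_cong)
  finally show ?thesis by (simp add: measure_preserving_def distr_id)
qed

lemma measure_preserving_snd:
  assumes "prob_space A" "prob_space B"
  shows "measure_preserving (A \<Otimes>\<^sub>M B) B snd"
proof -
  interpret A: prob_space A by fact
  show ?thesis
    by (rule measure_preservingI) (auto simp: nn_integral_pair[OF assms(2)] A.emeasure_space_1)
qed

text \<open>For an index in \<open>I\<close> the entry is discarded and replaced by an independent
  one of the same law, and the tail of an i.i.d. sequence is again such a sequence, independent of
  its head. Coordinates do not interact, so entries and tapes are zipped and each coordinate is
  treated alone.\<close>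

lemma measure_preserving_read_heads:
  assumes J: "finite J" and A: "\<And>j. prob_space (A j)"
  shows "measure_preserving (PiM J A \<Otimes>\<^sub>M PiM J (\<lambda>j. PiM UNIV (\<lambda>_. A j)))
    (PiM J A \<Otimes>\<^sub>M PiM J (\<lambda>j. PiM UNIV (\<lambda>_. A j))) (read_heads J I)"
    (is "measure_preserving (?X \<Otimes>\<^sub>M ?T) _ _")
proof -
  let ?S = "\<lambda>j. PiM UNIV (\<lambda>_::nat. A j)"
  have S: "\<And>j. prob_space (?S j)" by (intro prob_space_PiM A)
  let ?u = "\<lambda>j z. if j \<in> I then (snd z 0, \<lambda>k. snd z (Suc k)) else z"
  have u: "measure_preserving (A j \<Otimes>\<^sub>M ?S j) (A j \<Otimes>\<^sub>M ?S j) (?u j)" for j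
    using measure_preserving_comp[OF measure_preserving_snd[OF A[of j] S[of j]]
        measure_preserving_uncons[OF A[of j]]] measure_preserving_id
    by (cases "j \<in> I") (simp_all)
  have "measure_preserving (?X \<Otimes>\<^sub>M ?T) (?X \<Otimes>\<^sub>M ?T)
     (\<lambda>x. let y = \<lambda>j\<in>J. ?u j ((\<lambda>j\<in>J. (fst x j, snd x j)) j) in (\<lambda>j\<in>J. fst (y j), \<lambda>j\<in>J. snd (y j)))"
    unfolding Let_def
    by (rule measure_preserving_comp[OF measure_preserving_zip[OF J A S]
        measure_preserving_comp[OF measure_preserving_PiM[OF J _ _ u] measure_preserving_unzip[OF J A S]]])
       (auto intro!: prob_space_pair_measure A S)
  then show ?thesis
    by (rule back_subst[where P = "measure_preserving _ _"])
      (auto simp: read_heads_def split_beta' restrict_def fun_eq_iff)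
qed

text \<open>The state after \<open>i\<close> rounds is a function of the shocks before round
  \<open>i\<close> and of the initial randomness \<open>Z\<close> (later the tapes). Hence it is
  independent of shock \<open>i\<close>, and its law evolves by the kernel
  \<open>f i\<close>.\<close>

lemma driven_process_law:
  fixes X :: "nat \<Rightarrow> (nat \<Rightarrow> 's) \<times> 'z \<Rightarrow> 'x"
  assumes A: "prob_space A" and Z: "prob_space Z"
    and X: "\<And>i. X i \<in> PiM UNIV (\<lambda>_. A) \<Otimes>\<^sub>M Z \<rightarrow>\<^sub>M L i"
    and causal: "\<And>i \<omega> \<omega>' z. (\<forall>r<i. \<omega> r = \<omega>' r) \<Longrightarrow> X i (\<omega>, z) = X i (\<omega>', z)"
    and step: "\<And>i \<omega> z. X (Suc i) (\<omega>, z) = f i (X i (\<omega>, z), \<omega> i)"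
    and zero: "measure_preserving (PiM UNIV (\<lambda>_. A) \<Otimes>\<^sub>M Z) (L 0) (X 0)"
    and f: "\<And>i. measure_preserving (L i \<Otimes>\<^sub>M A) (L (Suc i)) (f i)"
  shows "measure_preserving (PiM UNIV (\<lambda>_. A) \<Otimes>\<^sub>M Z) (L i) (X i)"
    and "measure_preserving (PiM UNIV (\<lambda>_. A) \<Otimes>\<^sub>M Z) (L i \<Otimes>\<^sub>M A) (\<lambda>z. (X i z, fst z i))"
proof -
  let ?S = "PiM UNIV (\<lambda>_::nat. A)"
  interpret sequence_space A
    using A by (simp add: sequence_space_def product_prob_space_def product_sigma_finite_def
        product_prob_space_axioms_def prob_space_imp_sigma_finite)
  have S: "prob_space S" by (intro prob_space_PiM A)
  note PS = prob_space_pair_measure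
  have joint: "measure_preserving (?S \<Otimes>\<^sub>M Z) (L i \<Otimes>\<^sub>M A) (\<lambda>z. (X i z, fst z i))"
    if Xi: "measure_preserving (?S \<Otimes>\<^sub>M Z) (L i) (X i)" for i
  proof (rule measure_preservingI)
    note [measurable] = X
    show "(\<lambda>z. (X i z, fst z i)) \<in> ?S \<Otimes>\<^sub>M Z \<rightarrow>\<^sub>M L i \<Otimes>\<^sub>M A" by measurable
    fix g :: "_ \<Rightarrow> ennreal" assume [measurable]: "g \<in> borel_measurable (L i \<Otimes>\<^sub>M A)"
    \<comment> \<open>Resample the shocks from round \<open>i\<close> on. By causality
      \<open>X i\<close> does not notice, while shock \<open>i\<close> becomes entry 0 of a separate
      independent sequence; this exhibits the independence.\<close>
    have comb: "measure_preserving (?S \<Otimes>\<^sub>M ?S) ?S (\<lambda>z. comb_seq i (fst z) (snd z))"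
      using PiM_comb_seq[of i] measurable_comb_seq[of i A]
      by (simp add: measure_preserving_def split_beta')
    have "(\<integral>\<^sup>+z. g (X i z, fst z i) \<partial>(?S \<Otimes>\<^sub>M Z)) =
      (\<integral>\<^sup>+w. g (X i (comb_seq i (fst (fst w)) (snd (fst w)), snd w),
         comb_seq i (fst (fst w)) (snd (fst w)) i) \<partial>((?S \<Otimes>\<^sub>M ?S) \<Otimes>\<^sub>M Z))"
      using measure_preserving_nn_integral[OF measure_preserving_map_prod[OF comb measure_preserving_id Z Z],
          of "\<lambda>z. g (X i z, fst z i)"] by simp
    also have "\<dots> = (\<integral>\<^sup>+w. g (X i (fst (fst w), snd w), snd (fst w) 0) \<partial>((?S \<Otimes>\<^sub>M ?S) \<Otimes>\<^sub>M Z))"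
    proof (rule nn_integral_cong)
      fix w :: "((nat \<Rightarrow> 's) \<times> (nat \<Rightarrow> 's)) \<times> 'z"
      have "X i (comb_seq i (fst (fst w)) (snd (fst w)), snd w) = X i (fst (fst w), snd w)"
        by (rule causal) (simp add: comb_seq_def)
      moreover have "comb_seq i (fst (fst w)) (snd (fst w)) i = snd (fst w) 0"
        by (simp add: comb_seq_def)
      ultimately show "g (X i (comb_seq i (fst (fst w)) (snd (fst w)), snd w),
         comb_seq i (fst (fst w)) (snd (fst w)) i) = g (X i (fst (fst w), snd w), snd (fst w) 0)" by simp
    qed
    also have "\<dots> = (\<integral>\<^sup>+w. g (X i (fst w), snd w 0) \<partial>((?S \<Otimes>\<^sub>M Z) \<Otimes>\<^sub>M ?S))"
    proof -
      have "measure_preserving ((?S \<Otimes>\<^sub>M Z) \<Otimes>\<^sub>M ?S) ((?S \<Otimes>\<^sub>M ?S) \<Otimes>\<^sub>M Z)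
        (\<lambda>z. ((fst (fst z), snd z), snd (fst z)))"
        using measure_preserving_comp[OF measure_preserving_assoc(1)[OF S Z S]
           measure_preserving_comp[OF measure_preserving_map_prod[OF measure_preserving_id
             measure_preserving_swap[OF Z S] PS[OF Z S] PS[OF S Z]]
             measure_preserving_assoc(2)[OF S S Z]]] by simp
      from measure_preserving_nn_integral[OF this,
          of "\<lambda>w. g (X i (fst (fst w), snd w), snd (fst w) 0)"]
      show ?thesis by simp
    qed
    also have "\<dots> = (\<integral>\<^sup>+y. g y \<partial>(L i \<Otimes>\<^sub>M A))"
    proof -
      have "measure_preserving S A (\<lambda>\<omega>. \<omega> 0)"
        using PiM_component[of 0] by (simp add: measure_preserving_def)
      from measure_preserving_nn_integral[OF measure_preserving_map_prod[OF Xi this S A], of g]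
      show ?thesis by simp
    qed
    finally show "(\<integral>\<^sup>+z. g (X i z, fst z i) \<partial>(?S \<Otimes>\<^sub>M Z)) = (\<integral>\<^sup>+y. g y \<partial>(L i \<Otimes>\<^sub>M A))" .
  qed
  show i: "measure_preserving (?S \<Otimes>\<^sub>M Z) (L i) (X i)" for i
  proof (induction i)
    case (Suc i)
    have "X (Suc i) = (\<lambda>z. f i (X i z, fst z i))"
      by (rule ext) (metis step prod.collapse)
    then show ?case
      using measure_preserving_comp[OF joint[OF Suc] f[of i]] by simp
  qed (fact zero)
  show "measure_preserving (?S \<Otimes>\<^sub>M Z) (L i \<Otimes>\<^sub>M A) (\<lambda>z. (X i z, fst z i))"
    by (rule joint[OF i])
qed

section \<open>Sequential search and the observations it generates\<close>

lemma precedes_trans: "precedes \<sigma> l k \<Longrightarrow> precedes \<sigma> k j \<Longrightarrow> precedes \<sigma> l j"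
  by (auto simp: precedes_def)

lemma precedes_total: "j \<noteq> k \<Longrightarrow> precedes \<sigma> j k \<or> precedes \<sigma> k j"
  by (auto simp: precedes_def)

lemma transacts_unique: "transacts m \<sigma> F j \<Longrightarrow> transacts m \<sigma> F k \<Longrightarrow> j = k"
  using precedes_total[of j k \<sigma>] by (auto simp: transacts_def inspects_def)

text \<open>The witness is the first element in the order \<open>precedes\<close> among the fitting
  businesses of positive index: the smallest number among those attaining the maximal index.\<close>

lemma exists_transacts:
  assumes "k < m" "\<sigma> k > 0" "F k"
  obtains j where "transacts m \<sigma> F j" "\<sigma> k \<le> \<sigma> j" "j = k \<or> precedes \<sigma> j k"
proof -
  define A where "A = {k. k < m \<and> \<sigma> k > 0 \<and> F k}"
  have fin: "finite (\<sigma> ` A)" and kA: "k \<in> A" using assms by (auto simp: A_def)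
  define j where "j = (LEAST j. j \<in> A \<and> \<sigma> j = Max (\<sigma> ` A))"
  have "Max (\<sigma> ` A) \<in> \<sigma> ` A" using fin kA by (intro Max_in) auto
  then have "\<exists>j. j \<in> A \<and> \<sigma> j = Max (\<sigma> ` A)" by force
  from LeastI_ex[OF this] have j: "j \<in> A" "\<sigma> j = Max (\<sigma> ` A)" by (auto simp: j_def)
  have max: "\<sigma> l \<le> \<sigma> j" if "l \<in> A" for l using that fin by (simp add: j)
  have least: "j \<le> l" if "l \<in> A" "\<sigma> l = \<sigma> j" for l
    unfolding j_def by (rule Least_le) (use that j in auto)
  have "transacts m \<sigma> F j"
    unfolding transacts_def inspects_def
  proof (intro conjI allI impI)
    fix l assume l: "l < m" "precedes \<sigma> l j"
    show "\<not> F l"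
    proof
      assume "F l"
      then have "l \<in> A" using l j by (auto simp: A_def precedes_def)
      then show False using l max[of l] least[of l] by (auto simp: precedes_def)
    qed
  qed (use j in \<open>auto simp: A_def\<close>)
  moreover have "j = k \<or> precedes \<sigma> j k"
    using max[OF kA] least[OF kA] by (auto simp: precedes_def)
  ultimately show thesis using max[OF kA] that by blast
qed

text \<open>Search is adapted to what it reveals. If \<open>j\<close> were inspected under
  \<open>F'\<close> but not under \<open>F\<close>, some fit under \<open>F\<close> would precede
  it. The transaction that then takes place under \<open>F\<close> comes no later than this fit and
  is inspected under \<open>F\<close>, so it is also a fit under \<open>F'\<close> and stops the
  search before \<open>j\<close>.\<close>

lemma inspects_cong_fit:
  assumes agree: "\<And>k. inspects m \<sigma> F k \<Longrightarrow> F' k = F k"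
  shows "inspects m \<sigma> F' j \<longleftrightarrow> inspects m \<sigma> F j"
proof
  assume L: "inspects m \<sigma> F' j"
  show "inspects m \<sigma> F j"
  proof (rule ccontr)
    assume "\<not> inspects m \<sigma> F j"
    then obtain k where k: "k < m" "precedes \<sigma> k j" "F k" using L by (auto simp: inspects_def)
    then have "\<sigma> k > 0" using L by (auto simp: inspects_def precedes_def)
    then obtain l where l: "transacts m \<sigma> F l" "l = k \<or> precedes \<sigma> l k"
      using exists_transacts[of k m \<sigma> F] k by metis
    then have "F' l" using agree[of l] by (auto simp: transacts_def)
    then show False using l k L precedes_trans[of \<sigma> l k j]
      by (auto simp: inspects_def transacts_def)
  qed
next
  assume R: "inspects m \<sigma> F j"
  have "\<not> F' k" if "k < m" "precedes \<sigma> k j" for k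
  proof -
    have "inspects m \<sigma> F k"
      using R that precedes_trans[of \<sigma> _ k j] by (fastforce simp: inspects_def precedes_def)
    then show ?thesis using agree[of k] R that by (auto simp: inspects_def)
  qed
  then show "inspects m \<sigma> F' j" using R by (simp add: inspects_def)
qed

lemma inspects_cong_index:
  "(\<And>k. k < m \<Longrightarrow> \<sigma> k = \<sigma>' k) \<Longrightarrow> inspects m \<sigma> F j \<longleftrightarrow> inspects m \<sigma>' F j"
  by (auto simp: inspects_def precedes_def)

lemma transacts_cong_index:
  "(\<And>k. k < m \<Longrightarrow> \<sigma> k = \<sigma>' k) \<Longrightarrow> transacts m \<sigma> F j \<longleftrightarrow> transacts m \<sigma>' F j"
  using inspects_cong_index[of m \<sigma> \<sigma>' F j] by (simp add: transacts_def)

lemma pred_inspects: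
  assumes \<sigma>: "\<And>k. k < m \<Longrightarrow> (\<lambda>x. \<sigma> x k) \<in> borel_measurable N"
    and F: "\<And>k. k < m \<Longrightarrow> (\<lambda>x. F x k) \<in> N \<rightarrow>\<^sub>M count_space UNIV"
  shows "Measurable.pred N (\<lambda>x. inspects m (\<sigma> x) (F x) j)"
proof (cases "j < m")
  case True
  have "Measurable.pred N (\<lambda>x. precedes (\<sigma> x) k j \<longrightarrow> \<not> F x k)" if "k \<in> {..<m}" for k
  proof -
    have [measurable]: "(\<lambda>x. \<sigma> x k) \<in> borel_measurable N" "(\<lambda>x. \<sigma> x j) \<in> borel_measurable N"
      "Measurable.pred N (\<lambda>x. F x k)"
      using \<sigma> F True that by auto
    have "Measurable.pred N (\<lambda>x. \<sigma> x j < \<sigma> x k)" "Measurable.pred N (\<lambda>x. \<sigma> x k = \<sigma> x j)"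
      by measurable
    then show ?thesis
      unfolding precedes_def by (intro pred_intros_logic) auto
  qed
  then have 1: "Measurable.pred N (\<lambda>x. \<forall>k\<in>{..<m}. precedes (\<sigma> x) k j \<longrightarrow> \<not> F x k)"
    by (rule pred_intros_finite(3)[OF finite_lessThan])
  have 2: "Measurable.pred N (\<lambda>x. \<sigma> x j > 0)" using \<sigma>[OF True] by measurable
  have "(\<lambda>x. inspects m (\<sigma> x) (F x) j) =
      (\<lambda>x. \<sigma> x j > 0 \<and> (\<forall>k\<in>{..<m}. precedes (\<sigma> x) k j \<longrightarrow> \<not> F x k))"
    using True by (auto simp: inspects_def)
  then show ?thesis using pred_intros_logic(3)[OF 2 1] by simp
next
  case False
  then have "(\<lambda>x. inspects m (\<sigma> x) (F x) j) = (\<lambda>x. False)" by (auto simp: inspects_def)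
  then show ?thesis by simp
qed

lemma pred_transacts:
  assumes \<sigma>: "\<And>k. k < m \<Longrightarrow> (\<lambda>x. \<sigma> x k) \<in> borel_measurable N"
    and F: "\<And>k. k < m \<Longrightarrow> (\<lambda>x. F x k) \<in> N \<rightarrow>\<^sub>M count_space UNIV"
  shows "Measurable.pred N (\<lambda>x. transacts m (\<sigma> x) (F x) j)"
proof (cases "j < m")
  case True
  show ?thesis
    unfolding transacts_def by (rule pred_intros_logic(3)[OF pred_inspects[OF \<sigma> F] F[OF True]])
next
  case False
  then have "(\<lambda>x. transacts m (\<sigma> x) (F x) j) = (\<lambda>x. False)" by (auto simp: transacts_def inspects_def)
  then show ?thesis by simp
qed

lemma measurable_count_space_combine:
  fixes f :: "'x \<Rightarrow> 'a::countable" and g :: "'x \<Rightarrow> 'b::countable"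
  assumes [measurable]: "f \<in> N \<rightarrow>\<^sub>M count_space UNIV" "g \<in> N \<rightarrow>\<^sub>M count_space UNIV"
    and "\<And>a b. F a b \<in> space L"
  shows "(\<lambda>x. F (f x) (g x)) \<in> N \<rightarrow>\<^sub>M L"
proof -
  have "(\<lambda>x. (f x, g x)) \<in> N \<rightarrow>\<^sub>M count_space UNIV \<Otimes>\<^sub>M count_space UNIV" by measurable
  then have 1: "(\<lambda>x. (f x, g x)) \<in> N \<rightarrow>\<^sub>M count_space UNIV"
    by (simp add: pair_measure_countable)
  have 2: "case_prod F \<in> count_space UNIV \<rightarrow>\<^sub>M L" using assms(3) by (auto simp: measurable_def)
  show ?thesis using measurable_compose[OF 1 2] by (simp only: prod.case)
qed

lemma outcome_component_measurable:
  "j < nbiz M \<Longrightarrow> (\<lambda>y. fst (snd y) j) \<in> outcome_space M \<rightarrow>\<^sub>M count_space UNIV"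
  "(\<lambda>y. snd (snd y)) \<in> outcome_space M \<rightarrow>\<^sub>M count_space UNIV"
  unfolding outcome_space_def by measurable

text \<open>
  Beliefs depend on the history only through countably many possible observations, so that any
  function of a posterior is measurable.
\<close>

definition observations :: "nat \<Rightarrow> nat \<Rightarrow> (nat \<Rightarrow> outcome) \<Rightarrow> (bool option \<times> (nat \<times> bool) option) list" where
  "observations j i h = map (\<lambda>r. (fst (snd (h r)) j, snd (snd (h r)))) [0..<i]"

lemma observations_measurable:
  assumes "j < nbiz M" "{..<i} \<subseteq> R"
  shows "observations j i \<in> history_space M R \<rightarrow>\<^sub>M count_space UNIV"
  using assms(2)
proof (induction i)
  case (Suc i)
  have h: "(\<lambda>h. h i) \<in> history_space M R \<rightarrow>\<^sub>M outcome_space M"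
    unfolding history_space_def using Suc.prems by (intro measurable_component_singleton) auto
  have a: "(\<lambda>h. (fst (snd (h i)) j, snd (snd (h i)))) \<in> history_space M R \<rightarrow>\<^sub>M count_space UNIV"
    using measurable_count_space_combine[where F = Pair and L = "count_space UNIV",
        OF measurable_compose[OF h outcome_component_measurable(1)[OF assms(1)]]
        measurable_compose[OF h outcome_component_measurable(2)]] by simp
  have b: "observations j i \<in> history_space M R \<rightarrow>\<^sub>M count_space UNIV"
    by (rule Suc.IH) (use Suc.prems in auto)
  have "(\<lambda>h. observations j i h @ [(fst (snd (h i)) j, snd (snd (h i)))]) \<in>
      history_space M R \<rightarrow>\<^sub>M count_space UNIV"
    using measurable_count_space_combine[where F = "\<lambda>a b. a @ [b]" and L = "count_space UNIV", OF b a]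
    by simp
  then show ?case by (simp add: observations_def)
next
  case 0
  have "observations j 0 = (\<lambda>_. [])" by (simp add: observations_def fun_eq_iff)
  then show ?case by simp
qed

lemma posterior_cong:
  assumes "observations j i h = observations j i h'"
  shows "posterior M j i h = posterior M j i h'"
proof -
  have "\<And>r. r < i \<Longrightarrow> fst (snd (h r)) j = fst (snd (h' r)) j \<and> snd (snd (h r)) = snd (snd (h' r))"
    using assms by (simp add: observations_def)
  then have "likelihood j i h = likelihood j i h'"
    unfolding likelihood_def by (intro ext) (auto intro!: prod.cong)
  then show ?thesis by (simp add: posterior_def)
qed

lemma posterior_restrict: "posterior M j i (restrict h {..<i}) = posterior M j i h"
  by (rule posterior_cong) (simp add: observations_def)

lemma posterior_function_measurable:
  assumes "j < nbiz M" "{..<i} \<subseteq> R" "\<And>B. G B \<in> space L"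
  shows "(\<lambda>h. G (posterior M' j i h)) \<in> history_space M R \<rightarrow>\<^sub>M L"
proof -
  \<comment> \<open>A representative history for each list of observations turns the posterior into
    a function on a countable discrete space; by \<open>posterior_cong\<close> the choice of the
    representative is immaterial.\<close>
  let ?H = "\<lambda>l. G (posterior M' j i (SOME h. observations j i h = l))"
  have "(\<lambda>h. ?H (observations j i h)) \<in> history_space M R \<rightarrow>\<^sub>M L"
    by (rule measurable_compose[OF observations_measurable[OF assms(1,2)]])
       (simp add: assms(3))
  moreover have "?H (observations j i h) = G (posterior M' j i h)" for h
  proof -
    have "observations j i (SOME h'. observations j i h' = observations j i h) = observations j i h"
      by (rule someI[of _ h]) (rule refl)
    then show ?thesis by (rule arg_cong[where f = G, OF posterior_cong])
  qed
  ultimately show ?thesis by simp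
qed

section \<open>A single round of the dynamics\<close>

definition inspected :: "outcome \<Rightarrow> nat \<Rightarrow> bool" where
  "inspected y j \<longleftrightarrow> fst (snd y) j \<noteq> None"

definition round_index :: "market \<Rightarrow> nat \<Rightarrow> (nat \<Rightarrow> outcome) \<Rightarrow> real \<Rightarrow> (nat \<Rightarrow> real) \<Rightarrow> nat \<Rightarrow> real" where
  "round_index M i h V u j = search_index M (price_rule M j i h (u j)) (posterior M j i h) V"

text \<open>\<open>play_round\<close> takes its prices from a restricted function. This is literally
  the index it computes, so that \<open>play_round_eq\<close> holds by unfolding; the simpler
  \<open>round_index\<close> agrees with it on actual businesses and is the form used
  afterwards.\<close>

definition posted_index :: "market \<Rightarrow> nat \<Rightarrow> (nat \<Rightarrow> outcome) \<Rightarrow> real \<Rightarrow> (nat \<Rightarrow> real) \<Rightarrow> nat \<Rightarrow> real" where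
  "posted_index M i h V u j =
    search_index M ((\<lambda>j\<in>{..<nbiz M}. price_rule M j i h (u j)) j) (posterior M j i h) V"

lemma posted_index: "j < nbiz M \<Longrightarrow> posted_index M i h V u j = round_index M i h V u j"
  by (simp add: posted_index_def round_index_def)

lemma play_round_eq:
  "play_round M i h (V, F, q, u) =
    (\<lambda>j\<in>{..<nbiz M}. price_rule M j i h (u j),
     \<lambda>j\<in>{..<nbiz M}. if inspects (nbiz M) (posted_index M i h V u) F j then Some (F j) else None,
     if \<exists>j. transacts (nbiz M) (posted_index M i h V u) F j
     then Some (THE j. transacts (nbiz M) (posted_index M i h V u) F j,
       q (THE j. transacts (nbiz M) (posted_index M i h V u) F j)) else None)"
  unfolding play_round_def posted_index_def[abs_def] Let_def prod.case by (rule refl)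

lemma play_round_price:
  "j < nbiz M \<Longrightarrow> fst (play_round M i h (V, F, q, u)) j = price_rule M j i h (u j)"
  by (simp add: play_round_eq)

lemma play_round_inspection:
  assumes "j < nbiz M"
  shows "fst (snd (play_round M i h (V, F, q, u))) j =
    (if inspects (nbiz M) (round_index M i h V u) F j then Some (F j) else None)"
  using inspects_cong_index[of "nbiz M" "posted_index M i h V u" "round_index M i h V u" F j]
  by (simp add: play_round_eq posted_index assms)

lemma play_round_inspected:
  "j < nbiz M \<Longrightarrow> inspected (play_round M i h (V, F, q, u)) j \<longleftrightarrow>
    inspects (nbiz M) (round_index M i h V u) F j"
  by (simp add: inspected_def play_round_inspection)

lemma play_round_transaction:
  "snd (snd (play_round M i h (V, F, q, u))) = Some (j, g) \<longleftrightarrow>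
    transacts (nbiz M) (round_index M i h V u) F j \<and> g = q j"
proof -
  let ?t = "transacts (nbiz M) (posted_index M i h V u) F"
  have t: "?t j \<longleftrightarrow> transacts (nbiz M) (round_index M i h V u) F j"
    by (rule transacts_cong_index) (rule posted_index)
  have the: "(THE j. ?t j) = k" if "?t k" for k
    using that transacts_unique by (intro the_equality) blast+
  show ?thesis
    unfolding play_round_eq t[symmetric] snd_conv
    using the by auto
qed

lemma play_round_no_transaction:
  "snd (snd (play_round M i h (V, F, q, u))) = None \<longleftrightarrow>
    (\<forall>j<nbiz M. \<not> transacts (nbiz M) (round_index M i h V u) F j)"
proof -
  have "transacts (nbiz M) (posted_index M i h V u) F j \<longleftrightarrow>
      transacts (nbiz M) (round_index M i h V u) F j" for j
    by (rule transacts_cong_index) (rule posted_index)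
  then show ?thesis
    unfolding play_round_eq snd_conv by (auto simp: transacts_def inspects_def)
qed

locale valid_market =
  fixes M :: market
  assumes wf: "wf_market M"
begin

abbreviation "m \<equiv> nbiz M"

lemma prob_value: "prob_space (value_dist M)" and sets_value[measurable_cong]: "sets (value_dist M) = sets borel"
  using wf by (auto simp: wf_market_def regular_dist_def)

lemma prob_seed: "prob_space (uniform_measure lborel {0..1::real})"
  by (rule prob_space_uniform_measure) auto

lemma prob_shock: "prob_space (shock_space M)"
  unfolding shock_space_def
  by (intro prob_space_pair_measure prob_space_PiM prob_value prob_seed prob_space_measure_pmf)

lemma price_rule_measurable:
  "j < m \<Longrightarrow> (\<lambda>z. price_rule M j i (fst z) (snd z)) \<in> borel_measurable (history_space M {..<i} \<Otimes>\<^sub>M borel)"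
  using wf by (simp add: wf_market_def split_beta')

lemma sets_shock: "sets (shock_space M) = sets (borel \<Otimes>\<^sub>M (PiM {..<m} (\<lambda>_. count_space UNIV) \<Otimes>\<^sub>M
    (PiM {..<m} (\<lambda>_. count_space UNIV) \<Otimes>\<^sub>M PiM {..<m} (\<lambda>_. borel))))"
  unfolding shock_space_def
  by (intro sets_pair_measure_cong sets_PiM_cong refl sets_value) (simp_all)

lemma shock_measurable:
  shows "fst \<in> borel_measurable (shock_space M)"
    and "j < m \<Longrightarrow> (\<lambda>s. fst (snd s) j) \<in> shock_space M \<rightarrow>\<^sub>M count_space UNIV"
    and "j < m \<Longrightarrow> (\<lambda>s. fst (snd (snd s)) j) \<in> shock_space M \<rightarrow>\<^sub>M count_space UNIV"
    and "j < m \<Longrightarrow> (\<lambda>s. snd (snd (snd s)) j) \<in> borel_measurable (shock_space M)"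
  unfolding measurable_cong_sets[OF sets_shock refl] by measurable


abbreviation "HS i \<equiv> history_space M {..<i}"

lemma round_index_measurable:
  assumes j: "j < m"
    and h: "h \<in> N \<rightarrow>\<^sub>M HS i" and V: "V \<in> borel_measurable N"
    and u: "(\<lambda>z. u z j) \<in> borel_measurable N"
  shows "(\<lambda>z. round_index M i (h z) (V z) (u z) j) \<in> borel_measurable N"
proof -
  have post: "(\<lambda>z. G (posterior M j i (h z))) \<in> borel_measurable N" for G :: "_ \<Rightarrow> real"
    by (rule measurable_compose[OF h posterior_function_measurable[OF j]]) auto
  have "(\<lambda>z. (h z, u z j)) \<in> N \<rightarrow>\<^sub>M HS i \<Otimes>\<^sub>M borel" by (rule measurable_Pair[OF h u])
  from measurable_compose[OF this price_rule_measurable[OF j]]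
  have "(\<lambda>z. price_rule M j i (h z) (u z j)) \<in> borel_measurable N" by simp
  then show ?thesis
    unfolding round_index_def search_index_def
    by (intro borel_measurable_diff borel_measurable_times borel_measurable_divide V post) simp
qed

lemma play_round_measurable:
  "(\<lambda>z. play_round M i (fst z) (snd z)) \<in> HS i \<Otimes>\<^sub>M shock_space M \<rightarrow>\<^sub>M outcome_space M"
proof -
  let ?N = "HS i \<Otimes>\<^sub>M shock_space M"
  let ?\<sigma> = "\<lambda>z. round_index M i (fst z) (fst (snd z)) (snd (snd (snd (snd z))))"
  let ?F = "\<lambda>z. fst (snd (snd z))" and ?q = "\<lambda>z. fst (snd (snd (snd z)))"
  note comp = shock_measurable[THEN measurable_compose[OF measurable_snd]]
  have \<sigma>: "(\<lambda>z. ?\<sigma> z j) \<in> borel_measurable ?N" if "j < m" for j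
    by (intro round_index_measurable that comp measurable_fst)
  have F: "(\<lambda>z. ?F z j) \<in> ?N \<rightarrow>\<^sub>M count_space UNIV" if "j < m" for j
    by (rule comp(2)[OF that])
  have q: "(\<lambda>z. ?q z j) \<in> ?N \<rightarrow>\<^sub>M count_space UNIV" if "j < m" for j
    by (rule comp(3)[OF that])
  have z: "snd z = (fst (snd z), ?F z, ?q z, snd (snd (snd (snd z))))" for z :: "_ \<times> shock" by simp
  let ?p = "\<lambda>z. play_round M i (fst z) (snd z)"
  have price: "(\<lambda>z. fst (?p z)) \<in> ?N \<rightarrow>\<^sub>M PiM {..<m} (\<lambda>_. borel)"
  proof (rule measurable_PiM_single')
    fix j assume j: "j \<in> {..<m}"
    have "(\<lambda>z. (fst z, snd (snd (snd (snd z))) j)) \<in> ?N \<rightarrow>\<^sub>M HS i \<Otimes>\<^sub>M borel"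
      by (rule measurable_Pair[OF measurable_fst comp(4)]) (use j in simp)
    from measurable_compose[OF this price_rule_measurable] j
    have "(\<lambda>z. price_rule M j i (fst z) (snd (snd (snd (snd z))) j)) \<in> borel_measurable ?N" by simp
    moreover have "fst (?p z) j = price_rule M j i (fst z) (snd (snd (snd (snd z))) j)" for z
      using j by (subst z) (simp only: play_round_price lessThan_iff)
    ultimately show "(\<lambda>z. fst (?p z) j) \<in> borel_measurable ?N" by (simp only:)
  next
    show "(\<lambda>z. fst (?p z)) \<in> space ?N \<rightarrow> (\<Pi>\<^sub>E j\<in>{..<m}. space borel)"
    proof
      fix z
      show "fst (?p z) \<in> (\<Pi>\<^sub>E j\<in>{..<m}. space borel)"
        by (subst z) (simp only: play_round_eq fst_conv space_borel PiE_UNIV_domain, simp)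
    qed
  qed
  have insp: "(\<lambda>z. fst (snd (?p z))) \<in> ?N \<rightarrow>\<^sub>M PiM {..<m} (\<lambda>_. count_space UNIV)"
  proof (rule measurable_PiM_single')
    fix j assume j: "j \<in> {..<m}"
    have I: "(\<lambda>z. inspects m (?\<sigma> z) (?F z) j) \<in> ?N \<rightarrow>\<^sub>M count_space UNIV"
      by (rule pred_inspects[OF \<sigma> F])
    have "(\<lambda>z. if inspects m (?\<sigma> z) (?F z) j then Some (?F z j) else None) \<in> ?N \<rightarrow>\<^sub>M count_space UNIV"
      using measurable_count_space_combine[where F = "\<lambda>a b. if a then Some b else None" and L = "count_space UNIV",
          OF I F[of j]] j by simp
    moreover have "fst (snd (?p z)) j = (if inspects m (?\<sigma> z) (?F z) j then Some (?F z j) else None)" for z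
      using j by (subst z) (simp only: play_round_inspection lessThan_iff)
    ultimately show "(\<lambda>z. fst (snd (?p z)) j) \<in> ?N \<rightarrow>\<^sub>M count_space UNIV" by (simp only:)
  next
    show "(\<lambda>z. fst (snd (?p z))) \<in> space ?N \<rightarrow> (\<Pi>\<^sub>E j\<in>{..<m}. space (count_space UNIV))"
    proof
      fix z
      show "fst (snd (?p z)) \<in> (\<Pi>\<^sub>E j\<in>{..<m}. space (count_space UNIV))"
        by (subst z) (simp only: play_round_eq fst_conv snd_conv space_count_space, simp)
    qed
  qed
  have T: "(\<lambda>z. transacts m (?\<sigma> z) (?F z) j) \<in> ?N \<rightarrow>\<^sub>M count_space UNIV" for j
    by (rule pred_transacts[OF \<sigma> F])
  have trans: "(\<lambda>z. snd (snd (?p z))) \<in> ?N \<rightarrow>\<^sub>M count_space UNIV"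
  proof (rule measurable_count_space_eq2_countable[THEN iffD2, OF _, rotated], intro conjI ballI)
    fix x :: "(nat \<times> bool) option"
    have vim: "(\<lambda>z. snd (snd (?p z))) -` {x} \<inter> space ?N = {z \<in> space ?N. snd (snd (?p z)) = x}" by auto
    show "(\<lambda>z. snd (snd (?p z))) -` {x} \<inter> space ?N \<in> sets ?N"
    proof (cases x)
      case None
      have "Measurable.pred ?N (\<lambda>z. \<forall>j\<in>{..<m}. \<not> transacts m (?\<sigma> z) (?F z) j)"
        by (intro pred_intros_finite(3) finite_lessThan pred_intros_logic(2) T)
      moreover have "snd (snd (?p z)) = x \<longleftrightarrow> (\<forall>j\<in>{..<m}. \<not> transacts m (?\<sigma> z) (?F z) j)" for z
        by (subst z) (simp only: play_round_no_transaction None Ball_def lessThan_iff)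
      ultimately show ?thesis unfolding vim by (simp only: pred_def)
    next
      case (Some y)
      obtain j g where y: "y = (j, g)" by fastforce
      have eq: "snd (snd (?p z)) = x \<longleftrightarrow> transacts m (?\<sigma> z) (?F z) j \<and> ?q z j = g" for z
        by (subst z) (simp only: play_round_transaction Some y eq_commute[of _ g])
      show ?thesis
      proof (cases "j < m")
        case True
        have "Measurable.pred ?N (\<lambda>z. transacts m (?\<sigma> z) (?F z) j \<and> (?q z j = g))"
          using T[of j] q[OF True] by measurable
        then show ?thesis unfolding vim by (simp only: eq pred_def)
      next
        case False
        then have "{z \<in> space ?N. snd (snd (?p z)) = x} = {}"
          by (auto simp only: eq transacts_def inspects_def)
        then show ?thesis unfolding vim by (simp only: sets.empty_sets)
      qed
    qed
  qed simp_all
  show ?thesis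
    unfolding outcome_space_def
    using measurable_Pair[OF price measurable_Pair[OF insp trans]] by simp
qed

lemma append_round_measurable:
  "(\<lambda>z. (fst z)(i := play_round M i (fst z) (snd z))) \<in> HS i \<Otimes>\<^sub>M shock_space M \<rightarrow>\<^sub>M HS (Suc i)"
  unfolding history_space_def
  by (rule measurable_fun_upd[where J = "{..<i}"])
     (auto intro!: play_round_measurable[unfolded history_space_def])

text \<open>A common reference for two constructions: the prefixes of the original history and those
  of the history read from tapes both turn out to have this law.\<close>

primrec prefix_law :: "nat \<Rightarrow> (nat \<Rightarrow> outcome) measure" where
  "prefix_law 0 = PiM {} (\<lambda>_. outcome_space M)"
| "prefix_law (Suc i) = distr (prefix_law i \<Otimes>\<^sub>M shock_space M) (HS (Suc i))
     (\<lambda>z. (fst z)(i := play_round M i (fst z) (snd z)))"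

lemma sets_prefix_law[measurable_cong, simp]: "sets (prefix_law i) = sets (HS i)"
  by (cases i) (simp_all add: history_space_def)

lemma append_round_measurable':
  "(\<lambda>z. (fst z)(i := play_round M i (fst z) (snd z))) \<in> prefix_law i \<Otimes>\<^sub>M shock_space M \<rightarrow>\<^sub>M HS (Suc i)"
  using append_round_measurable by (subst measurable_cong_sets[OF sets_pair_measure_cong refl]) auto

lemma prob_prefix_law: "prob_space (prefix_law i)"
proof (induction i)
  case 0
  show ?case by (simp, rule prob_spaceI) (simp add: PiM_empty emeasure_count_space)
next
  case (Suc i)
  then show ?case
    by (simp only: prefix_law.simps)
      (rule prob_space.prob_space_distr[OF prob_space_pair_measure[OF _ prob_shock] append_round_measurable'])
qed

lemma append_round_preserving:
  "measure_preserving (prefix_law i \<Otimes>\<^sub>M shock_space M) (prefix_law (Suc i))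
    (\<lambda>z. (fst z)(i := play_round M i (fst z) (snd z)))"
proof -
  have "(\<lambda>z. (fst z)(i := play_round M i (fst z) (snd z))) \<in>
      prefix_law i \<Otimes>\<^sub>M shock_space M \<rightarrow>\<^sub>M prefix_law (Suc i)"
    using append_round_measurable'[of i] by (subst measurable_cong_sets[OF refl sets_prefix_law])
  then show ?thesis
    unfolding measure_preserving_def by (auto intro!: distr_cong)
qed

end

section \<open>Reading fits and qualities from tapes\<close>

type_synonym tape = "(nat \<Rightarrow> nat \<Rightarrow> bool) \<times> (nat \<Rightarrow> nat \<Rightarrow> bool)"

text \<open>
  The \<open>k\<close>-th entries of the two tapes of business \<open>j\<close> are the fit revealed by its \<open>k\<close>-th inspection
  and the quality realization of a transaction following that inspection.
\<close>

definition tape_space :: "market \<Rightarrow> tape measure" where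
  "tape_space M =
     PiM {..<nbiz M} (\<lambda>j. PiM UNIV (\<lambda>_. measure_pmf (bernoulli_pmf (fit_prob M j)))) \<Otimes>\<^sub>M
     PiM {..<nbiz M} (\<lambda>j. PiM UNIV (\<lambda>_. measure_pmf (bernoulli_pmf (quality M j))))"

definition substitute_fits :: "market \<Rightarrow> nat set \<Rightarrow> shock \<times> tape \<Rightarrow> shock \<times> tape" where
  "substitute_fits M I z =
     (let y = read_heads {..<nbiz M} I (fst (snd (fst z)), fst (snd z))
      in ((fst (fst z), fst y, snd (snd (fst z))), snd y, snd (snd z)))"

definition substitute_qualities :: "market \<Rightarrow> nat set \<Rightarrow> shock \<times> tape \<Rightarrow> shock \<times> tape" where
  "substitute_qualities M I z =
     (let y = read_heads {..<nbiz M} I (fst (snd (snd (fst z))), snd (snd z))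
      in ((fst (fst z), fst (snd (fst z)), fst y, snd (snd (snd (fst z)))), fst (snd z), snd y))"

text \<open>Both tapes advance at each inspection, also when there is no fit and hence no
  transaction. The quality entry is then skipped unseen, which keeps the two tapes of a business
  aligned.\<close>

definition substitute_heads :: "market \<Rightarrow> nat set \<Rightarrow> shock \<times> tape \<Rightarrow> shock \<times> tape" where
  "substitute_heads M I z = substitute_qualities M I (substitute_fits M I z)"

lemma substitute_heads_simps:
  "fst (fst (substitute_heads M I z)) = fst (fst z)"
  "snd (snd (snd (fst (substitute_heads M I z)))) = snd (snd (snd (fst z)))"
  "j < nbiz M \<Longrightarrow> fst (snd (fst (substitute_heads M I z))) j =
     (if j \<in> I then fst (snd z) j 0 else fst (snd (fst z)) j)"
  "j < nbiz M \<Longrightarrow> fst (snd (snd (fst (substitute_heads M I z)))) j =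
     (if j \<in> I then snd (snd z) j 0 else fst (snd (snd (fst z))) j)"
  "j < nbiz M \<Longrightarrow> fst (snd (substitute_heads M I z)) j =
     (if j \<in> I then (\<lambda>k. fst (snd z) j (Suc k)) else fst (snd z) j)"
  "j < nbiz M \<Longrightarrow> snd (snd (substitute_heads M I z)) j =
     (if j \<in> I then (\<lambda>k. snd (snd z) j (Suc k)) else snd (snd z) j)"
  by (simp_all add: substitute_heads_def substitute_fits_def substitute_qualities_def read_heads_def Let_def)

text \<open>The fits are a separate argument rather than part of \<open>s\<close>, because the same
  value and the same prices are to be combined with the fits of the shock as well as with the heads
  of the tapes.\<close>

definition inspected_set :: "market \<Rightarrow> nat \<Rightarrow> (nat \<Rightarrow> outcome) \<Rightarrow> shock \<Rightarrow> (nat \<Rightarrow> bool) \<Rightarrow> nat set" where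
  "inspected_set M i h s F =
     {j \<in> {..<nbiz M}. inspects (nbiz M) (round_index M i h (fst s) (snd (snd (snd s)))) F j}"

text \<open>
  Which businesses are inspected depends only on the fits of these businesses. Therefore taking
  their fits and qualities from the tapes instead of the shocks does not change the law of a round.
\<close>

definition read_tape :: "market \<Rightarrow> nat \<Rightarrow> (nat \<Rightarrow> outcome) \<Rightarrow> shock \<times> tape \<Rightarrow> shock \<times> tape" where
  "read_tape M i h z =
     substitute_heads M (inspected_set M i h (fst z) (\<lambda>j. fst (snd z) j 0)) z"

lemma inspected_set_cong:
  assumes "\<And>j. j \<in> inspected_set M i h s F \<Longrightarrow> F' j = F j"
  shows "inspected_set M i h s F' = inspected_set M i h s F"
proof -
  have "inspects (nbiz M) (round_index M i h (fst s) (snd (snd (snd s)))) F' j \<longleftrightarrow>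
      inspects (nbiz M) (round_index M i h (fst s) (snd (snd (snd s)))) F j" for j
    by (rule inspects_cong_fit) (use assms in \<open>auto simp: inspected_set_def inspects_def\<close>)
  then show ?thesis by (simp add: inspected_set_def)
qed

text \<open>This is the compatibility condition of \<open>measure_preserving_piecewise\<close>: from
  the round as finally played one can read off which tapes were used. The two fit profiles agree on
  \<open>k\<close>, and agreement on the inspected set of one profile gives the same inspected set
  for the other.\<close>

lemma inspected_set_substitute_heads:
  assumes "k \<subseteq> {..<nbiz M}"
  shows "inspected_set M i h (fst z) (\<lambda>j. fst (snd z) j 0) = k \<longleftrightarrow>
    inspected_set M i h (fst (substitute_heads M k z)) (fst (snd (fst (substitute_heads M k z)))) = k"
proof -
  let ?z = "substitute_heads M k z"
  have same: "inspected_set M i h (fst ?z) F = inspected_set M i h (fst z) F" for F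
    by (simp add: inspected_set_def substitute_heads_simps)
  have heads: "fst (snd (fst ?z)) j = fst (snd z) j 0" if "j \<in> k" for j
    using that assms by (subst substitute_heads_simps) auto
  show ?thesis
    unfolding same
    using inspected_set_cong[of M i h "fst z" "\<lambda>j. fst (snd z) j 0" "fst (snd (fst ?z))"]
      inspected_set_cong[of M i h "fst z" "fst (snd (fst ?z))" "\<lambda>j. fst (snd z) j 0"] heads
    by metis
qed

lemma measurable_finite_subset:
  assumes P: "\<And>j. j < n \<Longrightarrow> Measurable.pred N (\<lambda>x. P x j)"
  shows "(\<lambda>x. {j \<in> {..<n::nat}. P x j}) \<in> N \<rightarrow>\<^sub>M count_space (Pow {..<n})"
proof (rule measurable_count_space_eq_countable[THEN iffD2], goal_cases)
  case 1
  show ?case by (rule countable_finite) simp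
next
  case 2
  show ?case
  proof (intro conjI ballI)
    fix k assume k: "k \<in> Pow {..<n}"
    have "(\<lambda>x. {j \<in> {..<n}. P x j}) -` {k} \<inter> space N = {x \<in> space N. \<forall>j\<in>{..<n}. P x j = (j \<in> k)}"
      using k by auto
    also have "\<dots> \<in> sets N"
    proof -
      have "Measurable.pred N (\<lambda>x. \<forall>j\<in>{..<n}. P x j = (j \<in> k))"
        by (intro pred_intros_finite(3) finite_lessThan pred_intros_logic(6) P) auto
      then show ?thesis by (simp only: pred_def)
    qed
    finally show "(\<lambda>x. {j \<in> {..<n}. P x j}) -` {k} \<inter> space N \<in> sets N" .
  qed auto
qed

context valid_market begin

abbreviation "TS \<equiv> tape_space M"

lemma prob_tape: "prob_space (tape_space M)"
  unfolding tape_space_def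
  by (intro prob_space_pair_measure prob_space_PiM prob_space_measure_pmf)

lemma prob_coin: "prob_space (PiM {..<m} (\<lambda>j. measure_pmf (bernoulli_pmf (p j))))"
  "prob_space (PiM {..<m} (\<lambda>j. PiM UNIV (\<lambda>_. measure_pmf (bernoulli_pmf (p j)))))"
  by (intro prob_space_PiM prob_space_measure_pmf)+

lemma substitute_heads_preserving:
  "measure_preserving (shock_space M \<Otimes>\<^sub>M TS) (shock_space M \<Otimes>\<^sub>M TS) (substitute_heads M I)"
proof -
  let ?U = "PiM {..<m} (\<lambda>j. uniform_measure lborel {0..1::real})"
  let ?C = "\<lambda>p. PiM {..<m} (\<lambda>j. measure_pmf (bernoulli_pmf (p j)))"
  let ?S = "\<lambda>p. PiM {..<m} (\<lambda>j. PiM UNIV (\<lambda>_. measure_pmf (bernoulli_pmf (p j))))"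
  have U: "prob_space ?U" by (intro prob_space_PiM prob_seed)
  note C = prob_coin(1) and S = prob_coin(2) and PP = prob_space_pair_measure
  note QU = PP[OF C[of "quality M"] U]
  note FQU = PP[OF C[of "fit_prob M"] QU]
  note shock = PP[OF prob_value FQU]
  have R: "measure_preserving (?C p \<Otimes>\<^sub>M ?S p) (?C p \<Otimes>\<^sub>M ?S p) (read_heads {..<m} I)" for p
    by (intro measure_preserving_read_heads finite_lessThan prob_space_measure_pmf)
  have "measure_preserving (shock_space M \<Otimes>\<^sub>M TS) (shock_space M \<Otimes>\<^sub>M TS) (substitute_fits M I)"
    using measure_preserving_on_fst_right[OF shock S[of "quality M"] S[of "fit_prob M"]
        measure_preserving_on_snd_left[OF FQU prob_value S
          measure_preserving_on_fst_left[OF C QU S R[of "fit_prob M"]]]]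
    unfolding shock_space_def tape_space_def substitute_fits_def[abs_def] Let_def fst_conv snd_conv .
  moreover have "measure_preserving (shock_space M \<Otimes>\<^sub>M TS) (shock_space M \<Otimes>\<^sub>M TS) (substitute_qualities M I)"
    using measure_preserving_on_snd_right[OF shock S[of "fit_prob M"] S[of "quality M"]
        measure_preserving_on_snd_left[OF FQU prob_value S
          measure_preserving_on_snd_left[OF QU C S
            measure_preserving_on_fst_left[OF C U S R[of "quality M"]]]]]
    unfolding shock_space_def tape_space_def substitute_qualities_def[abs_def] Let_def fst_conv snd_conv .
  ultimately show ?thesis
    unfolding substitute_heads_def[abs_def] by (rule measure_preserving_comp)
qed

lemma tape_measurable:
  "j < m \<Longrightarrow> (\<lambda>T. fst T j k) \<in> TS \<rightarrow>\<^sub>M count_space UNIV"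
  "j < m \<Longrightarrow> (\<lambda>T. snd T j k) \<in> TS \<rightarrow>\<^sub>M count_space UNIV"
proof -
  have sets: "sets TS = sets (PiM {..<m} (\<lambda>j. PiM UNIV (\<lambda>_::nat. count_space (UNIV::bool set))) \<Otimes>\<^sub>M
     PiM {..<m} (\<lambda>j. PiM UNIV (\<lambda>_::nat. count_space (UNIV::bool set))))"
    unfolding tape_space_def by (intro sets_pair_measure_cong sets_PiM_cong refl) simp_all
  show "j < m \<Longrightarrow> (\<lambda>T. fst T j k) \<in> TS \<rightarrow>\<^sub>M count_space UNIV"
    "j < m \<Longrightarrow> (\<lambda>T. snd T j k) \<in> TS \<rightarrow>\<^sub>M count_space UNIV"
    unfolding measurable_cong_sets[OF sets refl]
    by (rule measurable_compose[OF measurable_fst], rule measurable_compose[OF measurable_component_singleton],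
        simp, rule measurable_component_singleton, simp)
      (rule measurable_compose[OF measurable_snd], rule measurable_compose[OF measurable_component_singleton],
        simp, rule measurable_component_singleton, simp)
qed

lemma inspected_set_measurable:
  assumes h: "h \<in> N \<rightarrow>\<^sub>M HS i" and s: "s \<in> N \<rightarrow>\<^sub>M shock_space M"
    and F: "\<And>j. j < m \<Longrightarrow> (\<lambda>x. F x j) \<in> N \<rightarrow>\<^sub>M count_space UNIV"
  shows "(\<lambda>x. inspected_set M i (h x) (s x) (F x)) \<in> N \<rightarrow>\<^sub>M count_space (Pow {..<m})"
  unfolding inspected_set_def
  by (intro measurable_finite_subset pred_inspects round_index_measurable h F
      measurable_compose[OF s shock_measurable(1)] measurable_compose[OF s shock_measurable(4)])

lemma read_tape_measurable:
  "(\<lambda>z. read_tape M i (fst z) (snd z)) \<in> HS i \<Otimes>\<^sub>M (shock_space M \<Otimes>\<^sub>M TS) \<rightarrow>\<^sub>M shock_space M \<Otimes>\<^sub>M TS"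
  unfolding read_tape_def
proof (rule measurable_compose_countable'[where I = "Pow {..<m}"])
  show "(\<lambda>x. substitute_heads M k (snd x)) \<in> HS i \<Otimes>\<^sub>M (shock_space M \<Otimes>\<^sub>M TS) \<rightarrow>\<^sub>M shock_space M \<Otimes>\<^sub>M TS" for k
    by (rule measurable_compose[OF measurable_snd measure_preserving_measurable[OF substitute_heads_preserving]])
  show "(\<lambda>x. inspected_set M i (fst x) (fst (snd x)) (\<lambda>j. fst (snd (snd x)) j 0)) \<in>
      HS i \<Otimes>\<^sub>M (shock_space M \<Otimes>\<^sub>M TS) \<rightarrow>\<^sub>M count_space (Pow {..<m})"
    by (intro inspected_set_measurable measurable_fst measurable_compose[OF measurable_snd measurable_fst]
       measurable_compose[OF measurable_snd measurable_compose[OF measurable_snd tape_measurable(1)]])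
  show "countable (Pow {..<m})" by (rule countable_finite) simp
qed

text \<open>For a fixed set of businesses the exchange with the tapes preserves the law, but here
  the set depends on the tape heads being exchanged. It is therefore split over the finitely many
  sets, labelled before the exchange by the search with the heads and after it by the search with
  the new fits.\<close>

lemma read_tape_preserving:
  assumes h: "h \<in> space (HS i)"
  shows "measure_preserving (shock_space M \<Otimes>\<^sub>M TS) (shock_space M \<Otimes>\<^sub>M TS) (read_tape M i h)"
  unfolding read_tape_def[abs_def]
proof (rule measure_preserving_piecewise[where K = "Pow {..<m}" and f = "substitute_heads M"
      and l = "\<lambda>z. inspected_set M i h (fst z) (fst (snd (fst z)))"])
  let ?N = "shock_space M \<Otimes>\<^sub>M TS"
  show "(\<lambda>x. substitute_heads M (inspected_set M i h (fst x) (\<lambda>j. fst (snd x) j 0)) x) \<in> ?N \<rightarrow>\<^sub>M ?N"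
    using measurable_compose[OF measurable_Pair1'[OF h] read_tape_measurable]
    by (simp add: read_tape_def)
  have meas: "(\<lambda>z. inspected_set M i h (fst z) (fst (snd (fst z)))) \<in> ?N \<rightarrow>\<^sub>M count_space (Pow {..<m})"
    by (intro inspected_set_measurable measurable_const h measurable_fst
       measurable_compose[OF measurable_fst shock_measurable(2)])
  fix k assume k: "k \<in> Pow {..<m}"
  have "{y \<in> space ?N. inspected_set M i h (fst y) (fst (snd (fst y))) = k} =
    (\<lambda>z. inspected_set M i h (fst z) (fst (snd (fst z)))) -` {k} \<inter> space ?N" by auto
  then show "{y \<in> space ?N. inspected_set M i h (fst y) (fst (snd (fst y))) = k} \<in> sets ?N"
    using measurable_sets[OF meas, of "{k}"] k by (simp only:) simp
  show "inspected_set M i h (fst x) (\<lambda>j. fst (snd x) j 0) = k \<longleftrightarrow>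
    inspected_set M i h (fst (substitute_heads M k x)) (fst (snd (fst (substitute_heads M k x)))) = k" for x
    using k by (intro inspected_set_substitute_heads) auto
qed (auto simp: inspected_set_def intro: substitute_heads_preserving)

end

section \<open>Histories generated from the tapes\<close>

definition tape_step :: "market \<Rightarrow> nat \<Rightarrow> ((nat \<Rightarrow> outcome) \<times> tape) \<times> shock \<Rightarrow> (nat \<Rightarrow> outcome) \<times> tape" where
  "tape_step M i x = (let h = fst (fst x); y = read_tape M i h (snd x, snd (fst x))
     in (h(i := play_round M i h (fst y)), snd y))"

primrec tape_state :: "market \<Rightarrow> nat \<Rightarrow> (nat \<Rightarrow> shock) \<times> tape \<Rightarrow> (nat \<Rightarrow> outcome) \<times> tape" where
  "tape_state M 0 z = (\<lambda>_. undefined, snd z)"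
| "tape_state M (Suc i) z = tape_step M i (tape_state M i z, fst z i)"

definition tape_history :: "market \<Rightarrow> (nat \<Rightarrow> shock) \<times> tape \<Rightarrow> nat \<Rightarrow> outcome" where
  "tape_history M z i = fst (tape_state M (Suc i) z) i"

lemma history_prefix_apply: "i < n \<Longrightarrow> history_prefix M \<omega> n i = history M \<omega> i"
proof (induction n)
  case (Suc n)
  then show ?case by (cases "i = n") (auto simp: history_def)
qed simp

lemma history_prefix_outside: "\<not> i < n \<Longrightarrow> history_prefix M \<omega> n i = undefined"
  by (induction n) auto

lemma restrict_history: "restrict (history M \<omega>) {..<n} = history_prefix M \<omega> n"
  by (rule ext) (auto simp: history_prefix_apply history_prefix_outside restrict_def)

lemma tape_state_apply: "i < n \<Longrightarrow> fst (tape_state M n z) i = tape_history M z i"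
proof (induction n)
  case (Suc n)
  then show ?case by (cases "i = n") (auto simp: tape_history_def tape_step_def Let_def)
qed simp

lemma tape_state_outside: "\<not> i < n \<Longrightarrow> fst (tape_state M n z) i = undefined"
  by (induction n) (auto simp: tape_step_def Let_def)

lemma restrict_tape_history: "restrict (tape_history M z) {..<n} = fst (tape_state M n z)"
  by (rule ext) (auto simp: tape_state_apply tape_state_outside restrict_def)

lemma PiM_UNIV_eqI:
  assumes sets: "sets \<mu> = sets (PiM UNIV (\<lambda>_::nat. L))" "sets \<nu> = sets (PiM UNIV (\<lambda>_::nat. L))"
    and fin: "finite_measure \<mu>"
    and eq: "\<And>n. distr \<mu> (PiM {..<n} (\<lambda>_. L)) (\<lambda>x. restrict x {..<n}) =
      distr \<nu> (PiM {..<n} (\<lambda>_. L)) (\<lambda>x. restrict x {..<n})"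
  shows "\<mu> = \<nu>"
proof (rule measure_eqI_PiM_infinite[where I = UNIV and M = "\<lambda>_. L", OF sets _ fin])
  fix J :: "nat set" and A :: "nat \<Rightarrow> 'a set"
  assume J: "finite J" and A: "\<And>i. i \<in> J \<Longrightarrow> A i \<in> sets L"
  obtain n where n: "J \<subseteq> {..<n}" using finite_nat_bounded[OF J] by blast
  let ?X = "prod_emb {..<n} (\<lambda>_. L) J (Pi\<^sub>E J A)"
  have X: "?X \<in> sets (PiM {..<n} (\<lambda>_. L))" using J A n by (intro sets_PiM_I) auto
  have vim: "prod_emb UNIV (\<lambda>_. L) J (Pi\<^sub>E J A) =
      (\<lambda>x. restrict x {..<n}) -` ?X \<inter> space (PiM UNIV (\<lambda>_::nat. L))"
    using n by (auto simp: prod_emb_def space_PiM PiE_iff restrict_def extensional_def subset_eq)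
  have r: "(\<lambda>x. restrict x {..<n}) \<in> PiM UNIV (\<lambda>_::nat. L) \<rightarrow>\<^sub>M PiM {..<n} (\<lambda>_. L)"
    by (rule measurable_restrict_subset) simp
  have "emeasure \<kappa> (prod_emb UNIV (\<lambda>_. L) J (Pi\<^sub>E J A)) =
      emeasure (distr \<kappa> (PiM {..<n} (\<lambda>_. L)) (\<lambda>x. restrict x {..<n})) ?X"
    if "sets \<kappa> = sets (PiM UNIV (\<lambda>_::nat. L))" for \<kappa>
    using X r by (subst emeasure_distr)
      (auto simp: vim sets_eq_imp_space_eq[OF that] measurable_cong_sets[OF that refl])
  from this[OF sets(1)] this[OF sets(2)]
  show "emeasure \<mu> (prod_emb UNIV (\<lambda>_. L) J (Pi\<^sub>E J A)) = emeasure \<nu> (prod_emb UNIV (\<lambda>_. L) J (Pi\<^sub>E J A))"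
    by (simp add: eq)
qed

context valid_market begin

abbreviation "SS \<equiv> PiM UNIV (\<lambda>_::nat. shock_space M)"

lemma empty_history_space: "(\<lambda>_. undefined) \<in> space (HS 0)"
  by (simp add: history_space_def space_PiM)

lemma prefix_law_0: "prob_space Z \<Longrightarrow> measure_preserving Z (prefix_law 0) (\<lambda>_. \<lambda>_. undefined)"
proof (rule measure_preservingI)
  show "(\<lambda>_ _. undefined) \<in> Z \<rightarrow>\<^sub>M prefix_law 0"
    by (rule measurable_const) (simp add: space_PiM)
  assume "prob_space Z"
  then interpret prob_space Z .
  fix g :: "_ \<Rightarrow> ennreal" assume "g \<in> borel_measurable (prefix_law 0)"
  then show "(\<integral>\<^sup>+x. g (\<lambda>_. undefined) \<partial>Z) = (\<integral>\<^sup>+y. g y \<partial>prefix_law 0)"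
    by (simp add: emeasure_space_1 PiM_empty nn_integral_count_space_finite)
qed

lemma prob_history_source: "prob_space (SS \<Otimes>\<^sub>M TS)"
  by (intro prob_space_pair_measure prob_space_PiM prob_shock prob_tape)

lemma history_prefix_measurable: "(\<lambda>\<omega>. history_prefix M \<omega> i) \<in> SS \<rightarrow>\<^sub>M HS i"
proof (induction i)
  case 0
  show ?case using empty_history_space by simp
next
  case (Suc i)
  have "(\<lambda>\<omega>. (history_prefix M \<omega> i, \<omega> i)) \<in> SS \<rightarrow>\<^sub>M HS i \<Otimes>\<^sub>M shock_space M"
    by (intro measurable_Pair Suc measurable_component_singleton) simp
  from measurable_compose[OF this append_round_measurable] show ?case by (simp add: fun_upd_def)
qed

lemma history_prefix_cong: "\<forall>r<i. \<omega> r = \<omega>' r \<Longrightarrow> history_prefix M \<omega> i = history_prefix M \<omega>' i"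
  by (induction i) auto

lemma history_prefix_law:
  "measure_preserving SS (prefix_law i) (\<lambda>\<omega>. history_prefix M \<omega> i)"
  "measure_preserving SS (prefix_law i \<Otimes>\<^sub>M shock_space M) (\<lambda>\<omega>. (history_prefix M \<omega> i, \<omega> i))"
proof -
  \<comment> \<open>The original dynamics has no initial randomness, so the factor \<open>Z\<close>
    of \<open>driven_process_law\<close> is a one-point space.\<close>
  let ?Z = "return (count_space UNIV) ()"
  have Z: "prob_space ?Z" by (rule prob_space_return) simp
  have SZ: "prob_space (SS \<Otimes>\<^sub>M ?Z)" by (intro prob_space_pair_measure prob_space_PiM prob_shock Z)
  have SSP: "prob_space SS" by (intro prob_space_PiM prob_shock)
  have meas: "(\<lambda>z. history_prefix M (fst z) i) \<in> SS \<Otimes>\<^sub>M ?Z \<rightarrow>\<^sub>M prefix_law i" for i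
    using measurable_compose[OF measurable_fst history_prefix_measurable[of i]]
    by (simp add: measurable_cong_sets[OF refl sets_prefix_law])
  note L = driven_process_law[where L = prefix_law and f = "\<lambda>i z. (fst z)(i := play_round M i (fst z) (snd z))"
      and X = "\<lambda>i z. history_prefix M (fst z) i" and A = "shock_space M" and Z = ?Z and i = i,
      OF prob_shock Z meas _ _ _ append_round_preserving]
  have i: "measure_preserving SS (SS \<Otimes>\<^sub>M ?Z) (\<lambda>\<omega>. (\<omega>, ()))"
  proof (rule measure_preservingI)
    fix g :: "_ \<Rightarrow> ennreal" assume "g \<in> borel_measurable (SS \<Otimes>\<^sub>M ?Z)"
    then show "(\<integral>\<^sup>+x. g (x, ()) \<partial>SS) = (\<integral>\<^sup>+y. g y \<partial>(SS \<Otimes>\<^sub>M ?Z))"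
      by (subst nn_integral_pair[OF Z]) (auto simp: nn_integral_return)
  qed (rule measurable_Pair2', simp)
  show "measure_preserving SS (prefix_law i) (\<lambda>\<omega>. history_prefix M \<omega> i)"
    using measure_preserving_comp[OF i L(1)] prefix_law_0[OF SZ] by (simp add: history_prefix_cong)
  show "measure_preserving SS (prefix_law i \<Otimes>\<^sub>M shock_space M) (\<lambda>\<omega>. (history_prefix M \<omega> i, \<omega> i))"
    using measure_preserving_comp[OF i L(2)] prefix_law_0[OF SZ] by (simp add: history_prefix_cong)
qed

text \<open>The invariant is a product law: the unread rest of the tapes stays i.i.d. and
  independent of the history so far. For each fixed history \<open>read_tape\<close> preserves the
  joint law of shock and tapes, after which the round is appended without touching the rest of the
  tapes.\<close>

lemma tape_step_preserving:
  "measure_preserving ((prefix_law i \<Otimes>\<^sub>M TS) \<Otimes>\<^sub>M shock_space M) (prefix_law (Suc i) \<Otimes>\<^sub>M TS) (tape_step M i)"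
proof -
  note P = prob_prefix_law prob_tape prob_shock
  note PP = prob_space_pair_measure
  have sets: "sets (prefix_law i \<Otimes>\<^sub>M (shock_space M \<Otimes>\<^sub>M TS)) = sets (HS i \<Otimes>\<^sub>M (shock_space M \<Otimes>\<^sub>M TS))"
    by (intro sets_pair_measure_cong sets_prefix_law refl)
  have "measure_preserving (prefix_law i \<Otimes>\<^sub>M (shock_space M \<Otimes>\<^sub>M TS)) (prefix_law i \<Otimes>\<^sub>M (shock_space M \<Otimes>\<^sub>M TS))
      (\<lambda>z. (fst z, read_tape M i (fst z) (snd z)))"
  proof (rule measure_preserving_fibrewise)
    show "(\<lambda>(h, z). read_tape M i h z) \<in> prefix_law i \<Otimes>\<^sub>M (shock_space M \<Otimes>\<^sub>M TS) \<rightarrow>\<^sub>M shock_space M \<Otimes>\<^sub>M TS"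
      using read_tape_measurable[of i] by (simp add: measurable_cong_sets[OF sets refl] split_beta')
    fix h assume "h \<in> space (prefix_law i)"
    then show "measure_preserving (shock_space M \<Otimes>\<^sub>M TS) (shock_space M \<Otimes>\<^sub>M TS) (read_tape M i h)"
      using read_tape_preserving[of h i] by (simp add: sets_eq_imp_space_eq[OF sets_prefix_law])
  qed (intro PP P)+
  note 2 = this
  note 1 = measure_preserving_comp[OF measure_preserving_assoc(1)[OF P]
      measure_preserving_map_prod[OF measure_preserving_id measure_preserving_swap[OF P(2,3)] PP[OF P(2,3)] PP[OF P(3,2)]]]
  note 3 = measure_preserving_comp[OF measure_preserving_assoc(2)[OF P(1,3,2)]
      measure_preserving_map_prod[OF append_round_preserving measure_preserving_id P(2,2)]]
  show ?thesis
    using measure_preserving_comp[OF 1 measure_preserving_comp[OF 2 3]]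
    by (simp add: tape_step_def[abs_def] Let_def)
qed

lemma tape_state_measurable: "tape_state M i \<in> SS \<Otimes>\<^sub>M TS \<rightarrow>\<^sub>M prefix_law i \<Otimes>\<^sub>M TS"
proof (induction i)
  case 0
  have "(\<lambda>_. \<lambda>_. undefined) \<in> SS \<Otimes>\<^sub>M TS \<rightarrow>\<^sub>M prefix_law 0"
    by (rule measurable_const) (simp add: space_PiM)
  from measurable_Pair[OF this measurable_snd] show ?case by simp
next
  case (Suc i)
  have "(\<lambda>z. (tape_state M i z, fst z i)) \<in> SS \<Otimes>\<^sub>M TS \<rightarrow>\<^sub>M (prefix_law i \<Otimes>\<^sub>M TS) \<Otimes>\<^sub>M shock_space M"
    by (intro measurable_Pair Suc measurable_compose[OF measurable_fst measurable_component_singleton]) simp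
  from measurable_compose[OF this measure_preserving_measurable[OF tape_step_preserving]]
  show ?case by simp
qed

lemma tape_state_cong: "\<forall>r<i. \<omega> r = \<omega>' r \<Longrightarrow> tape_state M i (\<omega>, T) = tape_state M i (\<omega>', T)"
  by (induction i) auto

lemma tape_state_law:
  "measure_preserving (SS \<Otimes>\<^sub>M TS) (prefix_law i \<Otimes>\<^sub>M TS) (tape_state M i)"
proof (rule driven_process_law(1)[where L = "\<lambda>i. prefix_law i \<Otimes>\<^sub>M TS" and f = "tape_step M" and A = "shock_space M"])
  have "prob_space SS" by (intro prob_space_PiM prob_shock)
  from measure_preserving_map_prod[OF prefix_law_0[OF this] measure_preserving_id prob_tape prob_tape]
  show "measure_preserving (SS \<Otimes>\<^sub>M TS) (prefix_law 0 \<Otimes>\<^sub>M TS) (tape_state M 0)"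
    by (rule back_subst[where P = "measure_preserving _ _"]) (simp add: fun_eq_iff)
qed (rule prob_shock prob_tape tape_state_measurable tape_step_preserving tape_state_cong | simp)+

lemma history_measurable: "history M \<in> SS \<rightarrow>\<^sub>M history_space M UNIV"
proof -
  have "(\<lambda>\<omega>. history M \<omega> i) \<in> SS \<rightarrow>\<^sub>M outcome_space M" for i
    unfolding history_def
    using measurable_compose[OF history_prefix_measurable[of "Suc i", unfolded history_space_def]
        measurable_component_singleton[of i]] by simp
  moreover have "history M \<omega> i \<in> space (outcome_space M)" if "\<omega> \<in> space SS" for \<omega> i
    using measurable_space[OF calculation that] .
  ultimately show ?thesis
    unfolding history_space_def by (intro measurable_PiM_single') auto
qed

lemma tape_history_measurable: "tape_history M \<in> SS \<Otimes>\<^sub>M TS \<rightarrow>\<^sub>M history_space M UNIV"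
proof -
  have st: "(\<lambda>z. fst (tape_state M n z)) \<in> SS \<Otimes>\<^sub>M TS \<rightarrow>\<^sub>M HS n" for n
    using measurable_compose[OF tape_state_measurable measurable_fst]
    by (simp add: measurable_cong_sets[OF refl sets_prefix_law])
  have "(\<lambda>z. tape_history M z i) \<in> SS \<Otimes>\<^sub>M TS \<rightarrow>\<^sub>M outcome_space M" for i
    unfolding tape_history_def
    using measurable_compose[OF st[of "Suc i", unfolded history_space_def]
        measurable_component_singleton[of i]] by simp
  moreover have "tape_history M z i \<in> space (outcome_space M)" if "z \<in> space (SS \<Otimes>\<^sub>M TS)" for z i
    using measurable_space[OF calculation that] .
  ultimately show ?thesis
    unfolding history_space_def by (intro measurable_PiM_single') auto
qed

theorem tape_history_law: "measure_preserving (SS \<Otimes>\<^sub>M TS) (history_law M) (tape_history M)"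
proof -
  have sets: "sets (history_law M) = sets (history_space M UNIV)" by (simp add: history_law_def)
  have r: "(\<lambda>x. restrict x {..<n}) \<in> history_space M UNIV \<rightarrow>\<^sub>M HS n" for n
    unfolding history_space_def by (rule measurable_restrict_subset) simp
  have "distr (SS \<Otimes>\<^sub>M TS) (history_space M UNIV) (tape_history M) = history_law M"
    unfolding history_space_def
  proof (rule PiM_UNIV_eqI)
    show "sets (history_law M) = sets (PiM UNIV (\<lambda>_. outcome_space M))"
      using sets by (simp add: history_space_def)
    interpret prob_space "SS \<Otimes>\<^sub>M TS" by (rule prob_history_source)
    show "finite_measure (distr (SS \<Otimes>\<^sub>M TS) (PiM UNIV (\<lambda>_. outcome_space M)) (tape_history M))"
      using tape_history_measurable by (intro finite_measure_distr) (simp add: history_space_def)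
    fix n
    have "distr (distr (SS \<Otimes>\<^sub>M TS) (history_space M UNIV) (tape_history M)) (HS n) (\<lambda>x. restrict x {..<n}) =
        distr (SS \<Otimes>\<^sub>M TS) (HS n) (\<lambda>z. fst (tape_state M n z))"
      by (subst distr_distr[OF r tape_history_measurable]) (simp add: comp_def restrict_tape_history)
    also have "\<dots> = prefix_law n"
    proof -
      have "measure_preserving (SS \<Otimes>\<^sub>M TS) (prefix_law n) (\<lambda>z. fst (tape_state M n z))"
        using measure_preserving_comp[OF measure_preserving_comp[OF tape_state_law
              measure_preserving_swap[OF prob_prefix_law prob_tape]] measure_preserving_snd[OF prob_tape prob_prefix_law]]
        by simp
      then show ?thesis
        unfolding measure_preserving_def
        by (metis (no_types, lifting) distr_cong sets_prefix_law)
    qed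
    also have "\<dots> = distr SS (HS n) (\<lambda>\<omega>. history_prefix M \<omega> n)"
      using history_prefix_law(1)[of n] unfolding measure_preserving_def
      by (metis (no_types, lifting) distr_cong sets_prefix_law)
    also have "\<dots> = distr (history_law M) (HS n) (\<lambda>x. restrict x {..<n})"
      unfolding history_law_def
      by (subst distr_distr[OF r history_measurable]) (simp add: comp_def restrict_history)
    finally show "distr (distr (SS \<Otimes>\<^sub>M TS) (PiM UNIV (\<lambda>_. outcome_space M)) (tape_history M)) (PiM {..<n} (\<lambda>_. outcome_space M))
       (\<lambda>x. restrict x {..<n}) = distr (history_law M) (PiM {..<n} (\<lambda>_. outcome_space M)) (\<lambda>x. restrict x {..<n})"
      by (simp add: history_space_def)
  qed simp
  then show ?thesis
    using tape_history_measurable sets unfolding measure_preserving_def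
    by (metis (no_types, lifting) distr_cong measurable_cong_sets)
qed

end

section \<open>Supports and posteriors\<close>

lemma closed_msupport: "closed (msupport N)"
proof -
  have "- msupport N = \<Union>{U. open U \<and> emeasure N U = 0}"
    by (auto simp: msupport_def zero_less_iff_neq_zero)
  moreover have "open (\<Union>{U. open U \<and> emeasure N U = 0})" by (rule open_Union) auto
  ultimately show ?thesis unfolding closed_def by simp
qed

text \<open>The complement of the support is a union of open null sets, and by the Lindelof property
  countably many of them suffice.\<close>

lemma AE_msupport:
  fixes N :: "'a::second_countable_topology measure"
  assumes sets: "sets N = sets borel"
  shows "AE x in N. x \<in> msupport N"
proof -
  let ?F = "{U. open U \<and> emeasure N U = 0}"
  obtain F' where F': "F' \<subseteq> ?F" "countable F'" "\<Union>F' = \<Union>?F"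
    using Lindelof[of ?F] by auto
  have "\<Union>F' \<in> null_sets N"
  proof (rule null_sets_UN'[of F' "\<lambda>U. U", simplified])
    show "countable F'" by fact
    fix U assume "U \<in> F'"
    then show "U \<in> null_sets N" using F'(1) by (auto simp: null_sets_def sets)
  qed
  moreover have "{x \<in> space N. x \<notin> msupport N} \<subseteq> \<Union>F'"
    unfolding F'(3) by (auto simp: msupport_def zero_less_iff_neq_zero)
  ultimately show ?thesis by (rule AE_I'[of _ N "\<lambda>x. x \<in> msupport N"])
qed

lemma msupport_nonempty:
  fixes N :: "'a::second_countable_topology measure"
  assumes "prob_space N" "sets N = sets borel"
  shows "msupport N \<noteq> {}"
proof
  interpret prob_space N by fact
  assume "msupport N = {}"
  then have "AE x in N. False" using AE_msupport[OF assms(2)] by simp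
  then show False by simp
qed

lemma msupport_interval_pos:
  fixes N :: "real measure"
  assumes "x \<in> msupport N" "a < x"
  shows "emeasure N {a<..} > 0"
  using assms by (auto simp: msupport_def)

context valid_market begin

lemma bounded_value_support: "bounded (msupport (value_dist M))"
  using wf by (simp add: wf_market_def)

lemma max_value_in_support: "max_value M \<in> msupport (value_dist M)"
  unfolding max_value_def
  using msupport_nonempty[OF prob_value sets_value] bounded_value_support closed_msupport
  by (intro closed_contains_Sup bounded_imp_bdd_above)

lemma AE_value: "AE v in value_dist M. 0 \<le> v \<and> v \<le> max_value M"
proof -
  have "AE v in value_dist M. 0 \<le> v" using wf by (simp add: wf_market_def)
  then show ?thesis
    using AE_msupport[OF sets_value]
  proof eventually_elim
    case (elim v)
    then show ?case
      using bounded_value_support by (auto simp: max_value_def intro!: cSup_upper bounded_imp_bdd_above)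
  qed
qed

lemma max_value_nonneg: "0 \<le> max_value M"
proof -
  interpret prob_space "value_dist M" by (rule prob_value)
  have "AE v in value_dist M. 0 \<le> max_value M" using AE_value by eventually_elim simp
  then show ?thesis by simp
qed

lemma value_above_pos: "a < max_value M \<Longrightarrow> emeasure (value_dist M) {a<..} > 0"
  by (rule msupport_interval_pos[OF max_value_in_support])

lemma shock_components_preserving:
  "measure_preserving (shock_space M) (value_dist M) fst"
  "j < m \<Longrightarrow> measure_preserving (shock_space M) (uniform_measure lborel {0..1}) (\<lambda>s. snd (snd (snd s)) j)"
proof -
  let ?U = "PiM {..<m} (\<lambda>j. uniform_measure lborel {0..1::real})"
  let ?C = "\<lambda>p. PiM {..<m} (\<lambda>j. measure_pmf (bernoulli_pmf (p j)))"
  have U: "prob_space ?U" by (intro prob_space_PiM prob_seed)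
  note C = prob_coin(1) and PP = prob_space_pair_measure
  note QU = PP[OF C[of "quality M"] U]
  note FQU = PP[OF C[of "fit_prob M"] QU]
  show "measure_preserving (shock_space M) (value_dist M) fst"
    unfolding shock_space_def
    using measure_preserving_comp[OF measure_preserving_swap[OF prob_value FQU]
        measure_preserving_snd[OF FQU prob_value]] by simp
  have u: "measure_preserving (shock_space M) ?U (\<lambda>s. snd (snd (snd s)))"
    unfolding shock_space_def
    by (rule measure_preserving_comp[OF measure_preserving_snd[OF prob_value FQU]
        measure_preserving_comp[OF measure_preserving_snd[OF C QU] measure_preserving_snd[OF C U]]])
  assume j: "j < m"
  have "measure_preserving ?U (uniform_measure lborel {0..1}) (\<lambda>u. u j)"
    unfolding measure_preserving_def
    using j distr_PiM_component[of "{..<m}" "\<lambda>j. uniform_measure lborel {0..1::real}" j] prob_seed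
    by (auto intro!: measurable_component_singleton)
  from measure_preserving_comp[OF u this]
  show "measure_preserving (shock_space M) (uniform_measure lborel {0..1}) (\<lambda>s. snd (snd (snd s)) j)" .
qed

lemma prior_prob: "j < m \<Longrightarrow> prob_space (prior M j)"
  unfolding prior_def using wf by (intro prob_space_pair_measure) (auto simp: wf_market_def)

lemma sets_prior: "j < m \<Longrightarrow> sets (prior M j) = sets borel"
  unfolding prior_def borel_prod[symmetric] using wf
  by (intro sets_pair_measure_cong) (auto simp: wf_market_def)

lemma AE_prior:
  assumes j: "j < m"
  shows "AE \<theta> in prior M j. 0 < fst \<theta> \<and> fst \<theta> < 1 \<and> 0 \<le> snd \<theta> \<and> snd \<theta> \<le> 1"
proof -
  have P: "prob_space (fit_prior M j)" "prob_space (quality_prior M j)"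
    and AE: "AE p in fit_prior M j. p \<in> {0<..<1}" "AE p in quality_prior M j. p \<in> {0..1}"
    using wf j by (auto simp: wf_market_def)
  have "AE \<theta> in prior M j. fst \<theta> \<in> {0<..<1}"
    unfolding prior_def
    using AE_measure_preserving[OF measure_preserving_comp[OF measure_preserving_swap[OF P]
        measure_preserving_snd[OF P(2,1)]] AE(1)] by simp
  moreover have "AE \<theta> in prior M j. snd \<theta> \<in> {0..1}"
    unfolding prior_def by (rule AE_measure_preserving[OF measure_preserving_snd[OF P] AE(2)])
  ultimately show ?thesis by eventually_elim auto
qed

end

text \<open>The \<open>posterior\<close> with an arbitrary likelihood, so that histories and tapes
  can be treated alike. If \<open>L\<close> integrates to 0, division by 0 makes this the null
  measure, as for an impossible history.\<close>

definition bayes :: "'a measure \<Rightarrow> ('a \<Rightarrow> real) \<Rightarrow> 'a measure" where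
  "bayes D L = density D (\<lambda>\<theta>. ennreal (L \<theta> / (\<integral>\<theta>'. L \<theta>' \<partial>D)))"

lemma posterior_eq_bayes: "posterior M j i h = bayes (prior M j) (likelihood j i h)"
  by (simp add: posterior_def bayes_def)

locale likelihood_function = prob_space D for D :: "'a measure" +
  fixes L :: "'a \<Rightarrow> real"
  assumes L[measurable]: "L \<in> borel_measurable D" and L01: "AE \<theta> in D. 0 \<le> L \<theta> \<and> L \<theta> \<le> 1"
begin

abbreviation "Z \<equiv> \<integral>\<theta>. L \<theta> \<partial>D"

lemma integrable_L: "integrable D L"
  by (rule integrable_const_bound[where B = 1]) (use L01 in auto)

lemma Z_nonneg: "0 \<le> Z"
  by (rule integral_nonneg_AE) (use L01 in auto)

lemma bayes_null: "Z = 0 \<Longrightarrow> measure (bayes D L) A = 0"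
  unfolding bayes_def by (simp add: null_measure_eq_density[symmetric])

lemma prob_bayes:
  assumes "Z \<noteq> 0"
  shows "prob_space (bayes D L)"
proof (rule prob_spaceI)
  have "emeasure (bayes D L) (space (bayes D L)) = (\<integral>\<^sup>+\<theta>. ennreal (L \<theta> / Z) \<partial>D)"
    unfolding bayes_def by (subst emeasure_density) (auto intro!: nn_integral_cong)
  also have "\<dots> = ennreal (\<integral>\<theta>. L \<theta> / Z \<partial>D)"
    using L01 Z_nonneg integrable_L by (intro nn_integral_eq_integral) auto
  finally show "emeasure (bayes D L) (space (bayes D L)) = 1" using assms by simp
qed

lemma integral_bayes:
  assumes [measurable]: "f \<in> borel_measurable D"
  shows "(\<integral>\<theta>. f \<theta> \<partial>bayes D L) = (\<integral>\<theta>. L \<theta> * f \<theta> \<partial>D) / Z"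
proof -
  have "(\<integral>\<theta>. f \<theta> \<partial>bayes D L) = (\<integral>\<theta>. L \<theta> / Z * f \<theta> \<partial>D)"
    unfolding bayes_def using L01 Z_nonneg by (subst integral_density) (auto intro!: divide_nonneg_nonneg)
  then show ?thesis by simp
qed

lemma AE_bayes: "(AE \<theta> in bayes D L. P \<theta>) \<longleftrightarrow> (AE \<theta> in D. 0 < L \<theta> / Z \<longrightarrow> P \<theta>)"
  unfolding bayes_def by (subst AE_density) simp_all

end

lemma AE_const_from_balls:
  fixes a :: "'b::metric_space"
  assumes "prob_space N" and N: "sets N = sets borel"
    and ball: "\<And>e. 0 < e \<Longrightarrow> measure N (ball a e) = 1"
  shows "AE x in N. x = a"
proof -
  interpret prob_space N by fact
  have "AE x in N. x \<in> ball a (1 / Suc n)" for n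
    using ball[of "1 / Suc n"] by (subst AE_in_set_eq_1) (auto simp: N)
  then have "AE x in N. \<forall>n. x \<in> ball a (1 / Suc n)" by (simp add: AE_all_countable)
  then show ?thesis
  proof eventually_elim
    case (elim x)
    show ?case
    proof (rule ccontr)
      assume "x \<noteq> a"
      then obtain n where "1 / Suc n < dist a x"
        using nat_approx_posE[of "dist a x"] by auto
      then show False using elim[rule_format, of n] by (simp add: less_imp_not_less)
    qed
  qed
qed

text \<open>A posterior concentrated at \<open>a\<close> means that \<open>L\<close> vanishes almost
  everywhere off \<open>a\<close>, so the prior has an atom there. Further data of likelihood
  \<open>R\<close> merely multiply the weight of this atom by \<open>R a\<close>, and a positive
  factor cannot remove it.\<close>

lemma bayes_concentrated:
  fixes D :: "'b::metric_space measure"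
  assumes D: "prob_space D" "sets D = sets borel"
    and L: "likelihood_function D L" and R: "likelihood_function D (\<lambda>\<theta>. L \<theta> * R \<theta>)"
    and Ra: "R a > 0"
    and ball: "\<And>e. 0 < e \<Longrightarrow> measure (bayes D L) (ball a e) = 1"
  shows "prob_space (bayes D (\<lambda>\<theta>. L \<theta> * R \<theta>))" "AE \<theta> in bayes D (\<lambda>\<theta>. L \<theta> * R \<theta>). \<theta> = a"
proof -
  interpret L: likelihood_function D L by fact
  interpret R: likelihood_function D "\<lambda>\<theta>. L \<theta> * R \<theta>" by fact
  have Z: "L.Z \<noteq> 0" using ball[of 1] L.bayes_null by auto
  interpret B: prob_space "bayes D L" by (rule L.prob_bayes[OF Z])
  have "AE \<theta> in bayes D L. \<theta> = a"
    by (rule AE_const_from_balls[OF B.prob_space_axioms]) (simp_all add: ball, simp add: bayes_def D)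
  then have "AE \<theta> in D. 0 < L \<theta> / L.Z \<longrightarrow> \<theta> = a" by (simp add: L.AE_bayes)
  then have supp: "AE \<theta> in D. L \<theta> \<noteq> 0 \<longrightarrow> \<theta> = a"
    using L.L01 by eventually_elim (use Z L.Z_nonneg in auto)
  have a[measurable]: "{a} \<in> sets D" by (simp add: D)
  have "L.Z = (\<integral>\<theta>. L a * indicator {a} \<theta> \<partial>D)"
    by (rule integral_cong_AE) (use supp in \<open>auto simp: indicator_def\<close>)
  moreover have "R.Z = (\<integral>\<theta>. L a * R a * indicator {a} \<theta> \<partial>D)"
    by (rule integral_cong_AE) (use supp in \<open>auto simp: indicator_def\<close>)
  ultimately have "R.Z = L.Z * R a" by simp
  then have RZ: "R.Z \<noteq> 0" using Z Ra by simp
  then show "prob_space (bayes D (\<lambda>\<theta>. L \<theta> * R \<theta>))" by (rule R.prob_bayes)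
  show "AE \<theta> in bayes D (\<lambda>\<theta>. L \<theta> * R \<theta>). \<theta> = a"
    unfolding R.AE_bayes using supp by eventually_elim auto
qed

text \<open>An inspection that reveals a fit always ends in a transaction, so the quality entry
  counts exactly when the fit entry is true. The positions form a set, so that the product can be
  split into the entries read so far and the later ones.\<close>

definition tape_likelihood :: "(nat \<Rightarrow> bool) \<Rightarrow> (nat \<Rightarrow> bool) \<Rightarrow> nat set \<Rightarrow> real \<times> real \<Rightarrow> real" where
  "tape_likelihood f g K = (\<lambda>(p, x). \<Prod>k\<in>K. if f k then p * (if g k then x else 1 - x) else 1 - p)"

definition tape_belief :: "market \<Rightarrow> nat \<Rightarrow> tape \<Rightarrow> nat \<Rightarrow> (real \<times> real) measure" where
  "tape_belief M j T n = bayes (prior M j) (tape_likelihood (fst T j) (snd T j) {..<n})"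

context valid_market begin

lemma likelihood_function_likelihood:
  assumes "j < m" shows "likelihood_function (prior M j) (likelihood j i h)"
proof -
  interpret prob_space "prior M j" by (rule prior_prob[OF assms])
  show ?thesis
  proof
    show "likelihood j i h \<in> borel_measurable (prior M j)"
      unfolding measurable_cong_sets[OF sets_prior[OF assms] refl] likelihood_def
      by (simp add: split_beta' borel_prod[symmetric])
        (intro borel_measurable_prod borel_measurable_times; simp add: split_beta' option.case_eq_if)
    show "AE \<theta> in prior M j. 0 \<le> likelihood j i h \<theta> \<and> likelihood j i h \<theta> \<le> 1"
      using AE_prior[OF assms]
    proof eventually_elim
      case (elim \<theta>)
      have "0 \<le> (case fst (snd (h r)) j of None \<Rightarrow> 1 | Some f \<Rightarrow> if f then fst \<theta> else 1 - fst \<theta>) *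
        (case snd (snd (h r)) of None \<Rightarrow> 1 | Some (k, good) \<Rightarrow>
          if k = j then (if good then snd \<theta> else 1 - snd \<theta>) else 1) \<and>
        (case fst (snd (h r)) j of None \<Rightarrow> 1 | Some f \<Rightarrow> if f then fst \<theta> else 1 - fst \<theta>) *
        (case snd (snd (h r)) of None \<Rightarrow> 1 | Some (k, good) \<Rightarrow>
          if k = j then (if good then snd \<theta> else 1 - snd \<theta>) else 1) \<le> 1" for r
        using elim by (intro conjI mult_nonneg_nonneg mult_le_one) (auto split: option.split)
      then show ?case
        unfolding likelihood_def by (auto simp: split_beta' intro!: prod_nonneg prod_le_1)
    qed
  qed
qed

lemma likelihood_function_tape:
  assumes "j < m" "finite K" shows "likelihood_function (prior M j) (tape_likelihood f g K)"
proof -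
  interpret prob_space "prior M j" by (rule prior_prob[OF assms(1)])
  show ?thesis
  proof
    show "tape_likelihood f g K \<in> borel_measurable (prior M j)"
      unfolding measurable_cong_sets[OF sets_prior[OF assms(1)] refl] tape_likelihood_def
      by (simp add: split_beta' borel_prod[symmetric])
    show "AE \<theta> in prior M j. 0 \<le> tape_likelihood f g K \<theta> \<and> tape_likelihood f g K \<theta> \<le> 1"
      using AE_prior[OF assms(1)]
    proof eventually_elim
      case (elim \<theta>)
      have "0 \<le> (if f k then fst \<theta> * (if g k then snd \<theta> else 1 - snd \<theta>) else 1 - fst \<theta>) \<and>
        (if f k then fst \<theta> * (if g k then snd \<theta> else 1 - snd \<theta>) else 1 - fst \<theta>) \<le> 1" for k
        using elim by (auto intro!: mult_le_one)
      then show ?case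
        unfolding tape_likelihood_def by (auto simp: split_beta' intro!: prod_nonneg prod_le_1)
    qed
  qed
qed

text \<open>Some price would make the consumer of maximal value inspect, at the search cost of
  \<open>M\<close>. It is later applied as \<open>high.viable\<close> to beliefs that arise in
  \<open>Mt\<close>.\<close>

definition viable :: "(real \<times> real) measure \<Rightarrow> bool" where
  "viable B \<longleftrightarrow> search_index M 0 B (max_value M) > 0"

lemma mean_posterior:
  assumes j: "j < m"
  shows "0 \<le> mean_quality (posterior M j i h)" "mean_quality (posterior M j i h) \<le> 1"
    "0 \<le> mean_fit (posterior M j i h)" "mean_fit (posterior M j i h) \<le> 1"
    "viable (posterior M j i h) \<Longrightarrow> 0 < mean_fit (posterior M j i h)"
proof -
  interpret likelihood_function "prior M j" "likelihood j i h" by (rule likelihood_function_likelihood[OF j])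
  have [measurable]: "fst \<in> borel_measurable (prior M j)" "snd \<in> borel_measurable (prior M j)"
    by (simp_all add: measurable_cong_sets[OF sets_prior[OF j] refl] borel_prod[symmetric])
  let ?L = "likelihood j i h"
  have fit: "mean_fit (posterior M j i h) = (\<integral>\<theta>. ?L \<theta> * fst \<theta> \<partial>prior M j) / Z"
    unfolding mean_fit_def posterior_eq_bayes by (rule integral_bayes) simp
  have qual: "mean_quality (posterior M j i h) = (\<integral>\<theta>. ?L \<theta> * snd \<theta> \<partial>prior M j) / Z"
    unfolding mean_quality_def posterior_eq_bayes by (rule integral_bayes) simp
  have bnd: "AE \<theta> in prior M j. 0 \<le> ?L \<theta> * fst \<theta> \<and> ?L \<theta> * fst \<theta> \<le> ?L \<theta> \<and>
     0 \<le> ?L \<theta> * snd \<theta> \<and> ?L \<theta> * snd \<theta> \<le> ?L \<theta>"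
    using L01 AE_prior[OF j] by eventually_elim (auto intro: mult_left_le)
  have i1: "integrable (prior M j) (\<lambda>\<theta>. ?L \<theta> * fst \<theta>)" and i2: "integrable (prior M j) (\<lambda>\<theta>. ?L \<theta> * snd \<theta>)"
    using bnd L01 by (auto intro!: integrable_const_bound[where B = 1])
  have "0 \<le> (\<integral>\<theta>. ?L \<theta> * fst \<theta> \<partial>prior M j)" "0 \<le> (\<integral>\<theta>. ?L \<theta> * snd \<theta> \<partial>prior M j)"
    by (rule integral_nonneg_AE; use bnd in auto)+
  moreover have "(\<integral>\<theta>. ?L \<theta> * fst \<theta> \<partial>prior M j) \<le> Z" "(\<integral>\<theta>. ?L \<theta> * snd \<theta> \<partial>prior M j) \<le> Z"
    using i1 i2 integrable_L bnd by (auto intro!: integral_mono_AE)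
  ultimately show "0 \<le> mean_quality (posterior M j i h)" "mean_quality (posterior M j i h) \<le> 1"
    "0 \<le> mean_fit (posterior M j i h)" "mean_fit (posterior M j i h) \<le> 1"
    unfolding fit qual using Z_nonneg by (auto simp: divide_le_eq_1)
  then show "0 < mean_fit (posterior M j i h)" if v: "viable (posterior M j i h)"
  proof -
    \<comment> \<open>If \<open>Z\<close> were 0, both means would be 0 and so would the index,
      since \<open>x / 0 = 0\<close>; this is not positive.\<close>
    have Z: "Z \<noteq> 0" using v by (auto simp: viable_def search_index_def fit qual)
    have "(\<integral>\<theta>. ?L \<theta> * fst \<theta> \<partial>prior M j) \<noteq> 0"
    proof
      assume "(\<integral>\<theta>. ?L \<theta> * fst \<theta> \<partial>prior M j) = 0"
      then have "AE \<theta> in prior M j. ?L \<theta> * fst \<theta> = 0"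
        using integral_nonneg_eq_0_iff_AE[OF i1] bnd by simp
      then have "AE \<theta> in prior M j. ?L \<theta> = 0"
        using AE_prior[OF j] by eventually_elim auto
      then have "Z = (\<integral>\<theta>. 0 \<partial>prior M j)" by (intro integral_cong_AE) auto
      then show False using Z by simp
    qed
    then have "mean_fit (posterior M j i h) \<noteq> 0" using Z by (simp add: fit)
    then show ?thesis using \<open>0 \<le> mean_fit (posterior M j i h)\<close> by simp
  qed
qed

end

section \<open>Almost sure properties of the dynamics\<close>

lemma play_round_inspected_set:
  "j < nbiz M \<Longrightarrow> inspected (play_round M i h s) j \<longleftrightarrow> j \<in> inspected_set M i h s (fst (snd s))"
  by (cases s) (simp add: play_round_inspected inspected_set_def)

lemma play_round_transacts:
  "snd (snd (play_round M i h s)) = Some (j, g) \<longleftrightarrow>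
    j < nbiz M \<and> inspected (play_round M i h s) j \<and> fst (snd s) j \<and> g = fst (snd (snd s)) j"
  by (cases s) (auto simp: play_round_transaction play_round_inspected transacts_def inspects_def)

lemma play_round_records:
  "j < nbiz M \<Longrightarrow> inspected (play_round M i h s) j \<Longrightarrow>
    fst (snd (play_round M i h s)) j = Some (fst (snd s) j)"
  by (cases s) (auto simp: play_round_inspection inspected_def split: if_splits)

section \<open>Beliefs along a tape\<close>

definition inspections :: "(nat \<Rightarrow> outcome) \<Rightarrow> nat \<Rightarrow> nat \<Rightarrow> nat" where
  "inspections H j i = card {r. r < i \<and> inspected (H r) j}"

lemma inspections_0 [simp]: "inspections H j 0 = 0"
  by (simp add: inspections_def)

lemma inspections_Suc:
  "inspections H j (Suc i) = (if inspected (H i) j then Suc (inspections H j i) else inspections H j i)"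
proof -
  have "{r. r < Suc i \<and> inspected (H r) j} =
    (if inspected (H i) j then insert i {r. r < i \<and> inspected (H r) j} else {r. r < i \<and> inspected (H r) j})"
    by (auto simp: less_Suc_eq)
  then show ?thesis by (simp add: inspections_def)
qed

lemma mono_inspections: "i \<le> i' \<Longrightarrow> inspections H j i \<le> inspections H j i'"
  by (rule lift_Suc_mono_le[of "inspections H j"]) (auto simp: inspections_Suc)

text \<open>One round of the tape dynamics, unfolded. The set of tapes that \<open>read_tape\<close>
  advances is chosen before the round is played, and it coincides with the set of businesses that
  the round records as inspected.\<close>

lemma tape_round:
  fixes M i z
  defines "T \<equiv> snd (tape_state M i z)" and "H \<equiv> tape_history M z"
  defines "y \<equiv> read_tape M i (fst (tape_state M i z)) (fst z i, T)"
  shows "H i = play_round M i (fst (tape_state M i z)) (fst y)"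
    and "snd (tape_state M (Suc i) z) = snd y"
    and "j < nbiz M \<Longrightarrow> inspected (H i) j \<Longrightarrow>
      fst (snd (fst y)) j = fst T j 0 \<and> fst (snd (snd (fst y))) j = snd T j 0"
    and "j < nbiz M \<Longrightarrow> fst (snd y) j = (if inspected (H i) j then (\<lambda>k. fst T j (Suc k)) else fst T j)"
    and "j < nbiz M \<Longrightarrow> snd (snd y) j = (if inspected (H i) j then (\<lambda>k. snd T j (Suc k)) else snd T j)"
proof -
  let ?h = "fst (tape_state M i z)"
  let ?I = "inspected_set M i ?h (fst z i) (\<lambda>j. fst T j 0)"
  show Hi: "H i = play_round M i ?h (fst y)" and "snd (tape_state M (Suc i) z) = snd y"
    by (simp_all add: H_def y_def T_def tape_history_def tape_step_def Let_def)
  have y: "y = substitute_heads M ?I (fst z i, T)" by (simp add: y_def read_tape_def)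
  have "?I \<subseteq> {..<nbiz M}" by (auto simp: inspected_set_def)
  from inspected_set_substitute_heads[OF this, where i = i and h = ?h and z = "(fst z i, T)"]
  have I: "inspected_set M i ?h (fst y) (fst (snd (fst y))) = ?I" by (simp add: y)
  assume j: "j < nbiz M"
  then have insp: "inspected (H i) j \<longleftrightarrow> j \<in> ?I" unfolding Hi by (simp add: play_round_inspected_set I)
  show "fst (snd y) j = (if inspected (H i) j then (\<lambda>k. fst T j (Suc k)) else fst T j)"
    "snd (snd y) j = (if inspected (H i) j then (\<lambda>k. snd T j (Suc k)) else snd T j)"
    unfolding insp unfolding y using j by (simp_all add: substitute_heads_simps)
  assume "inspected (H i) j"
  then show "fst (snd (fst y)) j = fst T j 0 \<and> fst (snd (snd (fst y))) j = snd T j 0"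
    unfolding insp using j by (simp add: y substitute_heads_simps)
qed

lemma tape_position:
  assumes j: "j < nbiz M"
  shows "fst (snd (tape_state M i z)) j = (\<lambda>k. fst (snd z) j (inspections (tape_history M z) j i + k))"
    and "snd (snd (tape_state M i z)) j = (\<lambda>k. snd (snd z) j (inspections (tape_history M z) j i + k))"
proof (induction i)
  case (Suc i)
  show "fst (snd (tape_state M (Suc i) z)) j = (\<lambda>k. fst (snd z) j (inspections (tape_history M z) j (Suc i) + k))"
    unfolding tape_round(2) tape_round(4)[OF j] Suc inspections_Suc by simp
  show "snd (snd (tape_state M (Suc i) z)) j = (\<lambda>k. snd (snd z) j (inspections (tape_history M z) j (Suc i) + k))"
    unfolding tape_round(2) tape_round(5)[OF j] Suc inspections_Suc by simp
qed auto

lemma tape_history_records: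
  fixes M z
  defines "H \<equiv> tape_history M z" and "T \<equiv> snd z"
  assumes j: "j < nbiz M"
  shows "inspected (H i) j \<Longrightarrow> fst (snd (H i)) j = Some (fst T j (inspections H j i))"
    and "snd (snd (H i)) = Some (j, g) \<longleftrightarrow>
      inspected (H i) j \<and> fst T j (inspections H j i) \<and> g = snd T j (inspections H j i)"
proof -
  show "fst (snd (H i)) j = Some (fst T j (inspections H j i))" if I: "inspected (H i) j"
    using play_round_records[OF j, of i "fst (tape_state M i z)" "fst (read_tape M i (fst (tape_state M i z)) (fst z i, snd (tape_state M i z)))"]
      tape_round(3)[OF j, of z i] I
    unfolding H_def T_def tape_round(1)[symmetric] tape_position[OF j] by simp
  show "snd (snd (H i)) = Some (j, g) \<longleftrightarrow>
      inspected (H i) j \<and> fst T j (inspections H j i) \<and> g = snd T j (inspections H j i)"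
    using play_round_transacts[of M i "fst (tape_state M i z)" "fst (read_tape M i (fst (tape_state M i z)) (fst z i, snd (tape_state M i z)))" j g]
      tape_round(3)[OF j, of z i] j
    unfolding H_def T_def tape_round(1)[symmetric] tape_position[OF j] by auto
qed

lemma likelihood_Suc:
  "likelihood j (Suc i) h = (\<lambda>(p, x). likelihood j i h (p, x) *
     ((case fst (snd (h i)) j of None \<Rightarrow> 1 | Some f \<Rightarrow> if f then p else 1 - p) *
     (case snd (snd (h i)) of None \<Rightarrow> 1
        | Some (k, good) \<Rightarrow> if k = j then (if good then x else 1 - x) else 1)))"
  by (auto simp: likelihood_def fun_eq_iff)

lemma likelihood_not_inspected:
  assumes "\<not> inspected (h i) j" "\<And>g. snd (snd (h i)) \<noteq> Some (j, g)"
  shows "likelihood j (Suc i) h = likelihood j i h"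
  using assms by (auto simp: likelihood_Suc fun_eq_iff inspected_def split: option.split)

text \<open>A round without an inspection of \<open>j\<close> contributes the factor 1, and an
  inspection contributes the factor of the next tape entry. So the rounds in which the inspections
  happen leave no trace.\<close>

lemma likelihood_tape_history:
  assumes j: "j < nbiz M"
  shows "likelihood j i (tape_history M z) =
    tape_likelihood (fst (snd z) j) (snd (snd z) j) {..<inspections (tape_history M z) j i}"
proof (induction i)
  case 0
  show ?case by (simp add: likelihood_def tape_likelihood_def)
next
  case (Suc i)
  let ?H = "tape_history M z"
  note rec = tape_history_records[OF j, where z = z and i = i]
  show ?case
  proof (cases "inspected (?H i) j")
    case False
    then show ?thesis
      using likelihood_not_inspected[of ?H i j] rec(2) Suc by (simp add: inspections_Suc)
  next
    case True
    let ?n = "inspections ?H j i"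
    have "(case snd (snd (?H i)) of None \<Rightarrow> 1 | Some (k, good) \<Rightarrow>
        if k = j then (if good then x else 1 - x) else 1) =
      (if fst (snd z) j ?n then if snd (snd z) j ?n then x else 1 - x else (1::real))" for x
    proof (cases "fst (snd z) j ?n")
      case True
      then have "snd (snd (?H i)) = Some (j, snd (snd z) j ?n)" using rec(2) \<open>inspected (?H i) j\<close> by blast
      then show ?thesis using True by simp
    next
      case False
      then have "\<And>g. snd (snd (?H i)) \<noteq> Some (j, g)" using rec(2) by blast
      then show ?thesis using False by (auto split: option.split)
    qed
    then show ?thesis
      unfolding likelihood_Suc Suc rec(1)[OF True] inspections_Suc
      using True by (auto simp: tape_likelihood_def fun_eq_iff)
  qed
qed

text \<open>This makes the two markets comparable: whatever happens elsewhere, the belief after the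
  same number of inspections is the same in both, because \<open>tape_belief\<close> involves
  neither prices nor the search cost.\<close>

lemma posterior_tape_history:
  "j < nbiz M \<Longrightarrow> posterior M j i (tape_history M z) =
    tape_belief M j (snd z) (inspections (tape_history M z) j i)"
  by (simp add: posterior_eq_bayes tape_belief_def likelihood_tape_history)

section \<open>Events of probability one along the history\<close>

context valid_market begin

lemma sets_history_law: "sets (history_law M) = sets (history_space M UNIV)"
  by (simp add: history_law_def)

lemma AE_history_lawI:
  assumes "AE \<omega> in SS. P (history M \<omega>)" "Measurable.pred (history_space M UNIV) P"
  shows "AE H in history_law M. P H"
  unfolding history_law_def
  by (subst AE_distr_iff[OF history_measurable]) (use assms in \<open>simp_all add: pred_def\<close>)

lemma pred_inspected: "j < m \<Longrightarrow> Measurable.pred (history_space M UNIV) (\<lambda>H. inspected (H i) j)"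
proof -
  assume j: "j < m"
  have "(\<lambda>H. H i) \<in> history_space M UNIV \<rightarrow>\<^sub>M outcome_space M"
    unfolding history_space_def by (rule measurable_component_singleton) simp
  from measurable_compose[OF this outcome_component_measurable(1)[OF j]]
  have "(\<lambda>H. fst (snd (H i)) j) \<in> history_space M UNIV \<rightarrow>\<^sub>M count_space UNIV" .
  from measurable_compose[OF this, of "\<lambda>x. x \<noteq> None" "count_space UNIV"]
  show ?thesis by (simp add: inspected_def)
qed

lemma pred_posterior: "j < m \<Longrightarrow> Measurable.pred (history_space M UNIV) (\<lambda>H. Q (posterior M' j i H))"
  by (rule posterior_function_measurable) auto

lemma history_round: "history M \<omega> i = play_round M i (history_prefix M \<omega> i) (\<omega> i)"
  by (simp add: history_def)

lemma posterior_prefix: "posterior M' j i (history_prefix M \<omega> i) = posterior M' j i (history M \<omega>)"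
  by (metis posterior_restrict restrict_history)

lemma prefix_space: "\<omega> \<in> space SS \<Longrightarrow> history_prefix M \<omega> i \<in> space (HS i)"
  using measurable_space[OF history_prefix_measurable] .

lemma AE_sequence: "AE s in shock_space M. P s \<Longrightarrow> AE \<omega> in SS. \<forall>i. P (\<omega> i)"
  unfolding AE_all_countable by (intro allI AE_PiM_component prob_shock) auto

text \<open>An inspection needs a positive index at the posted price and the actual value. Lowering
  the price to 0 and raising the value to the maximum can only increase the index, because the mean
  quality is nonnegative.\<close>

lemma AE_inspected_viable:
  "AE H in history_law M. \<forall>i. \<forall>j\<in>{..<m}. inspected (H i) j \<longrightarrow> viable (posterior M j i H)"
proof (rule AE_history_lawI)
  have "AE s in shock_space M. fst s \<le> max_value M"
    using AE_measure_preserving[OF shock_components_preserving(1) AE_value] by eventually_elim simp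
  \<comment> \<open>\<open>wf_market\<close> guarantees nonnegative prices only for seeds in the
    unit interval.\<close>
  moreover have "AE s in shock_space M. \<forall>j\<in>{..<m}. snd (snd (snd s)) j \<in> {0..1}"
  proof (intro AE_finite_allI finite_lessThan)
    fix j assume "j \<in> {..<m}"
    moreover have "AE u in uniform_measure lborel {0..1::real}. u \<in> {0..1}"
      by (subst AE_uniform_measure) auto
    ultimately show "AE s in shock_space M. snd (snd (snd s)) j \<in> {0..1}"
      using AE_measure_preserving[OF shock_components_preserving(2)] by blast
  qed
  ultimately have "AE s in shock_space M. fst s \<le> max_value M \<and> (\<forall>j\<in>{..<m}. snd (snd (snd s)) j \<in> {0..1})"
    by eventually_elim simp
  from AE_sequence[OF this] AE_space
  show "AE \<omega> in SS. \<forall>i. \<forall>j\<in>{..<m}. inspected (history M \<omega> i) j \<longrightarrow> viable (posterior M j i (history M \<omega>))"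
  proof eventually_elim
    case (elim \<omega>)
    show ?case
    proof (intro allI ballI impI)
      fix i j assume j: "j \<in> {..<m}" and "inspected (history M \<omega> i) j"
      then have "round_index M i (history_prefix M \<omega> i) (fst (\<omega> i)) (snd (snd (snd (\<omega> i)))) j > 0"
        by (auto simp: history_round play_round_inspected_set inspected_set_def inspects_def)
      moreover have "0 \<le> price_rule M j i (history_prefix M \<omega> i) (snd (snd (snd (\<omega> i))) j)"
        using wf j elim prefix_space[OF elim(2), of i] by (auto simp: wf_market_def)
      moreover have "fst (\<omega> i) * mean_quality (posterior M j i (history M \<omega>)) \<le>
          max_value M * mean_quality (posterior M j i (history M \<omega>))"
        using elim mean_posterior(1) j by (intro mult_right_mono) auto
      ultimately show "viable (posterior M j i (history M \<omega>))"
        unfolding viable_def round_index_def search_index_def posterior_prefix by linarith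
    qed
  qed
  show "Measurable.pred (history_space M UNIV)
      (\<lambda>H. \<forall>i. \<forall>j\<in>{..<m}. inspected (H i) j \<longrightarrow> viable (posterior M j i H))"
    by (intro pred_intros_countable pred_intros_finite(3) finite_lessThan pred_intros_logic(4)
      pred_inspected pred_posterior) auto
qed

text \<open>Missing \<open>G\<close> in \<open>n\<close> consecutive rounds from round
  \<open>i\<close> on has probability \<open>?p ^ n\<close>, which tends to 0 because
  \<open>?p < 1\<close>.\<close>

lemma AE_infinitely_often:
  assumes G: "G \<in> sets (shock_space M)" and pos: "emeasure (shock_space M) G > 0"
  shows "AE \<omega> in SS. \<forall>i. \<exists>r\<ge>i. \<omega> r \<in> G"
  unfolding AE_all_countable
proof
  fix i
  interpret A: prob_space "shock_space M" by (rule prob_shock)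
  interpret product_prob_space "\<lambda>_::nat. shock_space M" UNIV
    by (simp add: product_prob_space_def product_sigma_finite_def
        product_prob_space_axioms_def A.prob_space_axioms A.sigma_finite_measure_axioms)
  let ?p = "A.prob (space (shock_space M) - G)"
  have p: "?p < 1" "0 \<le> ?p"
    using pos by (simp_all add: A.prob_compl[OF G] A.emeasure_eq_measure)
  let ?E = "\<lambda>n. {\<omega> \<in> space SS. \<forall>r\<in>{i..<i + n}. \<omega> r \<in> space (shock_space M) - G}"
  have "{s \<in> space (shock_space M). s \<in> space (shock_space M) - G} = space (shock_space M) - G" by auto
  then have "{s \<in> space (shock_space M). s \<in> space (shock_space M) - G} \<in> sets (shock_space M)"
    using G by (simp only: sets.compl_sets)
  then have E: "?E n \<in> sets SS" for n
    by (intro sets.sets_Collect_finite_All sets_Collect_single'[where M = "\<lambda>_. shock_space M"]) auto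
  have "measure SS (?E n) = ?p ^ n" for n
    using emeasure_PiM_Collect[of "{i..<i + n}" "\<lambda>_. space (shock_space M) - G"] G
    by (simp add: P.emeasure_eq_measure A.emeasure_eq_measure prod_constant ennreal_power)
  then have lim: "(\<lambda>n. measure SS (?E n)) \<longlonglongrightarrow> 0"
    using p by (simp add: LIMSEQ_realpow_zero)
  have INT: "(\<Inter>n. ?E n) \<in> sets SS" using E by auto
  have "measure SS (\<Inter>n. ?E n) \<le> measure SS (?E n)" for n
    using E by (intro P.finite_measure_mono) auto
  then have "measure SS (\<Inter>n. ?E n) \<le> 0"
    using lim by (intro LIMSEQ_le_const[OF lim]) auto
  then have "(\<Inter>n. ?E n) \<in> null_sets SS"
    using INT by (auto simp: null_sets_def P.emeasure_eq_measure measure_le_0_iff)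
  moreover have "{\<omega> \<in> space SS. \<not> (\<exists>r\<ge>i. \<omega> r \<in> G)} \<subseteq> (\<Inter>n. ?E n)"
    by (auto simp: space_PiM)
  ultimately show "AE \<omega> in SS. \<exists>r\<ge>i. \<omega> r \<in> G"
    by (rule AE_I')
qed


text \<open>No business fits, so the search is not stopped and goes through all businesses of
  positive index. Such shocks have positive probability because all fit probabilities are below
  1.\<close>

definition quiet_shocks :: "real \<Rightarrow> shock set" where
  "quiet_shocks a = {a<..} \<times> (\<Pi>\<^sub>E k\<in>{..<m}. {False}) \<times>
     space (PiM {..<m} (\<lambda>j. measure_pmf (bernoulli_pmf (quality M j))) \<Otimes>\<^sub>M
       PiM {..<m} (\<lambda>j. uniform_measure lborel {0..1::real}))"

lemma fit_prob: "j < m \<Longrightarrow> 0 < fit_prob M j \<and> fit_prob M j < 1"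
  using wf by (auto simp: wf_market_def)

lemma quality: "j < m \<Longrightarrow> 0 \<le> quality M j \<and> quality M j \<le> 1"
  using wf by (auto simp: wf_market_def)

lemma quiet_shocks:
  shows "quiet_shocks a \<in> sets (shock_space M)"
    and "a < max_value M \<Longrightarrow> emeasure (shock_space M) (quiet_shocks a) > 0"
proof -
  let ?C = "\<lambda>p. PiM {..<m} (\<lambda>j. measure_pmf (bernoulli_pmf (p j)))"
  let ?U = "PiM {..<m} (\<lambda>j. uniform_measure lborel {0..1::real})"
  let ?R = "?C (quality M) \<Otimes>\<^sub>M ?U" and ?F = "\<Pi>\<^sub>E k\<in>{..<m}. {False}"
  have U: "prob_space ?U" by (intro prob_space_PiM prob_seed)
  note R = prob_space_pair_measure[OF prob_coin(1)[of "quality M"] U]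
  note FR = prob_space_pair_measure[OF prob_coin(1)[of "fit_prob M"] R]
  interpret R: prob_space ?R by (rule R)
  interpret FR: prob_space "?C (fit_prob M) \<Otimes>\<^sub>M ?R" by (rule FR)
  interpret V: prob_space "value_dist M" by (rule prob_value)
  have F: "?F \<in> sets (?C (fit_prob M))" by (rule sets_PiM_I_finite) auto
  then have FS: "?F \<times> space ?R \<in> sets (?C (fit_prob M) \<Otimes>\<^sub>M ?R)" by auto
  have A: "{a<..} \<in> sets (value_dist M)" by (simp add: sets_value)
  show "quiet_shocks a \<in> sets (shock_space M)"
    unfolding quiet_shocks_def shock_space_def using A FS by (rule pair_measureI)
  interpret C: product_sigma_finite "\<lambda>j. measure_pmf (bernoulli_pmf (fit_prob M j))"
    by (simp add: product_sigma_finite_def measure_pmf.sigma_finite_measure_axioms)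
  have "emeasure (?C (fit_prob M)) ?F = (\<Prod>j<m. emeasure (measure_pmf (bernoulli_pmf (fit_prob M j))) {False})"
    by (rule C.emeasure_PiM) auto
  also have "\<dots> = (\<Prod>j<m. ennreal (1 - fit_prob M j))"
    using fit_prob by (intro prod.cong) (auto simp: emeasure_pmf_single less_imp_le)
  also have "\<dots> > 0" using fit_prob by (auto simp: prod_pos zero_less_iff_neq_zero ennreal_eq_0_iff not_le)
  finally have pos: "emeasure (?C (fit_prob M)) ?F > 0" .
  assume "a < max_value M"
  then have "emeasure (value_dist M) {a<..} > 0" by (rule value_above_pos)
  moreover have "emeasure (shock_space M) (quiet_shocks a) =
     emeasure (value_dist M) {a<..} * (emeasure (?C (fit_prob M)) ?F * emeasure ?R (space ?R))"
    unfolding quiet_shocks_def shock_space_def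
    using A F FS by (simp add: FR.emeasure_pair_measure_Times R.emeasure_pair_measure_Times)
  ultimately show "emeasure (shock_space M) (quiet_shocks a) > 0"
    using pos by (simp add: R.emeasure_space_1 ennreal_zero_less_mult_iff)
qed

lemma quiet_shocksD:
  "s \<in> quiet_shocks a \<Longrightarrow> a < fst s" "s \<in> quiet_shocks a \<Longrightarrow> k < m \<Longrightarrow> \<not> fst (snd s) k"
  by (auto simp: quiet_shocks_def)

text \<open>Fit probabilities lie strictly between 0 and 1, but a quality may be 0 or 1. Then the
  wrong quality entry would give the true parameters likelihood 0; this excludes it.\<close>

lemma AE_tape_possible:
  "AE T in TS. \<forall>j\<in>{..<m}. \<forall>k. (quality M j = 0 \<longrightarrow> \<not> snd T j k) \<and> (quality M j = 1 \<longrightarrow> snd T j k)"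
proof -
  let ?S = "\<lambda>p. PiM {..<m} (\<lambda>j. PiM UNIV (\<lambda>_::nat. measure_pmf (bernoulli_pmf (p j))))"
  have "AE q in ?S (quality M). \<forall>j\<in>{..<m}. \<forall>k. (quality M j = 0 \<longrightarrow> \<not> q j k) \<and> (quality M j = 1 \<longrightarrow> q j k)"
  proof (intro AE_finite_allI finite_lessThan)
    fix j assume j: "j \<in> {..<m}"
    have "AE b in measure_pmf (bernoulli_pmf (quality M j)). (quality M j = 0 \<longrightarrow> \<not> b) \<and> (quality M j = 1 \<longrightarrow> b)"
    proof (subst AE_measure_pmf_iff, intro ballI)
      fix b assume "b \<in> set_pmf (bernoulli_pmf (quality M j))"
      then show "(quality M j = 0 \<longrightarrow> \<not> b) \<and> (quality M j = 1 \<longrightarrow> b)"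
        by (cases b) (auto simp: set_pmf_iff)
    qed
    then have "AE x in PiM UNIV (\<lambda>_::nat. measure_pmf (bernoulli_pmf (quality M j))).
        \<forall>k. (quality M j = 0 \<longrightarrow> \<not> x k) \<and> (quality M j = 1 \<longrightarrow> x k)"
      unfolding AE_all_countable by (intro allI AE_PiM_component prob_space_measure_pmf) auto
    then show "AE q in ?S (quality M). \<forall>k. (quality M j = 0 \<longrightarrow> \<not> q j k) \<and> (quality M j = 1 \<longrightarrow> q j k)"
      using j by (intro AE_PiM_component[where P = "\<lambda>x. \<forall>k. (quality M j = 0 \<longrightarrow> \<not> x k) \<and> (quality M j = 1 \<longrightarrow> x k)"]
        prob_space_PiM prob_space_measure_pmf) auto
  qed
  then show ?thesis
    unfolding tape_space_def
    by (rule AE_measure_preserving[OF measure_preserving_snd[OF prob_coin(2) prob_coin(2)]])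
qed

lemma mean_concentrated:
  assumes "prob_space B" "sets B = sets borel" "AE \<theta> in B. \<theta> = (a :: real \<times> real)"
  shows "mean_fit B = fst a" "mean_quality B = snd a" "0 < e \<Longrightarrow> measure B (ball a e) = 1"
proof -
  interpret prob_space B by fact
  have [measurable]: "fst \<in> borel_measurable B" "snd \<in> borel_measurable B"
    by (simp_all add: measurable_cong_sets[OF assms(2) refl] borel_prod[symmetric])
  have "(\<integral>\<theta>. fst \<theta> \<partial>B) = (\<integral>\<theta>. fst a \<partial>B)" using assms(3) by (intro integral_cong_AE) auto
  then show "mean_fit B = fst a" by (simp add: mean_fit_def prob_space)
  have "(\<integral>\<theta>. snd \<theta> \<partial>B) = (\<integral>\<theta>. snd a \<partial>B)" using assms(3) by (intro integral_cong_AE) auto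
  then show "mean_quality B = snd a" by (simp add: mean_quality_def prob_space)
  show "measure B (ball a e) = 1" if "0 < e"
    using assms(3) that by (subst AE_in_set_eq_1[symmetric]) (auto simp: assms(2))
qed

lemma sets_tape_belief: "j < m \<Longrightarrow> sets (tape_belief M j T n) = sets borel"
  by (simp add: tape_belief_def bayes_def sets_prior)

lemma learned_restrict:
  "learned M' H j \<longleftrightarrow> (\<forall>\<epsilon>>0. (\<lambda>i. measure (posterior M' j i H) (ball (fit_prob M' j, quality M' j) \<epsilon>)) \<longlonglongrightarrow> 1)"
  by (simp add: learned_def posterior_restrict)

text \<open>
  If a learned business is inspected only finitely often, then its posterior is already a point
  mass after these inspections, and further entries of its tape would not change it.
\<close>

lemma learned_tape:
  assumes j: "j < m" and L: "learned M (tape_history M z) j"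
    and insp: "\<And>i. inspected (tape_history M z i) j \<Longrightarrow> viable (posterior M j i (tape_history M z))"
    and possible: "\<And>k. (quality M j = 0 \<longrightarrow> \<not> snd (snd z) j k) \<and> (quality M j = 1 \<longrightarrow> snd (snd z) j k)"
    and index: "max_value M * quality M j - search_cost M / fit_prob M j > 0"
  shows "viable (tape_belief M j (snd z) n)"
    and "0 < e \<Longrightarrow> (\<lambda>n. measure (tape_belief M j (snd z) n) (ball (fit_prob M j, quality M j) e)) \<longlonglongrightarrow> 1"
proof -
  let ?H = "tape_history M z" and ?B = "tape_belief M j (snd z)" and ?a = "(fit_prob M j, quality M j)"
  let ?N = "inspections ?H j"
  have post: "posterior M j i ?H = ?B (?N i)" for i by (rule posterior_tape_history[OF j])
  have lim: "(\<lambda>i. measure (?B (?N i)) (ball ?a e)) \<longlonglongrightarrow> 1" if "0 < e" for e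
    using L that by (simp add: learned_restrict post)
  \<comment> \<open>The count grows by at most one per round, so every position passed was the
    current one in some round with an inspection, and in that round the belief was viable.\<close>
  have reached: "\<exists>i. ?N i = k \<and> inspected (?H i) j" if "k < ?N i" for k i
    using that
  proof (induction i)
    case (Suc i)
    then show ?case
      by (cases "k < ?N i") (auto simp: inspections_Suc split: if_splits intro!: exI[of _ i])
  qed simp
  have reach: "viable (?B k)" if "k < ?N i" for k i
    using reached[OF that] insp post by auto
  have goal: "viable (?B n) \<and> (0 < e \<longrightarrow> (\<lambda>n. measure (?B n) (ball ?a e)) \<longlonglongrightarrow> 1)" for n e
  proof (cases "\<forall>k. \<exists>i. k < ?N i")
    case True
    have "(\<lambda>n. measure (?B n) (ball ?a e)) \<longlonglongrightarrow> 1" if e: "0 < e"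
    proof (rule LIMSEQ_I)
      fix d :: real assume "0 < d"
      then obtain i0 where i0: "\<And>i. i \<ge> i0 \<Longrightarrow> norm (measure (?B (?N i)) (ball ?a e) - 1) < d"
        using LIMSEQ_D[OF lim[OF e]] by blast
      have "norm (measure (?B n) (ball ?a e) - 1) < d" if n: "n \<ge> ?N i0" for n
      proof -
        obtain i where i: "?N i = n" "inspected (?H i) j" using True reached by blast
        \<comment> \<open>If the round \<open>i\<close> comes before \<open>i0\<close>, then
          monotonicity of the count and \<open>n \<ge> ?N i0\<close> force equality, and the
          estimate for round \<open>i0\<close> itself applies.\<close>
        have "i \<ge> i0 \<or> ?N i = ?N i0"
          using n i(1) mono_inspections[of i i0 ?H j] by (cases "i \<ge> i0") auto
        then show ?thesis using i0[of i] i0[of i0] i(1) by auto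
      qed
      then show "\<exists>n0. \<forall>n\<ge>n0. norm (measure (?B n) (ball ?a e) - 1) < d" by blast
    qed
    then show "viable (?B n) \<and> (0 < e \<longrightarrow> (\<lambda>n. measure (?B n) (ball ?a e)) \<longlonglongrightarrow> 1)"
      using True reach by blast
  next
    case False
    then obtain k where k: "\<And>i. ?N i \<le> k" by (auto simp: not_less)
    obtain i0 where i0: "\<And>i. ?N i \<le> ?N i0"
    proof -
      have "finite (range ?N)" by (rule finite_subset[of _ "{..k}"]) (use k in auto)
      then have "Max (range ?N) \<in> range ?N" by (intro Max_in) auto
      then obtain i where "?N i = Max (range ?N)" by auto
      then show thesis using that \<open>finite (range ?N)\<close> by (metis Max_ge rangeI)
    qed
    let ?n = "?N i0"
    have const: "?N i = ?n" if "i \<ge> i0" for i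
      using mono_inspections[OF that, of ?H j] i0[of i] by simp
    \<comment> \<open>From \<open>i0\<close> on the belief does not change, so the limit 1 in the
      definition of \<open>learned\<close> is attained.\<close>
    have ball: "measure (?B ?n) (ball ?a e) = 1" if "0 < e" for e
    proof -
      have "(\<lambda>i. measure (?B (?N i)) (ball ?a e)) \<longlonglongrightarrow> measure (?B ?n) (ball ?a e)"
        by (intro tendsto_eventually eventually_sequentiallyI[of i0] arg_cong2[where f = measure] arg_cong[where f = ?B] refl)
          (rule const)
      from LIMSEQ_unique[OF this lim[OF that]] show ?thesis .
    qed
    let ?f = "fst (snd z) j" and ?g = "snd (snd z) j"
    have point: "prob_space (?B n)" "AE \<theta> in ?B n. \<theta> = ?a" if "n \<ge> ?n" for n
    proof -
      have split: "tape_likelihood ?f ?g {..<n} = (\<lambda>\<theta>. tape_likelihood ?f ?g {..<?n} \<theta> * tape_likelihood ?f ?g {?n..<n} \<theta>)"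
      proof -
        have "prod F {..<n} = prod F {..<?n} * prod F {?n..<n}" for F :: "nat \<Rightarrow> real"
          using prod.atLeastLessThan_concat[of 0 ?n n F] that by (simp only: lessThan_atLeast0)
        then show ?thesis
          unfolding tape_likelihood_def split_beta' by (intro ext)
      qed
      \<comment> \<open>The unread entries are possible under the truth, hence have positive
        likelihood there; with \<open>bayes_concentrated\<close> the point mass survives
        them.\<close>
      have R: "tape_likelihood ?f ?g {?n..<n} ?a > 0"
        unfolding tape_likelihood_def prod.case
      proof (rule prod_pos)
        fix k
        show "0 < (if ?f k then fit_prob M j * (if ?g k then quality M j else 1 - quality M j) else 1 - fit_prob M j)"
          using fit_prob[OF j] quality[OF j] possible[of k] by (auto simp: less_le)
      qed
      note L1 = likelihood_function_tape[OF j, of "{..<?n}" ?f ?g]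
      note L2 = likelihood_function_tape[OF j, of "{..<n}" ?f ?g, unfolded split]
      show "prob_space (?B n)" "AE \<theta> in ?B n. \<theta> = ?a"
        unfolding tape_belief_def split
        using bayes_concentrated[OF prior_prob[OF j] sets_prior[OF j] L1 L2 R] ball
        by (simp_all add: tape_belief_def)
    qed
    note mean = mean_concentrated[OF point(1) sets_tape_belief[OF j] point(2)]
    have "viable (?B n)"
    proof (cases "n < ?n")
      case False
      then show ?thesis using mean(1,2)[of n] index by (simp add: viable_def search_index_def)
    qed (rule reach)
    moreover have "(\<lambda>n. measure (?B n) (ball ?a e)) \<longlonglongrightarrow> 1" if "0 < e"
      by (intro tendsto_eventually eventually_sequentiallyI[of ?n] mean(3) that)
    ultimately show "viable (?B n) \<and> (0 < e \<longrightarrow> (\<lambda>n. measure (?B n) (ball ?a e)) \<longlonglongrightarrow> 1)" by blast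
  qed
  from goal[of n e] show "viable (?B n)" by (rule conjunct1)
  from goal[of n e] show "0 < e \<Longrightarrow> (\<lambda>n. measure (?B n) (ball ?a e)) \<longlonglongrightarrow> 1" by blast
qed

end

section \<open>Coupling the learned sets\<close>

lemma LIMSEQ_iff_Suc:
  fixes f :: "nat \<Rightarrow> real"
  shows "f \<longlonglongrightarrow> a \<longleftrightarrow> (\<forall>k. \<exists>n0. \<forall>n\<ge>n0. \<bar>f n - a\<bar> < 1 / Suc k)"
proof
  assume "f \<longlonglongrightarrow> a"
  then show "\<forall>k. \<exists>n0. \<forall>n\<ge>n0. \<bar>f n - a\<bar> < 1 / Suc k"
    using LIMSEQ_D[of f a] by (auto simp flip: real_norm_def)
next
  assume *: "\<forall>k. \<exists>n0. \<forall>n\<ge>n0. \<bar>f n - a\<bar> < 1 / Suc k"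
  show "f \<longlonglongrightarrow> a"
  proof (rule LIMSEQ_I)
    fix r :: real assume "0 < r"
    then obtain k where k: "1 / Suc k < r" using nat_approx_posE by blast
    obtain n0 where "\<forall>n\<ge>n0. \<bar>f n - a\<bar> < 1 / Suc k" using * by blast
    then show "\<exists>n0. \<forall>n\<ge>n0. norm (f n - a) < r" using k by (auto intro!: exI[of _ n0] intro: less_trans)
  qed
qed

context valid_market begin

lemma measure_posterior_mono:
  assumes j: "j < m" and A: "A \<subseteq> A'" "A' \<in> sets borel"
  shows "measure (posterior M j i h) A \<le> measure (posterior M j i h) A'" "measure (posterior M j i h) A \<le> 1"
proof -
  interpret likelihood_function "prior M j" "likelihood j i h" by (rule likelihood_function_likelihood[OF j])
  have "measure (posterior M j i h) A \<le> measure (posterior M j i h) A' \<and> measure (posterior M j i h) A \<le> 1"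
  proof (cases "Z = 0")
    case True
    then show ?thesis by (simp add: posterior_eq_bayes bayes_null)
  next
    case False
    interpret B: prob_space "bayes (prior M j) (likelihood j i h)" by (rule prob_bayes[OF False])
    show ?thesis
      unfolding posterior_eq_bayes
      using A by (intro conjI B.finite_measure_mono B.prob_le_1) (simp_all add: bayes_def sets_prior[OF j])
  qed
  then show "measure (posterior M j i h) A \<le> measure (posterior M j i h) A'" "measure (posterior M j i h) A \<le> 1" by auto
qed

text \<open>Countably many radii suffice by monotonicity in the radius. Together with
  \<open>LIMSEQ_iff_Suc\<close> this makes \<open>learned\<close> a measurable event, as is needed
  to move almost sure statements between the tapes and the coupling.\<close>

lemma learned_countable:
  assumes j: "j < m"
  shows "learned M H j \<longleftrightarrow> (\<forall>n. (\<lambda>i. measure (posterior M j i H) (ball (fit_prob M j, quality M j) (1 / Suc n))) \<longlonglongrightarrow> 1)"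
    (is "_ \<longleftrightarrow> (\<forall>n. ?f (1 / Suc n) \<longlonglongrightarrow> 1)")
proof
  assume *: "\<forall>n. ?f (1 / Suc n) \<longlonglongrightarrow> 1"
  have "?f e \<longlonglongrightarrow> 1" if e: "0 < e" for e
  proof -
    obtain n where n: "1 / Suc n < e" using nat_approx_posE[OF e] by blast
    show ?thesis
    proof (rule tendsto_sandwich[OF _ _ *[rule_format, of n] tendsto_const[of 1]])
      show "\<forall>\<^sub>F i in sequentially. ?f (1 / Suc n) i \<le> ?f e i"
        using n by (intro always_eventually allI measure_posterior_mono(1)[OF j] subset_ball) auto
      show "\<forall>\<^sub>F i in sequentially. ?f e i \<le> 1"
        by (intro always_eventually allI measure_posterior_mono(2)[OF j order_refl]) auto
    qed
  qed
  then show "learned M H j" by (simp add: learned_restrict)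
qed (simp add: learned_restrict)

lemma pred_learned:
  assumes j: "j < m"
  shows "Measurable.pred (history_space M UNIV) (\<lambda>H. learned M H j)"
proof -
  have "Measurable.pred (history_space M UNIV)
      (\<lambda>H. \<bar>measure (posterior M j i H) (ball (fit_prob M j, quality M j) (1 / Suc n)) - 1\<bar> < 1 / Suc k)" for i n k
    by (rule pred_posterior[OF j])
  then show ?thesis
    unfolding learned_countable[OF j] LIMSEQ_iff_Suc
    by (intro pred_intros_countable pred_intros_imp')
qed

end

locale cost_reduction = high: valid_market M + low: valid_market Mt
  for M Mt :: market +
  fixes ct :: real
  assumes Mt: "Mt = M\<lparr>search_cost := ct\<rparr>" and ct: "ct < search_cost M"
begin

lemma Mt_simps [simp]:
  "nbiz Mt = nbiz M" "fit_prob Mt = fit_prob M" "quality Mt = quality M" "value_dist Mt = value_dist M"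
  "price_rule Mt = price_rule M" "search_cost Mt = ct" "max_value Mt = max_value M"
  "shock_space Mt = shock_space M" "tape_space Mt = tape_space M" "outcome_space Mt = outcome_space M"
  "history_space Mt R = history_space M R" "posterior Mt j i h = posterior M j i h"
  "tape_belief Mt j T n = tape_belief M j T n"
  by (simp_all add: Mt max_value_def shock_space_def tape_space_def outcome_space_def history_space_def
      posterior_def prior_def tape_belief_def)

abbreviation "m \<equiv> nbiz M"

text \<open>The two markets are mixed on purpose: the history is that of \<open>Mt\<close>, the
  index that of \<open>M\<close>. Demand responsiveness in \<open>M\<close> holds for each history
  and almost every seed; since the seed of round \<open>i\<close> is independent of the prefix, it
  holds almost surely along the history of \<open>Mt\<close>.\<close>

lemma AE_low_prices:
  "AE \<omega> in high.SS. \<forall>i. \<forall>j\<in>{..<m}. high.viable (posterior M j i (history Mt \<omega>)) \<longrightarrow>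
    round_index M i (history_prefix Mt \<omega> i) (max_value M) (snd (snd (snd (\<omega> i)))) j > 0"
  unfolding AE_all_countable
proof (intro allI AE_finite_allI finite_lessThan)
  fix i j assume "j \<in> {..<m}"
  then have j: "j < m" by simp
  let ?P = "\<lambda>z. high.viable (posterior M j i (fst z)) \<longrightarrow>
      round_index M i (fst z) (max_value M) (snd (snd (snd (snd z)))) j > 0"
  let ?N = "low.prefix_law i \<Otimes>\<^sub>M shock_space M"
  interpret A: prob_space "low.prefix_law i" by (rule low.prob_prefix_law)
  interpret B: prob_space "shock_space M" by (rule high.prob_shock)
  interpret pair_sigma_finite "low.prefix_law i" "shock_space M" ..
  have sets: "sets ?N = sets (high.HS i \<Otimes>\<^sub>M shock_space M)"
    using low.sets_prefix_law[of i] by (intro sets_pair_measure_cong) auto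
  have "Measurable.pred ?N ?P"
    unfolding measurable_cong_sets[OF sets refl]
  proof (rule pred_intros_logic(4))
    show "Measurable.pred (high.HS i \<Otimes>\<^sub>M shock_space M) (\<lambda>z. high.viable (posterior M j i (fst z)))"
      by (rule measurable_compose[OF measurable_fst posterior_function_measurable[OF j]]) auto
    have "(\<lambda>z. round_index M i (fst z) (max_value M) (snd (snd (snd (snd z)))) j) \<in>
        borel_measurable (high.HS i \<Otimes>\<^sub>M shock_space M)"
      by (intro high.round_index_measurable j measurable_fst borel_measurable_const
          measurable_compose[OF measurable_snd high.shock_measurable(4)])
    from measurable_compose[OF this, of "\<lambda>x. 0 < x" "count_space UNIV"]
    show "Measurable.pred (high.HS i \<Otimes>\<^sub>M shock_space M)
       (\<lambda>z. 0 < round_index M i (fst z) (max_value M) (snd (snd (snd (snd z)))) j)" by simp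
  qed
  then have "{z \<in> space ?N. ?P z} \<in> sets ?N" by (simp only: pred_def)
  then have "AE z in ?N. ?P z"
  proof (rule AE_pair_measure)
    show "AE h in low.prefix_law i. AE s in shock_space M. ?P (h, s)"
    proof (rule AE_I2)
      fix h assume "h \<in> space (low.prefix_law i)"
      then have h: "h \<in> space (high.HS i)"
        using sets_eq_imp_space_eq[OF low.sets_prefix_law[of i]] by simp
      show "AE s in shock_space M. ?P (h, s)"
      proof (cases "high.viable (posterior M j i h)")
        case True
        have "\<exists>p\<ge>0. search_index M p (posterior M j i h) (max_value M) > 0"
          using True by (auto simp: high.viable_def)
        moreover have "demand_responsive M j" using high.wf j by (simp add: wf_market_def)
        ultimately have "AE u in uniform_measure lborel {0..1}.
            search_index M (price_rule M j i h u) (posterior M j i h) (max_value M) > 0"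
          using h unfolding demand_responsive_def by blast
        from AE_measure_preserving[OF high.shock_components_preserving(2)[OF j] this]
        show ?thesis by (simp add: round_index_def)
      qed simp
    qed
  qed
  moreover have "measure_preserving high.SS ?N (\<lambda>\<omega>. (history_prefix Mt \<omega> i, \<omega> i))"
    using low.history_prefix_law(2)[of i] by simp
  ultimately have "AE \<omega> in high.SS. ?P (history_prefix Mt \<omega> i, \<omega> i)"
    by (rule AE_measure_preserving[rotated])
  then show "AE \<omega> in high.SS. high.viable (posterior M j i (history Mt \<omega>)) \<longrightarrow>
    round_index M i (history_prefix Mt \<omega> i) (max_value M) (snd (snd (snd (\<omega> i)))) j > 0"
    using low.posterior_prefix[of M j i] by simp
qed

text \<open>
  In a round where no business fits and the value of the consumer is so close to the maximum that the cost reduction makes up for the difference, every business that would be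
  viable at the high search cost is inspected.
\<close>

lemma AE_low_inspected:
  "AE H in history_law Mt. \<forall>i. \<forall>j\<in>{..<m}. high.viable (posterior M j i H) \<longrightarrow> (\<exists>r\<ge>i. inspected (H r) j)"
proof (rule low.AE_history_lawI)
  \<comment> \<open>A value above \<open>?a\<close> loses less than
    \<open>search_cost M - ct\<close> of index against the maximal value, since mean qualities are
    at most 1.\<close>
  let ?a = "max_value M - (search_cost M - ct)"
  have "AE \<omega> in high.SS. \<forall>i. \<exists>r\<ge>i. \<omega> r \<in> high.quiet_shocks ?a"
    using ct by (intro high.AE_infinitely_often high.quiet_shocks) auto
  then have "AE \<omega> in high.SS. \<forall>i. \<forall>j\<in>{..<m}. high.viable (posterior M j i (history Mt \<omega>)) \<longrightarrow>
     (\<exists>r\<ge>i. inspected (history Mt \<omega> r) j)"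
    using AE_low_prices
  proof eventually_elim
    case (elim \<omega>)
    let ?H = "history Mt \<omega>"
    show ?case
    proof (intro allI ballI impI, rule ccontr)
      fix i j assume "j \<in> {..<m}" and v: "high.viable (posterior M j i ?H)"
        and no: "\<not> (\<exists>r\<ge>i. inspected (?H r) j)"
      then have j: "j < m" by simp
      \<comment> \<open>Without inspections the belief is frozen, so it remains viable up to the
        next quiet round, which then yields an inspection and a contradiction.\<close>
      have "likelihood j (i + d) ?H = likelihood j i ?H" for d
      proof (induction d)
        case (Suc d)
        have "\<not> inspected (?H (i + d)) j" using no by auto
        moreover from this have "snd (snd (?H (i + d))) \<noteq> Some (j, g)" for g
          unfolding low.history_round by (auto simp: play_round_transacts)
        ultimately show ?case using likelihood_not_inspected[of ?H "i + d" j] Suc by simp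
      qed simp
      then have post: "posterior M j r ?H = posterior M j i ?H" if "r \<ge> i" for r
        using that by (metis le_add_diff_inverse posterior_eq_bayes)
      obtain r where r: "r \<ge> i" "\<omega> r \<in> high.quiet_shocks ?a" using elim(1) by blast
      let ?h = "history_prefix Mt \<omega> r" and ?u = "snd (snd (snd (\<omega> r)))"
      define B where "B = posterior M j r ?H"
      have vB: "high.viable B" using v post[OF r(1)] by (simp add: B_def)
      then have hi: "round_index M r ?h (max_value M) ?u j > 0" using elim(2) j by (simp add: B_def)
      have mean: "0 \<le> mean_quality B" "mean_quality B \<le> 1" "0 < mean_fit B" "mean_fit B \<le> 1"
        using high.mean_posterior[OF j, of r ?H] vB by (simp_all add: B_def)
      have idx: "round_index M' r ?h V ?u j = V * mean_quality B - price_rule M' j r ?h (?u j) - search_cost M' / mean_fit B"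
        if "M' = M \<or> M' = Mt" for M' V
        using that low.posterior_prefix[of M j r \<omega>] by (auto simp: round_index_def search_index_def B_def)
      have "(max_value M - fst (\<omega> r)) * mean_quality B < search_cost M - ct"
      proof (cases "max_value M - fst (\<omega> r) \<le> 0")
        case True
        then have "(max_value M - fst (\<omega> r)) * mean_quality B \<le> 0"
          using mean by (simp add: mult_nonpos_nonneg)
        then show ?thesis using ct by simp
      next
        case False
        then have "(max_value M - fst (\<omega> r)) * mean_quality B \<le> max_value M - fst (\<omega> r)"
          using mean by (simp add: mult_left_le)
        then show ?thesis using high.quiet_shocksD(1)[OF r(2)] by simp
      qed
      \<comment> \<open>Moving from \<open>M\<close> at the maximal value to \<open>Mt\<close> at
        the actual value, the index gains the right-hand side and loses the left end of this chain;
        the gain is at least the cost difference because the mean fit is at most 1.\<close>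
      also have "search_cost M - ct \<le> (search_cost M - ct) / mean_fit B"
        using mean ct by (simp add: le_divide_eq mult_left_le)
      finally have "round_index Mt r ?h (fst (\<omega> r)) ?u j > 0"
        using hi by (simp add: idx algebra_simps diff_divide_distrib)
      moreover have "\<not> fst (snd (\<omega> r)) k" if "k < m" for k
        by (rule high.quiet_shocksD(2)[OF r(2) that])
      ultimately have "inspected (?H r) j"
        unfolding low.history_round using j
        by (simp add: play_round_inspected_set inspected_set_def inspects_def)
      then show False using no r(1) by blast
    qed
  qed
  then show "AE \<omega> in low.SS. \<forall>i. \<forall>j\<in>{..<m}. high.viable (posterior M j i (history Mt \<omega>)) \<longrightarrow>
     (\<exists>r\<ge>i. inspected (history Mt \<omega> r) j)" by (simp only: Mt_simps)
  show "Measurable.pred (history_space Mt UNIV)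
      (\<lambda>H. \<forall>i. \<forall>j\<in>{..<m}. high.viable (posterior M j i H) \<longrightarrow> (\<exists>r\<ge>i. inspected (H r) j))"
    unfolding Mt_simps
    by (intro pred_intros_countable pred_intros_finite(3) finite_lessThan pred_intros_logic(4)
      high.pred_inspected high.pred_posterior pred_intros_conj1') auto
qed

text \<open>Both histories are functions of the same shocks and tapes. Beliefs in \<open>Mt\<close>
  form the sequence of tape beliefs evaluated at the inspection counts, so convergence along the
  tape is inherited as soon as the counts are unbounded.\<close>

theorem coupling_of_learned_sets:
  obtains K where "coupling K (history_law M) (history_law Mt)"
    "AE z in K. \<forall>j\<in>{..<m}. learned M (fst z) j \<and>
       max_value M * quality M j - search_cost M / fit_prob M j > 0 \<longrightarrow> learned Mt (snd z) j"
proof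
  let ?S = "high.SS \<Otimes>\<^sub>M high.TS" and ?HT = "history_law M \<Otimes>\<^sub>M history_law Mt"
  let ?f = "\<lambda>z. (tape_history M z, tape_history Mt z)"
  define K where "K = distr ?S ?HT ?f"
  note f1 = high.tape_history_law
  have f2: "measure_preserving ?S (history_law Mt) (tape_history Mt)"
    using low.tape_history_law by simp
  have f: "?f \<in> ?S \<rightarrow>\<^sub>M ?HT"
    by (rule measurable_Pair[OF f1[THEN measure_preserving_measurable] f2[THEN measure_preserving_measurable]])
  show "coupling K (history_law M) (history_law Mt)"
    unfolding coupling_def K_def using f1 f2
    by (simp add: distr_distr[OF measurable_fst f] distr_distr[OF measurable_snd f] comp_def measure_preserving_def)
  have "AE z in ?S. \<forall>j\<in>{..<m}. \<forall>k. (quality M j = 0 \<longrightarrow> \<not> snd (snd z) j k) \<and> (quality M j = 1 \<longrightarrow> snd (snd z) j k)"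
    by (rule AE_measure_preserving[OF measure_preserving_snd high.AE_tape_possible])
      (intro prob_space_PiM high.prob_shock high.prob_tape)+
  moreover note AE_measure_preserving[OF f1 high.AE_inspected_viable] AE_measure_preserving[OF f2 AE_low_inspected]
  ultimately have "AE z in ?S. \<forall>j\<in>{..<m}. learned M (tape_history M z) j \<and>
       max_value M * quality M j - search_cost M / fit_prob M j > 0 \<longrightarrow> learned Mt (tape_history Mt z) j"
  proof eventually_elim
    case (elim z)
    show ?case
    proof (intro ballI impI)
      fix j assume "j \<in> {..<m}" and L: "learned M (tape_history M z) j \<and>
       max_value M * quality M j - search_cost M / fit_prob M j > 0"
      then have j: "j < m" by simp
      let ?H = "tape_history Mt z"
      note tape = high.learned_tape[OF j, of z]
      have viable: "high.viable (tape_belief M j (snd z) n)" for n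
        using L elim j by (intro tape(1)) auto
      have lim: "(\<lambda>n. measure (tape_belief M j (snd z) n) (ball (fit_prob M j, quality M j) e)) \<longlonglongrightarrow> 1"
        if "0 < e" for e
        using L elim j that by (intro tape(2)) auto
      have post: "posterior M j i ?H = tape_belief M j (snd z) (inspections ?H j i)" for i
        using posterior_tape_history[of j Mt i z] j by simp
      \<comment> \<open>Every tape belief is viable at the high cost, hence so is the belief after
        any number of inspections, and another inspection follows.\<close>
      have "\<exists>i. inspections ?H j i \<ge> n" for n
      proof (induction n)
        case (Suc n)
        then obtain i where i: "inspections ?H j i \<ge> n" by blast
        obtain r where r: "r \<ge> i" "inspected (?H r) j"
          using elim(3) viable post j by (metis lessThan_iff)
        then have "inspections ?H j (Suc r) = Suc (inspections ?H j r)" by (simp add: inspections_Suc)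
        then show ?case using i mono_inspections[OF r(1), of ?H j] by (intro exI[of _ "Suc r"]) simp
      qed simp
      then have "filterlim (inspections ?H j) at_top sequentially"
        unfolding filterlim_at_top eventually_sequentially using mono_inspections order_trans by metis
      then have "(\<lambda>i. measure (posterior M j i ?H) (ball (fit_prob M j, quality M j) e)) \<longlonglongrightarrow> 1" if "0 < e" for e
        unfolding post using filterlim_compose[OF lim[OF that]] by blast
      then show "learned Mt ?H j" by (simp add: high.learned_restrict)
    qed
  qed
  moreover have "Measurable.pred ?HT (\<lambda>z. \<forall>j\<in>{..<m}. learned M (fst z) j \<and>
       max_value M * quality M j - search_cost M / fit_prob M j > 0 \<longrightarrow> learned Mt (snd z) j)"
  proof -
    have sets: "sets ?HT = sets (history_space M UNIV \<Otimes>\<^sub>M history_space M UNIV)"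
      using low.sets_history_law by (intro sets_pair_measure_cong high.sets_history_law) simp
    have lo: "Measurable.pred (history_space M UNIV) (\<lambda>H. learned Mt H j)" if "j < m" for j
      using low.pred_learned[of j] that by simp
    show ?thesis
      unfolding measurable_cong_sets[OF sets refl]
      by (intro pred_intros_finite(3) finite_lessThan pred_intros_logic(3,4)
          measurable_compose[OF measurable_fst high.pred_learned] measurable_compose[OF measurable_snd lo]) auto
  qed
  ultimately show "AE z in K. \<forall>j\<in>{..<m}. learned M (fst z) j \<and>
       max_value M * quality M j - search_cost M / fit_prob M j > 0 \<longrightarrow> learned Mt (snd z) j"
    unfolding K_def by (subst AE_distr_iff[OF f]) (simp_all add: pred_def)
qed

end

section \<open>Welfare in a market equilibrium\<close>

locale equilibrium_market = valid_market +
  fixes S :: "nat set" and \<Phi> :: equilibrium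
  assumes eq: "market_equilibrium M S \<Phi>"
begin

abbreviation "PP \<equiv> PiM {..<m} (price_dist \<Phi>)"
abbreviation "FF \<equiv> PiM {..<m} (\<lambda>j. measure_pmf (bernoulli_pmf (fit_prob M j)))"
abbreviation "CS \<equiv> consumer_space M \<Phi>"
abbreviation "\<sigma> z \<equiv> eq_index M \<Phi> (fst z) (fst (snd z))"
abbreviation "buys z \<equiv> transacts m (\<sigma> z) (snd (snd z))"
abbreviation "insp z \<equiv> inspects m (\<sigma> z) (snd (snd z))"

lemma S: "S \<subseteq> {..<m}"
  using eq by (simp add: market_equilibrium_def)

lemma S_less: "j \<in> S \<Longrightarrow> j < m"
  using S by auto

lemma price_dist:
  assumes "j < m"
  shows "prob_space (price_dist \<Phi> j)" "sets (price_dist \<Phi> j) = sets borel" "AE p in price_dist \<Phi> j. 0 \<le> p"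
  using eq assms by (auto simp: market_equilibrium_def)

lemma prob_PP: "prob_space PP"
  by (intro prob_space_PiM price_dist(1)) auto

lemma prob_FF: "prob_space FF"
  by (intro prob_space_PiM prob_space_measure_pmf)

lemma CS_def': "CS = PP \<Otimes>\<^sub>M (value_dist M \<Otimes>\<^sub>M FF)"
  by (simp add: consumer_space_def)

lemma prob_CS: "prob_space CS"
  unfolding CS_def' by (intro prob_space_pair_measure prob_PP prob_FF prob_value)

lemma index_learned:
  assumes "j \<in> S"
  shows "eq_index M \<Phi> P V j = V * quality M j - P j - search_cost M / fit_prob M j"
proof -
  have B: "limit_belief \<Phi> j = return borel (fit_prob M j, quality M j)"
    using eq assms S by (auto simp: market_equilibrium_def)
  have meas: "(fst :: real \<times> real \<Rightarrow> real) \<in> borel_measurable borel" "(snd :: real \<times> real \<Rightarrow> real) \<in> borel_measurable borel"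
    by (simp_all add: borel_prod[symmetric])
  have "mean_fit (limit_belief \<Phi> j) = fit_prob M j" "mean_quality (limit_belief \<Phi> j) = quality M j"
    unfolding mean_fit_def mean_quality_def B by (simp_all add: integral_return[OF _ meas(1)] integral_return[OF _ meas(2)])
  then show ?thesis by (simp add: eq_index_def search_index_def)
qed

text \<open>The equilibrium condition speaks of price 0 and the maximal value only; it extends
  because the index increases with the value, the mean quality being nonnegative, and decreases with
  the price.\<close>

lemma index_lost:
  assumes "j < m" "j \<notin> S" "0 \<le> V" "V \<le> max_value M" "0 \<le> P j"
  shows "eq_index M \<Phi> P V j \<le> 0"
proof -
  let ?B = "limit_belief \<Phi> j"
  have lost: "search_index M 0 ?B (max_value M) \<le> 0" and "AE \<theta> in ?B. fst \<theta> \<in> {0<..<1} \<and> snd \<theta> \<in> {0..1}"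
    using eq assms by (auto simp: market_equilibrium_def)
  then have "0 \<le> mean_quality ?B"
    unfolding mean_quality_def by (intro integral_nonneg_AE) (auto elim: eventually_mono)
  then have "V * mean_quality ?B \<le> max_value M * mean_quality ?B"
    using assms by (intro mult_right_mono)
  then show ?thesis using lost assms by (simp add: eq_index_def search_index_def)
qed

lemma CS_components:
  shows "j < m \<Longrightarrow> (\<lambda>z. fst z j) \<in> borel_measurable CS"
    and "(\<lambda>z. fst (snd z)) \<in> borel_measurable CS"
    and "j < m \<Longrightarrow> (\<lambda>z. snd (snd z) j) \<in> CS \<rightarrow>\<^sub>M count_space UNIV"
proof -
  have sets: "sets CS = sets (PiM {..<m} (\<lambda>_. borel :: real measure) \<Otimes>\<^sub>M
      ((borel :: real measure) \<Otimes>\<^sub>M PiM {..<m} (\<lambda>_. count_space (UNIV :: bool set))))"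
    unfolding CS_def'
    by (intro sets_pair_measure_cong sets_PiM_cong refl sets_value price_dist(2)) auto
  show "j < m \<Longrightarrow> (\<lambda>z. fst z j) \<in> borel_measurable CS"
    "(\<lambda>z. fst (snd z)) \<in> borel_measurable CS"
    "j < m \<Longrightarrow> (\<lambda>z. snd (snd z) j) \<in> CS \<rightarrow>\<^sub>M count_space UNIV"
    unfolding measurable_cong_sets[OF sets refl]
    by (rule measurable_compose[OF measurable_fst measurable_component_singleton], simp)
      (rule measurable_compose[OF measurable_snd measurable_fst],
       rule measurable_compose[OF measurable_snd measurable_compose[OF measurable_snd measurable_component_singleton]], simp)
qed

lemma \<sigma>_measurable: "j < m \<Longrightarrow> (\<lambda>z. \<sigma> z j) \<in> borel_measurable CS"
  unfolding eq_index_def search_index_def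
  by (intro borel_measurable_diff borel_measurable_times borel_measurable_const CS_components)

lemma trans_measurable: "(\<lambda>z. buys z j) \<in> CS \<rightarrow>\<^sub>M count_space UNIV"
  by (rule pred_transacts[OF \<sigma>_measurable CS_components(3)])

lemma insp_measurable: "(\<lambda>z. insp z j) \<in> CS \<rightarrow>\<^sub>M count_space UNIV"
  by (rule pred_inspects[OF \<sigma>_measurable CS_components(3)])

lemma AE_CS: "AE z in CS. 0 \<le> fst (snd z) \<and> fst (snd z) \<le> max_value M \<and> (\<forall>j\<in>{..<m}. 0 \<le> fst z j)"
proof -
  note VF = prob_space_pair_measure[OF prob_value prob_FF]
  have "measure_preserving CS (value_dist M) (\<lambda>z. fst (snd z))"
    unfolding CS_def'
    using measure_preserving_comp[OF measure_preserving_snd[OF prob_PP VF]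
      measure_preserving_comp[OF measure_preserving_swap[OF prob_value prob_FF] measure_preserving_snd[OF prob_FF prob_value]]]
    by simp
  then have 1: "AE z in CS. 0 \<le> fst (snd z) \<and> fst (snd z) \<le> max_value M"
    by (rule AE_measure_preserving) (rule AE_value)
  have mp: "measure_preserving CS PP fst"
    unfolding CS_def'
    using measure_preserving_comp[OF measure_preserving_swap[OF prob_PP VF] measure_preserving_snd[OF VF prob_PP]]
    by simp
  have "AE P in PP. \<forall>j\<in>{..<m}. 0 \<le> P j"
    by (intro AE_finite_allI finite_lessThan AE_PiM_component price_dist) auto
  from 1 AE_measure_preserving[OF mp this] show ?thesis by eventually_elim auto
qed

lemma AE_index:
  "AE z in CS. (\<forall>j<m. \<sigma> z j \<le> max_value M) \<and> (\<forall>j<m. \<sigma> z j > 0 \<longrightarrow> j \<in> S)"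
  using AE_CS
proof eventually_elim
  case (elim z)
  have "\<sigma> z j \<le> max_value M" if j: "j < m" for j
  proof (cases "j \<in> S")
    case True
    have "fst (snd z) * quality M j \<le> max_value M * 1"
      using elim quality[OF j] by (intro mult_mono) auto
    moreover have "0 \<le> search_cost M / fit_prob M j"
      using fit_prob[OF j] wf by (auto simp: wf_market_def)
    moreover have "0 \<le> fst z j" using elim j by simp
    ultimately show ?thesis unfolding index_learned[OF True] by linarith
  next
    case False
    then show ?thesis using index_lost[OF j False, of "fst (snd z)" "fst z"] elim j max_value_nonneg by auto
  qed
  moreover have "j \<in> S" if "j < m" "\<sigma> z j > 0" for j
    using index_lost[OF that(1), of "fst (snd z)" "fst z"] that elim by fastforce
  ultimately show ?case by blast
qed

lemma nn_integral_FF_fit: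
  assumes j: "j < m" and g: "g \<in> borel_measurable FF"
    and indep: "\<And>F b. g (F(j := b)) = g F"
  shows "(\<integral>\<^sup>+F. g F * indicator {F. F j} F \<partial>FF) = ennreal (fit_prob M j) * (\<integral>\<^sup>+F. g F \<partial>FF)"
proof -
  interpret product_sigma_finite "\<lambda>j. measure_pmf (bernoulli_pmf (fit_prob M j))"
    by (simp add: product_sigma_finite_def measure_pmf.sigma_finite_measure_axioms)
  let ?J = "{..<m} - {j}"
  have ins: "insert j ?J = {..<m}" using j by auto
  have split: "(\<integral>\<^sup>+F. h F \<partial>FF) = (\<integral>\<^sup>+F. \<integral>\<^sup>+b. h (F(j := b)) \<partial>measure_pmf (bernoulli_pmf (fit_prob M j))
      \<partial>PiM ?J (\<lambda>j. measure_pmf (bernoulli_pmf (fit_prob M j))))"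
    if "h \<in> borel_measurable FF" for h
    using product_nn_integral_insert[of ?J j h] that unfolding ins by simp
  have F: "(\<lambda>F. F j) \<in> FF \<rightarrow>\<^sub>M count_space UNIV"
    using measurable_component_singleton[of j "{..<m}" "\<lambda>j. measure_pmf (bernoulli_pmf (fit_prob M j))"] j by simp
  have "(\<lambda>F. g F * (if F j then 1 else 0)) \<in> borel_measurable FF"
    using measurable_compose[OF F, of "\<lambda>b. if b then 1 else 0 :: ennreal" borel] g
    by (intro borel_measurable_times_ennreal) auto
  from split[OF this]
  have "(\<integral>\<^sup>+F. g F * (if F j then 1 else 0) \<partial>FF) = (\<integral>\<^sup>+F. g F * ennreal (fit_prob M j)
      \<partial>PiM ?J (\<lambda>j. measure_pmf (bernoulli_pmf (fit_prob M j))))"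
    using fit_prob[OF j] by (simp add: indep nn_integral_cmult emeasure_pmf_single)
  also have "\<dots> = (\<integral>\<^sup>+F. g F * ennreal (fit_prob M j) \<partial>FF)"
    using split[of "\<lambda>F. g F * ennreal (fit_prob M j)"] g by (simp add: indep)
  also have "\<dots> = ennreal (fit_prob M j) * (\<integral>\<^sup>+F. g F \<partial>FF)"
    using g by (simp add: nn_integral_multc mult.commute)
  finally show ?thesis
    by (simp add: indicator_def of_bool_def)
qed

text \<open>Whether a business is inspected does not depend on its own fit.\<close>

lemma prob_trans:
  assumes j: "j < m"
  shows "measure CS {z \<in> space CS. buys z j} = fit_prob M j * measure CS {z \<in> space CS. insp z j}"
proof -
  interpret CS: prob_space CS by (rule prob_CS)
  note VF = prob_space_pair_measure[OF prob_value prob_FF]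
  define h where "h P V F = (if inspects m (eq_index M \<Phi> P V) F j then 1 else 0 :: ennreal)" for P V F
  have hm: "(\<lambda>z. h (fst z) (fst (snd z)) (snd (snd z))) \<in> borel_measurable CS"
    unfolding h_def using insp_measurable[of j] by (intro measurable_If) (auto simp: pred_def)
  have tm: "(\<lambda>z. h (fst z) (fst (snd z)) (snd (snd z)) * indicator {F. F j} (snd (snd z))) \<in> borel_measurable CS"
    using hm measurable_compose[OF CS_components(3)[OF j], of "\<lambda>b. if b then 1 else 0 :: ennreal" borel]
    by (intro borel_measurable_times_ennreal) (auto simp: indicator_def of_bool_def)
  \<comment> \<open>\<open>precedes\<close> is irreflexive, so \<open>inspects\<close> never
    consults the fit of \<open>j\<close> itself.\<close>
  have indep: "h P V (F(j := b)) = h P V F" for P V F b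
    by (auto simp: h_def inspects_def precedes_def indicator_def)
  have iter: "(\<integral>\<^sup>+z. k (fst z) (fst (snd z)) (snd (snd z)) \<partial>CS) = (\<integral>\<^sup>+P. \<integral>\<^sup>+V. \<integral>\<^sup>+F. k P V F \<partial>FF \<partial>value_dist M \<partial>PP)"
    if k: "(\<lambda>z. k (fst z) (fst (snd z)) (snd (snd z))) \<in> borel_measurable CS" for k :: "_ \<Rightarrow> _ \<Rightarrow> _ \<Rightarrow> ennreal"
  proof -
    have k': "(\<lambda>z. k (fst z) (fst (snd z)) (snd (snd z))) \<in> borel_measurable (PP \<Otimes>\<^sub>M (value_dist M \<Otimes>\<^sub>M FF))"
      using k by (simp add: CS_def')
    have "(\<integral>\<^sup>+z. k (fst z) (fst (snd z)) (snd (snd z)) \<partial>CS) =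
        (\<integral>\<^sup>+P. \<integral>\<^sup>+w. k P (fst w) (snd w) \<partial>(value_dist M \<Otimes>\<^sub>M FF) \<partial>PP)"
      unfolding CS_def' by (subst nn_integral_pair[OF VF k']) simp
    also have "\<dots> = (\<integral>\<^sup>+P. \<integral>\<^sup>+V. \<integral>\<^sup>+F. k P V F \<partial>FF \<partial>value_dist M \<partial>PP)"
    proof (rule nn_integral_cong)
      fix P assume P: "P \<in> space PP"
      have "(\<lambda>w. k P (fst w) (snd w)) \<in> borel_measurable (value_dist M \<Otimes>\<^sub>M FF)"
        using measurable_compose[OF measurable_Pair1'[OF P] k'] by simp
      then show "(\<integral>\<^sup>+w. k P (fst w) (snd w) \<partial>(value_dist M \<Otimes>\<^sub>M FF)) = (\<integral>\<^sup>+V. \<integral>\<^sup>+F. k P V F \<partial>FF \<partial>value_dist M)"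
        by (subst nn_integral_pair[OF prob_FF]) simp_all
    qed
    finally show ?thesis .
  qed
  have em: "emeasure CS {z \<in> space CS. Q z} = (\<integral>\<^sup>+z. (if Q z then 1 else 0) \<partial>CS)"
    if "{z \<in> space CS. Q z} \<in> sets CS" for Q
    using nn_integral_indicator[OF that] by (auto simp: indicator_def of_bool_def cong: nn_integral_cong)
  have "emeasure CS {z \<in> space CS. buys z j} =
      (\<integral>\<^sup>+z. h (fst z) (fst (snd z)) (snd (snd z)) * indicator {F. F j} (snd (snd z)) \<partial>CS)"
    using trans_measurable[of j] unfolding pred_def
    by (subst em, assumption) (auto simp: h_def transacts_def indicator_def intro!: nn_integral_cong)
  also have "\<dots> = (\<integral>\<^sup>+P. \<integral>\<^sup>+V. \<integral>\<^sup>+F. h P V F * indicator {F. F j} F \<partial>FF \<partial>value_dist M \<partial>PP)"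
    by (rule iter[OF tm])
  also have "\<dots> = (\<integral>\<^sup>+P. \<integral>\<^sup>+V. ennreal (fit_prob M j) * (\<integral>\<^sup>+F. h P V F \<partial>FF) \<partial>value_dist M \<partial>PP)"
  proof (intro nn_integral_cong nn_integral_FF_fit j indep)
    fix P V assume "P \<in> space PP" "V \<in> space (value_dist M)"
    from measurable_compose[OF measurable_Pair1'[OF this(2)] measurable_compose[OF measurable_Pair1'[OF this(1)] hm[unfolded CS_def']]]
    show "h P V \<in> borel_measurable FF" by simp
  qed
  also have "\<dots> = (\<integral>\<^sup>+P. \<integral>\<^sup>+V. \<integral>\<^sup>+F. ennreal (fit_prob M j) * h P V F \<partial>FF \<partial>value_dist M \<partial>PP)"
  proof (intro nn_integral_cong nn_integral_cmult[symmetric])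
    fix P V assume "P \<in> space PP" "V \<in> space (value_dist M)"
    from measurable_compose[OF measurable_Pair1'[OF this(2)] measurable_compose[OF measurable_Pair1'[OF this(1)] hm[unfolded CS_def']]]
    show "h P V \<in> borel_measurable FF" by simp
  qed
  also have "\<dots> = (\<integral>\<^sup>+z. ennreal (fit_prob M j) * h (fst z) (fst (snd z)) (snd (snd z)) \<partial>CS)"
    by (rule iter[symmetric]) (intro borel_measurable_times_ennreal hm borel_measurable_const)
  also have "\<dots> = ennreal (fit_prob M j) * (\<integral>\<^sup>+z. h (fst z) (fst (snd z)) (snd (snd z)) \<partial>CS)"
    by (rule nn_integral_cmult[OF hm])
  also have "(\<integral>\<^sup>+z. h (fst z) (fst (snd z)) (snd (snd z)) \<partial>CS) = emeasure CS {z \<in> space CS. insp z j}"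
    using insp_measurable[of j] unfolding pred_def h_def by (rule em[symmetric])
  finally show ?thesis
    using fit_prob[OF j] by (simp add: CS.emeasure_eq_measure ennreal_mult[symmetric])
qed

lemma integrable_bounded_on:
  assumes Q: "(\<lambda>z. Q z) \<in> CS \<rightarrow>\<^sub>M count_space UNIV" and f: "f \<in> borel_measurable CS"
    and "AE z in CS. Q z \<longrightarrow> \<bar>f z\<bar> \<le> B"
  shows "integrable CS (\<lambda>z. if Q z then f z else (0::real))"
proof -
  interpret CS: prob_space CS by (rule prob_CS)
  show ?thesis
  proof (rule CS.integrable_const_bound[where B = "max 0 B"])
    show "(\<lambda>z. if Q z then f z else 0) \<in> borel_measurable CS"
      using Q f by (intro measurable_If) (auto simp: pred_def)
    show "AE z in CS. norm (if Q z then f z else 0) \<le> max 0 B"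
      using assms(3) by eventually_elim auto
  qed
qed

text \<open>The utility when search costs are charged as \<open>search_cost M / fit_prob M j\<close>
  at the moment of purchase. It differs from the realized utility but has the same expectation; at
  most one summand is nonzero.\<close>

definition surplus :: "(nat \<Rightarrow> real) \<times> real \<times> (nat \<Rightarrow> bool) \<Rightarrow> real" where
  "surplus z = (\<Sum>j<m. if buys z j then \<sigma> z j else 0)"

definition gross_surplus :: "(nat \<Rightarrow> real) \<times> real \<times> (nat \<Rightarrow> bool) \<Rightarrow> real" where
  "gross_surplus z = (\<Sum>j<m. if buys z j then \<sigma> z j + fst z j else 0)"

lemma AE_trans:
  "AE z in CS. \<forall>j. buys z j \<longrightarrow> j \<in> S \<and> 0 < \<sigma> z j \<and> \<sigma> z j \<le> max_value M \<and> 0 \<le> fst z j \<and>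
     \<sigma> z j + fst z j = fst (snd z) * quality M j - search_cost M / fit_prob M j \<and> \<sigma> z j + fst z j \<le> max_value M"
  using AE_index AE_CS
proof eventually_elim
  case (elim z)
  show ?case
  proof (intro allI impI)
    fix j assume "buys z j"
    then have j: "j < m" "\<sigma> z j > 0" by (auto simp: transacts_def inspects_def)
    then have jS: "j \<in> S" using elim by auto
    have "fst (snd z) * quality M j \<le> max_value M * 1"
      using elim quality[OF j(1)] by (intro mult_mono) auto
    moreover have "0 \<le> search_cost M / fit_prob M j"
      using fit_prob[OF j(1)] wf by (auto simp: wf_market_def)
    ultimately show "j \<in> S \<and> 0 < \<sigma> z j \<and> \<sigma> z j \<le> max_value M \<and> 0 \<le> fst z j \<and>
     \<sigma> z j + fst z j = fst (snd z) * quality M j - search_cost M / fit_prob M j \<and> \<sigma> z j + fst z j \<le> max_value M"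
      using jS j elim index_learned[OF jS, of "fst z" "fst (snd z)"] by auto
  qed
qed

lemma integrable_trans:
  assumes j: "j < m"
  shows "integrable CS (\<lambda>z. if buys z j then \<sigma> z j else 0)"
    "integrable CS (\<lambda>z. if buys z j then fst z j else 0)"
proof -
  show "integrable CS (\<lambda>z. if buys z j then \<sigma> z j else 0)"
  proof (rule integrable_bounded_on[OF trans_measurable \<sigma>_measurable[OF j]])
    show "AE z in CS. buys z j \<longrightarrow> \<bar>\<sigma> z j\<bar> \<le> max_value M"
      using AE_trans by eventually_elim force
  qed
  show "integrable CS (\<lambda>z. if buys z j then fst z j else 0)"
  proof (rule integrable_bounded_on[OF trans_measurable CS_components(1)[OF j]])
    show "AE z in CS. buys z j \<longrightarrow> \<bar>fst z j\<bar> \<le> max_value M"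
      using AE_trans by eventually_elim force
  qed
qed

text \<open>By \<open>prob_trans\<close> a business is bought from with probability
  \<open>fit_prob M j\<close> times that of being inspected. The expected cost of inspecting it is
  therefore the same as that of a charge \<open>search_cost M / fit_prob M j\<close> per purchase,
  which turns value minus price into the index.\<close>

lemma consumer_welfare_eq: "consumer_welfare M \<Phi> = (\<integral>z. surplus z \<partial>CS)"
proof -
  interpret CS: prob_space CS by (rule prob_CS)
  let ?c = "\<lambda>j. search_cost M / fit_prob M j"
  have meas: "{z \<in> space CS. buys z j} \<in> sets CS" "{z \<in> space CS. insp z j} \<in> sets CS" for j
    using trans_measurable[of j] insp_measurable[of j] by (simp_all add: pred_def)
  have ind: "(\<integral>z. (if buys z j then x else 0) \<partial>CS) = x * measure CS {z \<in> space CS. buys z j}"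
    "(\<integral>z. (if insp z j then x else 0) \<partial>CS) = x * measure CS {z \<in> space CS. insp z j}" for x j
  proof -
    have "(\<integral>z. (if Q z then x else 0) \<partial>CS) = x * measure CS {z \<in> space CS. Q z}"
      if "{z \<in> space CS. Q z} \<in> sets CS" for Q
    proof -
      have "(\<integral>z. (if Q z then x else 0) \<partial>CS) = (\<integral>z. x * indicator {z \<in> space CS. Q z} z \<partial>CS)"
        by (intro Bochner_Integration.integral_cong) (auto simp: indicator_def)
      then show ?thesis using that by simp
    qed
    from this[OF meas(1)] this[OF meas(2)]
    show "(\<integral>z. (if buys z j then x else 0) \<partial>CS) = x * measure CS {z \<in> space CS. buys z j}"
      "(\<integral>z. (if insp z j then x else 0) \<partial>CS) = x * measure CS {z \<in> space CS. insp z j}" by auto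
  qed
  have int: "integrable CS (\<lambda>z. if buys z j then x else 0)" "integrable CS (\<lambda>z. if insp z j then x else 0)" for x :: real and j
    by (rule integrable_bounded_on[where B = "\<bar>x\<bar>"]; simp add: trans_measurable insp_measurable)+
  let ?u = "\<lambda>j z. (if buys z j then \<sigma> z j else 0) + (if buys z j then ?c j else 0) - (if insp z j then search_cost M else 0)"
  have "consumer_welfare M \<Phi> = (\<integral>z. (\<Sum>j<m. (if buys z j then fst (snd z) * quality M j - fst z j else 0) -
       (if insp z j then search_cost M else 0)) \<partial>CS)"
    by (simp add: consumer_welfare_def split_beta')
  also have "\<dots> = (\<integral>z. (\<Sum>j<m. ?u j z) \<partial>CS)"
  proof (rule integral_cong_AE)
    show "AE z in CS. (\<Sum>j<m. (if buys z j then fst (snd z) * quality M j - fst z j else 0) -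
       (if insp z j then search_cost M else 0)) = (\<Sum>j<m. ?u j z)"
      using AE_trans by eventually_elim (intro sum.cong refl, force)
    show "(\<lambda>z. \<Sum>j<m. (if buys z j then fst (snd z) * quality M j - fst z j else 0) -
       (if insp z j then search_cost M else 0)) \<in> borel_measurable CS"
      using trans_measurable insp_measurable
      by (intro borel_measurable_sum borel_measurable_diff measurable_If borel_measurable_times CS_components
          borel_measurable_const) (auto simp: pred_def)
    show "(\<lambda>z. \<Sum>j<m. ?u j z) \<in> borel_measurable CS"
      using int integrable_trans(1)
      by (intro borel_measurable_sum borel_measurable_diff borel_measurable_add borel_measurable_integrable) auto
  qed
  also have "\<dots> = (\<Sum>j<m. (\<integral>z. (if buys z j then \<sigma> z j else 0) \<partial>CS) +
      (?c j * measure CS {z \<in> space CS. buys z j} - search_cost M * measure CS {z \<in> space CS. insp z j}))"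
    using int integrable_trans(1) by (subst Bochner_Integration.integral_sum) (auto simp: ind intro!: sum.cong)
  also have "\<dots> = (\<Sum>j<m. \<integral>z. (if buys z j then \<sigma> z j else 0) \<partial>CS)"
  proof (rule sum.cong[OF refl])
    fix j assume "j \<in> {..<m}"
    then have "?c j * measure CS {z \<in> space CS. buys z j} = search_cost M * measure CS {z \<in> space CS. insp z j}"
      using fit_prob[of j] by (simp add: prob_trans)
    then show "(\<integral>z. (if buys z j then \<sigma> z j else 0) \<partial>CS) +
      (?c j * measure CS {z \<in> space CS. buys z j} - search_cost M * measure CS {z \<in> space CS. insp z j}) =
      (\<integral>z. (if buys z j then \<sigma> z j else 0) \<partial>CS)" by simp
  qed
  also have "\<dots> = (\<integral>z. surplus z \<partial>CS)"
    unfolding surplus_def using integrable_trans(1) by (intro Bochner_Integration.integral_sum[symmetric]) auto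
  finally show ?thesis .
qed

lemma total_welfare_eq: "total_welfare M \<Phi> = (\<integral>z. gross_surplus z \<partial>CS)"
proof -
  have "revenue M \<Phi> j = (\<integral>z. (if buys z j then fst z j else 0) \<partial>CS)" for j
    by (simp add: revenue_def split_beta')
  then have "total_welfare M \<Phi> = (\<Sum>j<m. \<integral>z. (if buys z j then \<sigma> z j else 0) \<partial>CS) +
      (\<Sum>j<m. \<integral>z. (if buys z j then fst z j else 0) \<partial>CS)"
    unfolding total_welfare_def consumer_welfare_eq surplus_def
    using integrable_trans(1) by (subst Bochner_Integration.integral_sum) auto
  also have "\<dots> = (\<integral>z. (\<Sum>j<m. (if buys z j then \<sigma> z j else 0) + (if buys z j then fst z j else 0)) \<partial>CS)"
    using integrable_trans by (subst Bochner_Integration.integral_sum) (auto simp: sum.distrib)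
  also have "\<dots> = (\<integral>z. gross_surplus z \<partial>CS)"
    unfolding gross_surplus_def by (intro Bochner_Integration.integral_cong sum.cong refl) auto
  finally show ?thesis .
qed

lemma surplus_measurable: "surplus \<in> borel_measurable CS" "gross_surplus \<in> borel_measurable CS"
proof -
  show "surplus \<in> borel_measurable CS"
    unfolding surplus_def[abs_def]
    by (intro borel_measurable_sum borel_measurable_integrable integrable_trans) auto
  have "gross_surplus = (\<lambda>z. \<Sum>j<m. (if buys z j then \<sigma> z j else 0) + (if buys z j then fst z j else 0))"
    by (auto simp: gross_surplus_def fun_eq_iff intro!: sum.cong)
  then show "gross_surplus \<in> borel_measurable CS"
    using integrable_trans
    by (auto intro!: borel_measurable_sum borel_measurable_add borel_measurable_integrable)
qed

lemma surplus_trans: "buys z j \<Longrightarrow> surplus z = \<sigma> z j" "buys z j \<Longrightarrow> gross_surplus z = \<sigma> z j + fst z j"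
proof -
  assume j: "buys z j"
  then have "j < m" by (simp add: transacts_def inspects_def)
  moreover have "buys z k \<longleftrightarrow> k = j" for k using j transacts_unique by blast
  ultimately show "surplus z = \<sigma> z j" "gross_surplus z = \<sigma> z j + fst z j"
    by (simp_all add: surplus_def gross_surplus_def)
qed

lemma surplus_no_trans: "\<forall>j. \<not> buys z j \<Longrightarrow> surplus z = 0" "\<forall>j. \<not> buys z j \<Longrightarrow> gross_surplus z = 0"
  by (simp_all add: surplus_def gross_surplus_def)

lemma AE_surplus_nonneg: "AE z in CS. 0 \<le> surplus z \<and> surplus z \<le> max_value M \<and> 0 \<le> gross_surplus z \<and> gross_surplus z \<le> max_value M"
  using AE_trans
proof eventually_elim
  case (elim z)
  show ?case
  proof (cases "\<exists>j. buys z j")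
    case True
    then obtain j where j: "buys z j" by blast
    then show ?thesis using elim surplus_trans[OF j] by force
  qed (simp add: surplus_no_trans max_value_nonneg)
qed

lemma welfare_nn_integral:
  "ennreal (consumer_welfare M \<Phi>) = (\<integral>\<^sup>+z. ennreal (surplus z) \<partial>CS)"
  "ennreal (total_welfare M \<Phi>) = (\<integral>\<^sup>+z. ennreal (gross_surplus z) \<partial>CS)"
  "0 \<le> consumer_welfare M \<Phi>" "0 \<le> total_welfare M \<Phi>"
proof -
  interpret CS: prob_space CS by (rule prob_CS)
  have pos: "AE z in CS. 0 \<le> surplus z" "AE z in CS. 0 \<le> gross_surplus z"
    by (rule eventually_mono[OF AE_surplus_nonneg]; simp)+
  have bound: "AE z in CS. norm (surplus z) \<le> max_value M" "AE z in CS. norm (gross_surplus z) \<le> max_value M"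
    by (rule eventually_mono[OF AE_surplus_nonneg]; simp)+
  note i = CS.integrable_const_bound[OF bound(1) surplus_measurable(1)]
    CS.integrable_const_bound[OF bound(2) surplus_measurable(2)]
  show "ennreal (consumer_welfare M \<Phi>) = (\<integral>\<^sup>+z. ennreal (surplus z) \<partial>CS)"
    "ennreal (total_welfare M \<Phi>) = (\<integral>\<^sup>+z. ennreal (gross_surplus z) \<partial>CS)"
    unfolding consumer_welfare_eq total_welfare_eq
    by (simp_all add: nn_integral_eq_integral i pos)
  show "0 \<le> consumer_welfare M \<Phi>" "0 \<le> total_welfare M \<Phi>"
    unfolding consumer_welfare_eq total_welfare_eq using pos by (auto intro: integral_nonneg_AE)
qed

lemma welfare_not_viable:
  assumes "\<And>j. j \<in> S \<Longrightarrow> max_value M * quality M j - search_cost M / fit_prob M j \<le> 0"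
  shows "consumer_welfare M \<Phi> = 0" "total_welfare M \<Phi> = 0"
proof -
  have "AE z in CS. surplus z = 0 \<and> gross_surplus z = 0"
    using AE_trans AE_CS
  proof eventually_elim
    case (elim z)
    have "\<not> buys z j" for j
    proof
      assume "buys z j"
      then have j: "j \<in> S" "0 < \<sigma> z j + fst z j"
        "\<sigma> z j + fst z j = fst (snd z) * quality M j - search_cost M / fit_prob M j" using elim by force+
      moreover have "fst (snd z) * quality M j \<le> max_value M * quality M j"
        using elim quality[OF S_less[OF j(1)]] by (intro mult_right_mono) auto
      ultimately show False using assms[OF j(1)] by simp
    qed
    then show ?case by (simp add: surplus_no_trans)
  qed
  then have "AE z in CS. surplus z = 0" "AE z in CS. gross_surplus z = 0" by (auto elim!: eventually_mono)
  then show "consumer_welfare M \<Phi> = 0" "total_welfare M \<Phi> = 0"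
    unfolding consumer_welfare_eq total_welfare_eq
    by (simp_all add: integral_eq_zero_AE)
qed

end

section \<open>Comparison of full price distributions\<close>

lemma measure_atMost_support:
  fixes \<mu> :: "real measure"
  assumes P: "prob_space \<mu>" and B: "sets \<mu> = sets borel"
  shows "\<lbrakk>x \<le> y; \<And>z. x < z \<Longrightarrow> z \<le> y \<Longrightarrow> z \<notin> msupport \<mu>\<rbrakk> \<Longrightarrow> measure \<mu> {..y} = measure \<mu> {..x}"
    and "(\<And>z. z \<in> msupport \<mu> \<Longrightarrow> z \<le> y) \<Longrightarrow> measure \<mu> {..y} = 1"
    and "(\<And>z. z \<in> msupport \<mu> \<Longrightarrow> y < z) \<Longrightarrow> measure \<mu> {..y} = 0"
proof -
  interpret prob_space \<mu> by fact
  note supp = AE_msupport[OF B]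
  show "measure \<mu> {..y} = measure \<mu> {..x}" if "x \<le> y" "\<And>z. x < z \<Longrightarrow> z \<le> y \<Longrightarrow> z \<notin> msupport \<mu>"
  proof (rule measure_eq_AE)
    show "AE z in \<mu>. z \<in> {..y} \<longleftrightarrow> z \<in> {..x}"
      using supp by eventually_elim (use that in force)
  qed (simp_all add: B)
  show "measure \<mu> {..y} = 1" if "\<And>z. z \<in> msupport \<mu> \<Longrightarrow> z \<le> y"
    by (subst AE_in_set_eq_1[symmetric]) (use supp that in \<open>auto simp: B elim: eventually_mono\<close>)
  have "measure \<mu> {..y} = measure \<mu> {}" if "\<And>z. z \<in> msupport \<mu> \<Longrightarrow> y < z"
  proof (rule measure_eq_AE)
    show "AE z in \<mu>. z \<in> {..y} \<longleftrightarrow> z \<in> {}"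
      using supp by eventually_elim (use that in force)
  qed (simp_all add: B)
  then show "measure \<mu> {..y} = 0" if "\<And>z. z \<in> msupport \<mu> \<Longrightarrow> y < z" using that by simp
qed

text \<open>
  \<open>\<mu>\<close> and \<open>\<mu>'\<close> are the price distributions of \<open>n\<close> sellers with effective search cost \<open>s\<close> and of
  \<open>n'\<close> sellers with effective search cost \<open>s'\<close>; \<open>A x\<close> is the probability that a consumer who
  finds a fit values it at more than \<open>x\<close>. If the smallest full price (price plus \<open>s\<close>) among the
  fitting sellers were not stochastically larger in the first market, then deviating from a price
  \<open>y - s\<close> in the support of \<open>\<mu>\<close> to \<open>b - s\<close>, and from the top \<open>b - s'\<close> of the support of \<open>\<mu>'\<close> to
  \<open>y - s'\<close>, could not both be unprofitable, because \<open>(b - s) / (y - s) > (b - s') / (y - s')\<close>.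
\<close>

lemma full_price_dominance_support:
  fixes A G G' :: "real \<Rightarrow> real"
  assumes \<pi>: "0 < \<pi>" "\<pi> < 1" and n: "1 \<le> n" "n \<le> n'" and s: "s' < s"
    and G: "\<And>x. 0 \<le> G x" "\<And>x. G x \<le> 1" "\<And>x. 0 \<le> G' x" "\<And>x. G' x \<le> 1"
    and y: "s < y" "y < b" and top: "G' (b - s') = 1" and A: "0 < A y" "0 \<le> A b"
    and dev: "(b - s) * A b * (1 - \<pi> * G (b - s)) ^ (n - 1) \<le> (y - s) * A y * (1 - \<pi> * G (y - s)) ^ (n - 1)"
    and dev': "(y - s') * A y * (1 - \<pi> * G' (y - s')) ^ (n' - 1) \<le> (b - s') * A b * (1 - \<pi> * G' (b - s')) ^ (n' - 1)"
  shows "(1 - \<pi> * G' (y - s')) ^ n' \<le> (1 - \<pi> * G (y - s)) ^ n"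
proof -
  \<comment> \<open>The probability that a given rival does not both fit and undercut is at least 1
    - \<pi>. Dividing by this bound gives numbers \<ge> 1, whose powers increase with the
    exponent.\<close>
  define \<alpha> where "\<alpha> = (1 - \<pi> * G' (y - s')) / (1 - \<pi>)"
  define \<beta> where "\<beta> = (1 - \<pi> * G (y - s)) / (1 - \<pi>)"
  have a: "1 - \<pi> * G' (y - s') = (1 - \<pi>) * \<alpha>" and b: "1 - \<pi> * G (y - s) = (1 - \<pi>) * \<beta>"
    using \<pi> by (simp_all add: \<alpha>_def \<beta>_def)
  have lower: "1 - \<pi> \<le> 1 - \<pi> * G x" "1 - \<pi> \<le> 1 - \<pi> * G' x" for x
    using \<pi> G[of x] by (simp_all add: mult_left_le)
  have \<alpha>\<beta>: "1 \<le> \<alpha>" "1 \<le> \<beta>" using lower \<pi> by (simp_all add: \<alpha>_def \<beta>_def le_divide_eq)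
  \<comment> \<open>At \<open>b - s\<close> the worst case is that every fitting rival is cheaper;
    in the other market this is exact at the top of the support, by \<open>top\<close>.\<close>
  have "(b - s) * A b * (1 - \<pi>) ^ (n - 1) \<le> (b - s) * A b * (1 - \<pi> * G (b - s)) ^ (n - 1)"
    using y A \<pi> lower by (intro mult_left_mono power_mono mult_nonneg_nonneg) auto
  also note dev
  finally have 1: "(b - s) * A b \<le> (y - s) * A y * \<beta> ^ (n - 1)"
    using \<pi> by (simp add: b power_mult_distrib mult.assoc mult.left_commute[of _ "(1 - \<pi>) ^ (n - 1)"])
  have 2: "(y - s') * A y * \<alpha> ^ (n' - 1) \<le> (b - s') * A b"
    using dev' \<pi> by (simp add: top a power_mult_distrib mult.assoc mult.left_commute[of _ "(1 - \<pi>) ^ (n' - 1)"])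
  have "(b - s) * ((y - s') * A y * \<alpha> ^ (n' - 1)) \<le> (b - s) * ((b - s') * A b)"
    using 2 y by (intro mult_left_mono) auto
  also have "\<dots> = (b - s') * ((b - s) * A b)" by simp
  also have "\<dots> \<le> (b - s') * ((y - s) * A y * \<beta> ^ (n - 1))"
    using 1 y s by (intro mult_left_mono) auto
  also have "\<dots> = (b - s') * (y - s) * (A y * \<beta> ^ (n - 1))" by simp
  \<comment> \<open>The cross products differ by \<open>(s - s') * (b - y)\<close>. For
    \<open>n = n' = 1\<close> the powers below are all 1 and this strictness is the whole content:
    \<open>y < b\<close> is then impossible.\<close>
  also have "\<dots> < (b - s) * (y - s') * (A y * \<beta> ^ (n - 1))"
  proof (rule mult_strict_right_mono)
    have "0 < (s - s') * (b - y)" using s y by simp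
    then show "(b - s') * (y - s) < (b - s) * (y - s')" by (simp add: algebra_simps)
    show "0 < A y * \<beta> ^ (n - 1)" using A \<alpha>\<beta> by simp
  qed
  finally have "((b - s) * (y - s') * A y) * \<alpha> ^ (n' - 1) < ((b - s) * (y - s') * A y) * \<beta> ^ (n - 1)"
    by (simp add: mult_ac)
  moreover have "0 < (b - s) * (y - s') * A y" using y s A by simp
  ultimately have less: "\<alpha> ^ (n' - 1) < \<beta> ^ (n - 1)" by (simp add: mult_less_cancel_left)
  have "\<alpha> \<le> \<beta>"
  proof (rule ccontr)
    assume "\<not> \<alpha> \<le> \<beta>"
    then have "\<beta> ^ (n - 1) \<le> \<alpha> ^ (n - 1)" using \<alpha>\<beta> by (intro power_mono) auto
    also have "\<dots> \<le> \<alpha> ^ (n' - 1)" using \<alpha>\<beta> n by (intro power_increasing) auto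
    finally show False using less by simp
  qed
  \<comment> \<open>Revenues involve the \<open>n - 1\<close> and \<open>n' - 1\<close> rivals of a
    seller, the claim all sellers; the missing factor is supplied by \<alpha> \<le> \<beta>.\<close>
  have "\<alpha> ^ n' = \<alpha> * \<alpha> ^ (n' - 1)" "\<beta> ^ n = \<beta> * \<beta> ^ (n - 1)"
    using n by (simp_all flip: power_Suc)
  then have "\<alpha> ^ n' \<le> \<beta> ^ n" using \<open>\<alpha> \<le> \<beta>\<close> less \<alpha>\<beta> by (auto intro!: mult_mono)
  moreover have "(1 - \<pi>) ^ n' \<le> (1 - \<pi>) ^ n" using \<pi> n by (intro power_decreasing) auto
  ultimately show ?thesis
    unfolding a b power_mult_distrib using \<pi> \<alpha>\<beta> by (intro mult_mono) auto
qed

text \<open>Bertrand competition with random fits. The objective has the closed ray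
  \<open>{..p}\<close> because the seller considered loses all ties; \<open>vmax\<close> is the
  least full price at which demand vanishes.\<close>

locale price_competition =
  fixes \<pi> s :: real and A :: "real \<Rightarrow> real" and vmax :: real and n :: nat and \<mu> :: "real measure"
  assumes \<pi>: "0 < \<pi>" "\<pi> < 1" and s: "0 \<le> s" "s < vmax"
    and A_nonneg: "\<And>x. 0 \<le> A x" and A_pos: "\<And>x. x < vmax \<Longrightarrow> 0 < A x" and A_zero: "\<And>x. vmax \<le> x \<Longrightarrow> A x = 0"
    and n: "1 \<le> n"
    and prob: "prob_space \<mu>" and sets: "sets \<mu> = sets borel" and nonneg: "AE p in \<mu>. 0 \<le> p"
    and optimal: "\<And>p p'. p \<in> msupport \<mu> \<Longrightarrow> 0 \<le> p' \<Longrightarrow>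
      p' * A (p' + s) * (1 - \<pi> * measure \<mu> {..p'}) ^ (n - 1) \<le>
      p * A (p + s) * (1 - \<pi> * measure \<mu> {..p}) ^ (n - 1)"
begin

abbreviation "G x \<equiv> measure \<mu> {..x}"

lemma G: "0 \<le> G x" "G x \<le> 1"
  using prob_space.prob_le_1[OF prob] by auto

lemma support_nonneg: "p \<in> msupport \<mu> \<Longrightarrow> 0 \<le> p"
proof (rule ccontr)
  assume p: "p \<in> msupport \<mu>" "\<not> 0 \<le> p"
  then have "emeasure \<mu> {..<0} > 0" by (auto simp: msupport_def)
  moreover have "emeasure \<mu> {..<0} = 0"
    using nonneg by (subst AE_iff_measurable[symmetric, where P = "\<lambda>p. 0 \<le> p"]) (auto simp: sets sets_eq_imp_space_eq[OF sets])
  ultimately show False by simp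
qed

lemma support_pos: "p \<in> msupport \<mu> \<Longrightarrow> 0 < p \<and> p + s < vmax"
proof -
  assume p: "p \<in> msupport \<mu>"
  \<comment> \<open>Halfway between price 0 and the price at which demand vanishes. Its revenue is
    positive even if all rivals undercut it, since none of them may fit; so every optimal price
    earns something.\<close>
  let ?p = "(vmax - s) / 2"
  have "0 < ?p * A (?p + s) * (1 - \<pi> * G ?p) ^ (n - 1)"
  proof (intro mult_pos_pos zero_less_power)
    show "0 < A (?p + s)" using s by (intro A_pos) (simp add: field_simps)
    have "\<pi> * G ?p \<le> \<pi> * 1" using \<pi> G by (intro mult_left_mono) auto
    then show "0 < 1 - \<pi> * G ?p" using \<pi> by linarith
  qed (use s in simp)
  also have "\<dots> \<le> p * A (p + s) * (1 - \<pi> * G p) ^ (n - 1)" using p s by (intro optimal) auto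
  finally have "0 \<noteq> p * A (p + s)" by auto
  then have "p \<noteq> 0" "A (p + s) \<noteq> 0" by auto
  then show ?thesis using support_nonneg[OF p] A_zero[of "p + s"] by force
qed

lemma support_max: "Sup (msupport \<mu>) \<in> msupport \<mu>" "p \<in> msupport \<mu> \<Longrightarrow> p \<le> Sup (msupport \<mu>)"
proof -
  have bdd: "bdd_above (msupport \<mu>)"
    by (rule bdd_aboveI[of _ "vmax - s"]) (use support_pos in force)
  show "Sup (msupport \<mu>) \<in> msupport \<mu>"
    using msupport_nonempty[OF prob sets] bdd closed_msupport by (rule closed_contains_Sup)
  show "p \<in> msupport \<mu> \<Longrightarrow> p \<le> Sup (msupport \<mu>)" by (rule cSup_upper[OF _ bdd])
qed

text \<open>Optimality yields the comparison for closed rays, while welfare needs open ones, a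
  purchase requiring a strictly positive index. Continuity from below leads from one to the
  other.\<close>

lemma measure_lessThan_lim: "(\<lambda>k. G (x - 1 / Suc k)) \<longlonglongrightarrow> measure \<mu> {..<x}"
proof -
  interpret prob_space \<mu> by (rule prob)
  have "(\<lambda>k. G (x - 1 / Suc k)) \<longlonglongrightarrow> measure \<mu> (\<Union>k. {..x - 1 / Suc k})"
    by (rule finite_Lim_measure_incseq) (auto simp: sets incseq_def frac_le intro: order_trans)
  also have "(\<Union>k. {..x - 1 / Suc k}) = {..<x}"
  proof (intro equalityI subsetI)
    fix z assume "z \<in> {..<x}"
    then obtain k where "1 / Suc k < x - z" using nat_approx_posE[of "x - z"] by auto
    then show "z \<in> (\<Union>k. {..x - 1 / Suc k})" by (auto intro!: exI[of _ k])
  qed (auto simp: less_le_trans intro: le_less_trans)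
  finally show ?thesis .
qed

end

text \<open>The powers are the probabilities that no seller both fits and has full price at most
  \<open>y\<close>, respectively below \<open>y\<close>. Revealed preference applies only to
  \<open>y - s\<close> in the support of \<mu>; other \<open>y\<close> are reduced to such
  points.\<close>

lemma full_price_dominance:
  assumes "price_competition \<pi> s A vmax n \<mu>" "price_competition \<pi> s' A vmax n' \<mu>'"
    and n: "n \<le> n'" and ss: "s' < s"
  shows "(1 - \<pi> * measure \<mu>' {..y - s'}) ^ n' \<le> (1 - \<pi> * measure \<mu> {..y - s}) ^ n"
    and "(1 - \<pi> * measure \<mu>' {..<y - s'}) ^ n' \<le> (1 - \<pi> * measure \<mu> {..<y - s}) ^ n"
proof -
  interpret hi: price_competition \<pi> s A vmax n \<mu> by fact
  interpret lo: price_competition \<pi> s' A vmax n' \<mu>' by fact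
  interpret P': prob_space \<mu>' by (rule lo.prob)
  have lower: "1 - \<pi> \<le> 1 - \<pi> * hi.G x" "1 - \<pi> \<le> 1 - \<pi> * lo.G x" "1 - \<pi> * hi.G x \<le> 1" "1 - \<pi> * lo.G x \<le> 1" for x
    using hi.\<pi> hi.G[of x] lo.G[of x] by (simp_all add: mult_left_le)
  show closed: "(1 - \<pi> * lo.G (y - s')) ^ n' \<le> (1 - \<pi> * hi.G (y - s)) ^ n" for y
  proof (cases "\<exists>p\<in>msupport \<mu>. p \<le> y - s")
    case False
    then have "hi.G (y - s) = 0"
      by (intro measure_atMost_support(3)[OF hi.prob hi.sets]) auto
    moreover have "0 \<le> 1 - \<pi> * lo.G (y - s')" using lower(2)[of "y - s'"] hi.\<pi> by linarith
    ultimately show ?thesis using lower(4)[of "y - s'"] by (simp add: power_le_one)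
  next
    case True
    \<comment> \<open>Round \<open>y - s\<close> down to the closest support point \<open>p\<close>.
      This leaves the distribution function of \<mu> unchanged and can only lower that of \<mu>', so
      the claim at \<open>p + s\<close> is the stronger one.\<close>
    let ?T = "msupport \<mu> \<inter> {..y - s}"
    define p where "p = Sup ?T"
    have T: "?T \<noteq> {}" "bdd_above ?T" "closed ?T" using True closed_msupport by (auto intro: closed_Int)
    have p: "p \<in> msupport \<mu>" "p \<le> y - s" using closed_contains_Sup[OF T] by (auto simp: p_def)
    have "z \<notin> msupport \<mu>" if "p < z" "z \<le> y - s" for z
      using that cSup_upper[OF _ T(2), of z] by (auto simp: p_def)
    then have Gp: "hi.G (y - s) = hi.G p"
      by (intro measure_atMost_support(1)[OF hi.prob hi.sets] p) auto
    let ?b = "Sup (msupport \<mu>') + s'"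
    have at_max: "lo.G (?b - s') = 1"
      using lo.support_max(2) by (intro measure_atMost_support(2)[OF lo.prob lo.sets]) simp
    have "(1 - \<pi> * lo.G (y - s')) ^ n' \<le> (1 - \<pi> * lo.G (p + s - s')) ^ n'"
    proof (rule power_mono)
      have "lo.G (p + s - s') \<le> lo.G (y - s')"
        using p by (intro P'.finite_measure_mono) (auto simp: lo.sets)
      then show "1 - \<pi> * lo.G (y - s') \<le> 1 - \<pi> * lo.G (p + s - s')"
        using hi.\<pi> by simp
      show "0 \<le> 1 - \<pi> * lo.G (y - s')" using lower(2)[of "y - s'"] hi.\<pi> by linarith
    qed
    also have "\<dots> \<le> (1 - \<pi> * hi.G p) ^ n"
    \<comment> \<open>If \<open>p + s\<close> is not below the top full price \<open>?b\<close> of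
      the second market, all of \<mu>' lies below and the left side is the minimal value
      \<open>(1 - \<pi>) ^ n'\<close>.\<close>
    proof (cases "p + s < ?b")
      case False
      then have "lo.G (p + s - s') = 1"
        using lo.support_max(2) by (intro measure_atMost_support(2)[OF lo.prob lo.sets]) force
      moreover have "(1 - \<pi>) ^ n' \<le> (1 - \<pi>) ^ n" using hi.\<pi> n by (intro power_decreasing) auto
      moreover have "(1 - \<pi>) ^ n \<le> (1 - \<pi> * hi.G p) ^ n"
        using lower(1)[of p] hi.\<pi> by (intro power_mono) auto
      ultimately show ?thesis by simp
    next
      case True
      have pos: "0 < p" "p + s < vmax" using hi.support_pos[OF p(1)] by auto
      have "(1 - \<pi> * lo.G ((p + s) - s')) ^ n' \<le> (1 - \<pi> * hi.G ((p + s) - s)) ^ n"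
      proof (rule full_price_dominance_support[where b = ?b and A = A])
        show "0 < A (p + s)" by (rule hi.A_pos[OF pos(2)])
        show "(?b - s) * A ?b * (1 - \<pi> * hi.G (?b - s)) ^ (n - 1) \<le>
          (p + s - s) * A (p + s) * (1 - \<pi> * hi.G (p + s - s)) ^ (n - 1)"
          using hi.optimal[OF p(1), of "?b - s"] True pos by simp
        show "(p + s - s') * A (p + s) * (1 - \<pi> * lo.G (p + s - s')) ^ (n' - 1) \<le>
          (?b - s') * A ?b * (1 - \<pi> * lo.G (?b - s')) ^ (n' - 1)"
          using lo.optimal[OF lo.support_max(1), of "p + s - s'"] pos ss by simp
      qed (use hi.\<pi> hi.n n ss hi.G lo.G pos True at_max hi.A_nonneg in auto)
      then show ?thesis by simp
    qed
    finally show ?thesis by (simp add: Gp)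
  qed
  have "(\<lambda>k. (1 - \<pi> * lo.G (y - s' - 1 / Suc k)) ^ n') \<longlonglongrightarrow> (1 - \<pi> * measure \<mu>' {..<y - s'}) ^ n'"
    "(\<lambda>k. (1 - \<pi> * hi.G (y - s - 1 / Suc k)) ^ n) \<longlonglongrightarrow> (1 - \<pi> * measure \<mu> {..<y - s}) ^ n"
    by (intro tendsto_intros hi.measure_lessThan_lim lo.measure_lessThan_lim)+
  moreover have "(1 - \<pi> * lo.G (y - s' - 1 / Suc k)) ^ n' \<le> (1 - \<pi> * hi.G (y - s - 1 / Suc k)) ^ n" for k
    using closed[of "y - 1 / Suc k"] by (simp add: algebra_simps)
  ultimately show "(1 - \<pi> * measure \<mu>' {..<y - s'}) ^ n' \<le> (1 - \<pi> * measure \<mu> {..<y - s}) ^ n"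
    by (intro LIMSEQ_le) auto
qed

section \<open>Symmetric equilibria\<close>

lemma nn_integral_layer_cake:
  fixes X :: "'a \<Rightarrow> real"
  assumes N: "prob_space N" and X[measurable]: "X \<in> borel_measurable N"
  shows "(\<integral>\<^sup>+z. ennreal (X z) \<partial>N) = (\<integral>\<^sup>+t. indicator {0..} t * emeasure N {z \<in> space N. t < X z} \<partial>lborel)"
proof -
  interpret N: prob_space N by fact
  interpret pair_sigma_finite N lborel ..
  have "ennreal x = (\<integral>\<^sup>+t. indicator {0..<x} t \<partial>lborel)" for x :: real
    by (cases "0 \<le> x") (simp_all add: ennreal_neg)
  then have "(\<integral>\<^sup>+z. ennreal (X z) \<partial>N) = (\<integral>\<^sup>+z. \<integral>\<^sup>+t. indicator {0..<X z} t \<partial>lborel \<partial>N)" by simp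
  also have "\<dots> = (\<integral>\<^sup>+t. \<integral>\<^sup>+z. indicator {0..<X z} t \<partial>N \<partial>lborel)"
  proof (rule Fubini'[symmetric])
    have "(\<lambda>w. indicator {w. 0 \<le> snd w \<and> snd w < X (fst w)} w :: ennreal) \<in> borel_measurable (N \<Otimes>\<^sub>M lborel)"
      by measurable
    moreover have "(\<lambda>w. indicator {w. 0 \<le> snd w \<and> snd w < X (fst w)} w :: ennreal) = (\<lambda>(z, t). indicator {0..<X z} t)"
      by (auto simp: fun_eq_iff indicator_def)
    ultimately show "(\<lambda>(z, t). indicator {0..<X z} t :: ennreal) \<in> borel_measurable (N \<Otimes>\<^sub>M lborel)" by simp
  qed
  also have "\<dots> = (\<integral>\<^sup>+t. indicator {0..} t * emeasure N {z \<in> space N. t < X z} \<partial>lborel)"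
  proof (rule nn_integral_cong)
    fix t :: real
    have "(\<integral>\<^sup>+z. indicator {0..<X z} t \<partial>N) = (\<integral>\<^sup>+z. indicator {0..} t * indicator {z \<in> space N. t < X z} z \<partial>N)"
      by (rule nn_integral_cong) (auto simp: indicator_def)
    also have "\<dots> = indicator {0..} t * emeasure N {z \<in> space N. t < X z}"
      by (simp add: nn_integral_cmult)
    finally show "(\<integral>\<^sup>+z. indicator {0..<X z} t \<partial>N) = indicator {0..} t * emeasure N {z \<in> space N. t < X z}" .
  qed
  finally show ?thesis .
qed

locale symmetric_equilibrium = equilibrium_market +
  fixes \<pi> q :: real and \<mu> :: "real measure"
  assumes nonempty: "S \<noteq> {}"
    and types: "\<And>j. j \<in> S \<Longrightarrow> fit_prob M j = \<pi> \<and> quality M j = q \<and> price_dist \<Phi> j = \<mu>"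
    and viable_type: "max_value M * q - search_cost M / \<pi> > 0"
begin

abbreviation "s \<equiv> search_cost M / \<pi>"
abbreviation "n \<equiv> card S"
abbreviation "DD \<equiv> PP \<Otimes>\<^sub>M FF"
abbreviation "coin j \<equiv> measure_pmf (bernoulli_pmf (fit_prob M j))"

definition demand :: "real \<Rightarrow> real" where
  "demand x = measure (value_dist M) {v \<in> space (value_dist M). x < v * q}"

lemma finite_S: "finite S"
  using S finite_subset by blast

lemma \<mu>: "prob_space \<mu>" "sets \<mu> = sets borel" "AE p in \<mu>. 0 \<le> p"
  using nonempty types price_dist S_less by blast+

lemma \<pi>: "0 < \<pi>" "\<pi> < 1"
  using nonempty types fit_prob S_less by blast+

lemma q: "0 < q" "q \<le> 1"
proof -
  have q: "0 \<le> q" "q \<le> 1" using nonempty types quality S_less by blast+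
  moreover have "0 \<le> s" using \<pi> wf by (simp add: wf_market_def)
  ultimately show "0 < q" "q \<le> 1" using viable_type by (cases "q = 0"; auto)+
qed

lemma index: "j \<in> S \<Longrightarrow> eq_index M \<Phi> P V j = V * q - P j - s"
  using types[of j] index_learned[of j P V] by simp

lemma prob_DD: "prob_space DD"
  by (intro prob_space_pair_measure prob_PP prob_FF)

section \<open>Joint probabilities of prices and fits\<close>

lemma regroup_preserving:
  "measure_preserving (value_dist M \<Otimes>\<^sub>M DD) CS (\<lambda>w. (fst (snd w), fst w, snd (snd w)))"
  unfolding CS_def'
  using measure_preserving_comp[OF measure_preserving_assoc(2)[OF prob_value prob_PP prob_FF]
      measure_preserving_comp[OF measure_preserving_map_prod[OF measure_preserving_swap[OF prob_value prob_PP]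
         measure_preserving_id prob_FF prob_FF] measure_preserving_assoc(1)[OF prob_PP prob_value prob_FF]]]
  by simp

lemma box_prob:
  assumes A: "\<And>j. j < m \<Longrightarrow> A j \<in> sets (price_dist \<Phi> j \<Otimes>\<^sub>M coin j)"
  shows "{z \<in> space DD. \<forall>j\<in>{..<m}. (fst z j, snd z j) \<in> A j} \<in> sets DD"
    and "emeasure DD {z \<in> space DD. \<forall>j\<in>{..<m}. (fst z j, snd z j) \<in> A j} =
      (\<Prod>j<m. emeasure (price_dist \<Phi> j \<Otimes>\<^sub>M coin j) (A j))"
proof -
  \<comment> \<open>The product lemmas ask for a probability measure at every index; beyond the
    actual businesses a point mass serves as a default.\<close>
  define pd where "pd j = (if j < m then price_dist \<Phi> j else return borel 0)" for j
  have pd: "prob_space (pd j)" for j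
    by (simp add: pd_def price_dist prob_space_return)
  have PP: "PP = PiM {..<m} pd" by (rule PiM_cong) (auto simp: pd_def)
  let ?J = "{..<m}"
  let ?Z = "PiM ?J (\<lambda>j. pd j \<Otimes>\<^sub>M coin j)" and ?f = "\<lambda>z. \<lambda>j\<in>?J. (fst z j, snd z j)"
  have mp: "measure_preserving DD ?Z ?f"
    unfolding PP by (rule measure_preserving_zip[OF finite_lessThan pd prob_space_measure_pmf])
  interpret Z: product_sigma_finite "\<lambda>j. pd j \<Otimes>\<^sub>M coin j"
    by (simp add: product_sigma_finite_def prob_space_imp_sigma_finite prob_space_pair_measure pd prob_space_measure_pmf)
  have pdj: "pd j = price_dist \<Phi> j" if "j < m" for j using that by (simp add: pd_def)
  have A': "A j \<in> sets (pd j \<Otimes>\<^sub>M coin j)" if "j \<in> ?J" for j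
  proof -
    have "j < m" using that by simp
    then show ?thesis unfolding pdj[OF \<open>j < m\<close>] by (rule A)
  qed
  have box: "Pi\<^sub>E ?J A \<in> sets ?Z" by (rule sets_PiM_I_finite[OF finite_lessThan A'])
  have mem: "?f z \<in> Pi\<^sub>E ?J A \<longleftrightarrow> (\<forall>j\<in>?J. (fst z j, snd z j) \<in> A j)" for z
    unfolding PiE_iff by (simp del: lessThan_iff)
  have vim: "{z \<in> space DD. \<forall>j\<in>?J. (fst z j, snd z j) \<in> A j} = ?f -` Pi\<^sub>E ?J A \<inter> space DD"
    unfolding vimage_def mem by (simp only: Int_def mem_Collect_eq conj_commute)
  show "{z \<in> space DD. \<forall>j\<in>?J. (fst z j, snd z j) \<in> A j} \<in> sets DD"
    unfolding vim by (rule measurable_sets[OF measure_preserving_measurable[OF mp] box])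
  have "emeasure DD {z \<in> space DD. \<forall>j\<in>?J. (fst z j, snd z j) \<in> A j} = emeasure (distr DD ?Z ?f) (Pi\<^sub>E ?J A)"
    unfolding vim by (rule emeasure_distr[OF measure_preserving_measurable[OF mp] box, symmetric])
  also have "\<dots> = emeasure ?Z (Pi\<^sub>E ?J A)"
    using mp by (simp only: measure_preserving_def)
  also have "\<dots> = (\<Prod>j<m. emeasure (pd j \<Otimes>\<^sub>M coin j) (A j))"
    by (rule Z.emeasure_PiM[OF finite_lessThan A'])
  also have "\<dots> = (\<Prod>j<m. emeasure (price_dist \<Phi> j \<Otimes>\<^sub>M coin j) (A j))"
  proof (intro prod.cong refl)
    fix j assume "j \<in> {..<m}"
    then have "j < m" by simp
    show "emeasure (pd j \<Otimes>\<^sub>M coin j) (A j) = emeasure (price_dist \<Phi> j \<Otimes>\<^sub>M coin j) (A j)"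
      unfolding pdj[OF \<open>j < m\<close>] by (rule refl)
  qed
  finally show "emeasure DD {z \<in> space DD. \<forall>j\<in>?J. (fst z j, snd z j) \<in> A j} =
      (\<Prod>j<m. emeasure (price_dist \<Phi> j \<Otimes>\<^sub>M coin j) (A j))" .
qed

lemma pair_prob:
  assumes j: "j \<in> S" and X: "X \<in> sets borel"
  shows "X \<times> {True} \<in> sets (price_dist \<Phi> j \<Otimes>\<^sub>M coin j)"
    "emeasure (price_dist \<Phi> j \<Otimes>\<^sub>M coin j) (X \<times> {True}) = ennreal (\<pi> * measure \<mu> X)"
    "- (X \<times> {True}) \<in> sets (price_dist \<Phi> j \<Otimes>\<^sub>M coin j)"
    "emeasure (price_dist \<Phi> j \<Otimes>\<^sub>M coin j) (- (X \<times> {True})) = ennreal (1 - \<pi> * measure \<mu> X)"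
proof -
  let ?N = "price_dist \<Phi> j \<Otimes>\<^sub>M coin j"
  interpret \<mu>: prob_space \<mu> by (rule \<mu>)
  interpret N: prob_space ?N
    using types[OF j] by (intro prob_space_pair_measure prob_space_measure_pmf) (simp add: \<mu>)
  have sp: "space ?N = UNIV" using types[OF j] sets_eq_imp_space_eq[OF \<mu>(2)] by (simp add: space_pair_measure)
  show 1: "X \<times> {True} \<in> sets ?N" using X types[OF j] \<mu>(2) by auto
  show 2: "emeasure ?N (X \<times> {True}) = ennreal (\<pi> * measure \<mu> X)"
    using X types[OF j] \<mu>(2) \<pi>
    by (subst sigma_finite_measure.emeasure_pair_measure_Times)
      (auto simp: measure_pmf.sigma_finite_measure_axioms emeasure_pmf_single \<mu>.emeasure_eq_measure
        ennreal_mult mult.commute)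
  show "- (X \<times> {True}) \<in> sets ?N" using sets.compl_sets[OF 1] by (simp add: sp Compl_eq_Diff_UNIV)
  have "N.prob (X \<times> {True}) = \<pi> * measure \<mu> X"
    using 2 \<pi> by (simp add: N.emeasure_eq_measure)
  then show "emeasure ?N (- (X \<times> {True})) = ennreal (1 - \<pi> * measure \<mu> X)"
    using N.prob_compl[OF 1] by (simp add: N.emeasure_eq_measure sp Compl_eq_Diff_UNIV)
qed

lemma prod_over_S:
  assumes "\<And>j. j \<in> S' \<Longrightarrow> f j = ennreal a" "\<And>j. j < m \<Longrightarrow> j \<notin> S' \<Longrightarrow> f j = 1" "S' \<subseteq> {..<m}" "0 \<le> a"
  shows "(\<Prod>j<m. f j) = ennreal (a ^ card S')"
proof -
  have "(\<Prod>j<m. f j) = (\<Prod>j\<in>S'. f j)"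
    using assms by (intro prod.mono_neutral_right) auto
  also have "\<dots> = ennreal (a ^ card S')" using assms by (simp add: prod_constant ennreal_power)
  finally show ?thesis .
qed

lemma fit_below_le_1: "\<pi> * measure \<mu> X \<le> 1"
proof -
  interpret \<mu>: prob_space \<mu> by (rule \<mu>)
  have "\<pi> * measure \<mu> X \<le> 1 * 1" using \<pi> by (intro mult_mono) auto
  then show ?thesis by simp
qed

lemma emeasure_UNIV_pair: "j < m \<Longrightarrow> emeasure (price_dist \<Phi> j \<Otimes>\<^sub>M coin j) UNIV = 1"
proof -
  assume j: "j < m"
  interpret N: prob_space "price_dist \<Phi> j \<Otimes>\<^sub>M coin j"
    using price_dist[OF j] by (intro prob_space_pair_measure prob_space_measure_pmf)
  have "space (price_dist \<Phi> j \<Otimes>\<^sub>M coin j) = UNIV"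
    using sets_eq_imp_space_eq[OF price_dist(2)[OF j]] by (simp add: space_pair_measure)
  then show ?thesis using N.emeasure_space_1 by simp
qed

lemma UNIV_sets_pair: "j < m \<Longrightarrow> UNIV \<in> sets (price_dist \<Phi> j \<Otimes>\<^sub>M coin j)"
  using sets.top[of "price_dist \<Phi> j \<Otimes>\<^sub>M coin j"] sets_eq_imp_space_eq[OF price_dist(2)[of j]]
  by (simp add: space_pair_measure)

definition offer :: "real \<Rightarrow> (nat \<Rightarrow> real) \<times> (nat \<Rightarrow> bool) \<Rightarrow> bool" where
  "offer x z \<longleftrightarrow> (\<exists>j\<in>S. snd z j \<and> fst z j < x)"

lemma prob_offer:
  "{z \<in> space DD. offer x z} \<in> sets DD"
  "emeasure DD {z \<in> space DD. offer x z} = ennreal (1 - (1 - \<pi> * measure \<mu> {..<x}) ^ n)"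
proof -
  interpret DD: prob_space DD by (rule prob_DD)
  let ?A = "\<lambda>j. if j \<in> S then - ({..<x} \<times> {True}) else UNIV"
  let ?B = "{z \<in> space DD. \<forall>j\<in>{..<m}. (fst z j, snd z j) \<in> ?A j}"
  have A: "?A j \<in> sets (price_dist \<Phi> j \<Otimes>\<^sub>M coin j)" if "j < m" for j
    using pair_prob(3)[of j "{..<x}"] UNIV_sets_pair[OF that] by auto
  have B: "?B \<in> sets DD" using box_prob(1)[of ?A] A by blast
  have eq: "{z \<in> space DD. offer x z} = space DD - ?B"
    using S_less by (auto simp: offer_def)
  show "{z \<in> space DD. offer x z} \<in> sets DD" unfolding eq by (rule sets.compl_sets[OF B])
  have "emeasure DD ?B = (\<Prod>j<m. emeasure (price_dist \<Phi> j \<Otimes>\<^sub>M coin j) (?A j))"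
    using box_prob(2)[of ?A] A by blast
  also have "\<dots> = ennreal ((1 - \<pi> * measure \<mu> {..<x}) ^ n)"
    by (rule prod_over_S) (use S in \<open>auto simp: pair_prob(4) emeasure_UNIV_pair fit_below_le_1\<close>)
  finally have "measure DD ?B = (1 - \<pi> * measure \<mu> {..<x}) ^ n"
    by (simp add: DD.emeasure_eq_measure fit_below_le_1)
  then show "emeasure DD {z \<in> space DD. offer x z} = ennreal (1 - (1 - \<pi> * measure \<mu> {..<x}) ^ n)"
    unfolding eq using DD.prob_compl[OF B] by (simp add: DD.emeasure_eq_measure)
qed

text \<open>The purchase is made at the largest index among the fitting businesses, so the surplus
  exceeds a level \<ge> 0 iff some fitting business has an index above it. With equal types this is
  a condition on its price alone.\<close>

lemma AE_surplus_gt: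
  assumes "0 \<le> t"
  shows "AE z in CS. t < surplus z \<longleftrightarrow> offer (fst (snd z) * q - s - t) (fst z, snd (snd z))"
  using AE_index
proof eventually_elim
  case (elim z)
  show ?case
  proof
    assume t: "t < surplus z"
    obtain j where j: "buys z j"
    proof (rule ccontr)
      assume "\<not> thesis"
      then have "\<forall>j. \<not> buys z j" using that by blast
      from surplus_no_trans(1)[OF this] show False using t assms by linarith
    qed
    then have "j < m" "0 < \<sigma> z j" "snd (snd z) j" by (auto simp: transacts_def inspects_def)
    then have "j \<in> S" using elim by blast
    then show "offer (fst (snd z) * q - s - t) (fst z, snd (snd z))"
      using t \<open>snd (snd z) j\<close> unfolding surplus_trans(1)[OF j] index[OF \<open>j \<in> S\<close>] offer_def
      by (intro bexI[of _ j]) simp_all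
  next
    assume "offer (fst (snd z) * q - s - t) (fst z, snd (snd z))"
    then obtain j where j: "j \<in> S" "snd (snd z) j" "fst z j < fst (snd z) * q - s - t"
      unfolding offer_def by auto
    then have t: "t < \<sigma> z j" unfolding index[OF j(1)] by linarith
    then have "0 < \<sigma> z j" using assms by linarith
    then obtain k where k: "buys z k" "\<sigma> z j \<le> \<sigma> z k"
      using exists_transacts[of j m "\<sigma> z" "snd (snd z)", OF S_less[OF j(1)] _ j(2)] by blast
    show "t < surplus z" unfolding surplus_trans(1)[OF k(1)] using k(2) t by linarith
  qed
qed

text \<open>Prices are transfers and all learned businesses have the same type, so it only matters
  whether a purchase is made, not from whom.\<close>

lemma AE_gross_surplus:
  "AE z in CS. gross_surplus z = (if offer (fst (snd z) * q - s) (fst z, snd (snd z)) then fst (snd z) * q - s else 0)"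
  using AE_surplus_gt[OF order_refl] AE_trans AE_surplus_nonneg
proof eventually_elim
  case (elim z)
  show ?case
  proof (cases "\<exists>j. buys z j")
    case True
    then obtain j where j: "buys z j" by blast
    then have jS: "j \<in> S" "0 < \<sigma> z j" using elim(2) by blast+
    then have "offer (fst (snd z) * q - s) (fst z, snd (snd z))"
      using elim(1) unfolding surplus_trans(1)[OF j] by simp
    then show ?thesis unfolding surplus_trans(2)[OF j] index[OF jS(1)] by simp
  next
    case False
    then have "\<not> offer (fst (snd z) * q - s) (fst z, snd (snd z))"
      using elim(1) surplus_no_trans(1)[of z] by simp
    moreover have "gross_surplus z = 0" by (rule surplus_no_trans(2)) (use False in blast)
    ultimately show ?thesis by simp
  qed
qed

lemma nn_integral_offer:
  assumes g: "g \<in> borel_measurable CS"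
    and ae: "AE z in CS. g z = (if offer (y (fst (snd z))) (fst z, snd (snd z)) then k (fst (snd z)) else 0)"
  shows "(\<integral>\<^sup>+z. g z \<partial>CS) = (\<integral>\<^sup>+v. k v * ennreal (1 - (1 - \<pi> * measure \<mu> {..<y v}) ^ n) \<partial>value_dist M)"
proof -
  let ?g = "\<lambda>w. (fst (snd w), fst w, snd (snd w))"
  note mp = regroup_preserving
  have gm: "(\<lambda>w. g (?g w)) \<in> borel_measurable (value_dist M \<Otimes>\<^sub>M DD)"
    by (rule measurable_compose[OF measure_preserving_measurable[OF mp] g])
  have "(\<integral>\<^sup>+z. g z \<partial>CS) = (\<integral>\<^sup>+w. g (?g w) \<partial>(value_dist M \<Otimes>\<^sub>M DD))"
    by (rule measure_preserving_nn_integral[OF mp g, symmetric])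
  also have "\<dots> = (\<integral>\<^sup>+v. \<integral>\<^sup>+z. g (?g (v, z)) \<partial>DD \<partial>value_dist M)"
    by (rule nn_integral_pair[OF prob_DD gm])
  also have "\<dots> = (\<integral>\<^sup>+v. k v * ennreal (1 - (1 - \<pi> * measure \<mu> {..<y v}) ^ n) \<partial>value_dist M)"
  proof (rule nn_integral_cong_AE)
    interpret V: prob_space "value_dist M" by (rule prob_value)
    interpret DD: prob_space DD by (rule prob_DD)
    interpret pair_sigma_finite "value_dist M" DD ..
    have "AE w in value_dist M \<Otimes>\<^sub>M DD. g (?g w) = (if offer (y (fst w)) (snd w) then k (fst w) else 0)"
      using AE_measure_preserving[OF mp ae] by (simp only: fst_conv snd_conv prod.collapse)
    from AE_pair[OF this]
    show "AE v in value_dist M. (\<integral>\<^sup>+z. g (?g (v, z)) \<partial>DD) = k v * ennreal (1 - (1 - \<pi> * measure \<mu> {..<y v}) ^ n)"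
    proof eventually_elim
      case (elim v)
      have "AE z in DD. g (?g (v, z)) = k v * indicator {z \<in> space DD. offer (y v) z} z"
        using elim AE_space[of DD] by eventually_elim (simp add: indicator_def)
      then have "(\<integral>\<^sup>+z. g (?g (v, z)) \<partial>DD) = (\<integral>\<^sup>+z. k v * indicator {z \<in> space DD. offer (y v) z} z \<partial>DD)"
        by (rule nn_integral_cong_AE)
      also have "\<dots> = k v * emeasure DD {z \<in> space DD. offer (y v) z}"
        by (rule nn_integral_cmult_indicator[OF prob_offer(1)])
      finally show ?case by (simp only: prob_offer(2))
    qed
  qed
  finally show ?thesis .
qed

text \<open>The surplus depends on the cheapest fitting offer. For a fixed value its tail events are
  \<open>offer\<close> events with explicit probabilities, namely those compared by
  \<open>full_price_dominance\<close>; hence the integration over the level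
  \<open>t\<close>.\<close>

lemma consumer_welfare_formula:
  "ennreal (consumer_welfare M \<Phi>) = (\<integral>\<^sup>+t. indicator {0..} t *
     (\<integral>\<^sup>+v. ennreal (1 - (1 - \<pi> * measure \<mu> {..<v * q - t - s}) ^ n) \<partial>value_dist M) \<partial>lborel)"
  unfolding welfare_nn_integral(1) nn_integral_layer_cake[OF prob_CS surplus_measurable(1)]
proof (rule nn_integral_cong)
  fix t :: real
  show "indicator {0..} t * emeasure CS {z \<in> space CS. t < surplus z} = indicator {0..} t *
     (\<integral>\<^sup>+v. ennreal (1 - (1 - \<pi> * measure \<mu> {..<v * q - t - s}) ^ n) \<partial>value_dist M)"
  proof (cases "0 \<le> t")
    case True
    have X: "{z \<in> space CS. t < surplus z} \<in> sets CS"
      by (rule borel_measurable_less[OF borel_measurable_const surplus_measurable(1)])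
    have "AE z in CS. indicator {z \<in> space CS. t < surplus z} z =
        (if offer (fst (snd z) * q - t - s) (fst z, snd (snd z)) then 1 else 0 :: ennreal)"
      using AE_surplus_gt[OF True] AE_space[of CS]
      by eventually_elim (simp add: indicator_def algebra_simps)
    from nn_integral_offer[OF borel_measurable_indicator[OF X] this]
    have "emeasure CS {z \<in> space CS. t < surplus z} =
        (\<integral>\<^sup>+v. ennreal (1 - (1 - \<pi> * measure \<mu> {..<v * q - t - s}) ^ n) \<partial>value_dist M)"
      by (simp add: X)
    then show ?thesis by (simp only:)
  qed simp
qed

lemma total_welfare_formula:
  "ennreal (total_welfare M \<Phi>) = (\<integral>\<^sup>+v. ennreal (v * q - s) *
     ennreal (1 - (1 - \<pi> * measure \<mu> {..<v * q - s}) ^ n) \<partial>value_dist M)"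
  unfolding welfare_nn_integral(2)
proof (rule nn_integral_offer)
  show "(\<lambda>z. ennreal (gross_surplus z)) \<in> borel_measurable CS"
    by (rule measurable_compose[OF surplus_measurable(2) measurable_ennreal])
  show "AE z in CS. ennreal (gross_surplus z) =
      (if offer (fst (snd z) * q - s) (fst z, snd (snd z)) then ennreal (fst (snd z) * q - s) else 0)"
    using AE_gross_surplus by eventually_elim simp
qed

text \<open>
  The learned business with the largest number loses all ties, so that its revenue has this form
  whether or not the price distribution has atoms.
\<close>

lemma deviation_revenue_Max:
  "deviation_revenue M \<Phi> (Max S) p = \<pi> * (p * demand (p + s) * (1 - \<pi> * measure \<mu> {..p}) ^ (n - 1))"
proof -
  define j0 where "j0 = Max S"
  have j0: "j0 \<in> S" "\<And>k. k \<in> S \<Longrightarrow> k \<noteq> j0 \<Longrightarrow> k < j0"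
    using finite_S nonempty by (auto simp: j0_def intro: le_neq_trans)
  interpret CS: prob_space CS by (rule prob_CS)
  interpret V: prob_space "value_dist M" by (rule prob_value)
  interpret DD: prob_space DD by (rule prob_DD)
  \<comment> \<open>The business \<open>j0\<close> has to fit, and its own price draw is free
    because it is overwritten by \<open>p\<close>. The other learned businesses must not both fit
    and charge at most \<open>p\<close>; the lost ones are unrestricted.\<close>
  let ?A = "\<lambda>j. if j = j0 then UNIV \<times> {True} else if j \<in> S then - ({..p} \<times> {True}) else UNIV"
  let ?B = "{z \<in> space DD. \<forall>j\<in>{..<m}. (fst z j, snd z j) \<in> ?A j}"
  let ?V = "{v \<in> space (value_dist M). p + s < v * q}"
  have A: "?A j \<in> sets (price_dist \<Phi> j \<Otimes>\<^sub>M coin j)" if "j < m" for j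
    using pair_prob(3)[of j "{..p}"] pair_prob(1)[OF j0(1), of UNIV] UNIV_sets_pair[OF that] by auto
  have B: "?B \<in> sets DD" using box_prob(1)[of ?A] A by blast
  have V: "?V \<in> sets (value_dist M)"
    by (rule borel_measurable_less) (simp_all add: measurable_cong_sets[OF sets_value refl])
  have "emeasure DD ?B = (\<Prod>j<m. emeasure (price_dist \<Phi> j \<Otimes>\<^sub>M coin j) (?A j))"
    using box_prob(2)[of ?A] A by blast
  also have "\<dots> = emeasure (price_dist \<Phi> j0 \<Otimes>\<^sub>M coin j0) (?A j0) *
      (\<Prod>j\<in>{..<m} - {j0}. emeasure (price_dist \<Phi> j \<Otimes>\<^sub>M coin j) (?A j))"
    by (rule prod.remove) (use S_less[OF j0(1)] in auto)
  also have "(\<Prod>j\<in>{..<m} - {j0}. emeasure (price_dist \<Phi> j \<Otimes>\<^sub>M coin j) (?A j)) =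
      (\<Prod>j\<in>S - {j0}. emeasure (price_dist \<Phi> j \<Otimes>\<^sub>M coin j) (?A j))"
    using S by (intro prod.mono_neutral_right) (auto simp: emeasure_UNIV_pair)
  also have "\<dots> = (\<Prod>j\<in>S - {j0}. ennreal (1 - \<pi> * measure \<mu> {..p}))"
    by (rule prod.cong[OF refl]) (simp add: pair_prob(4))
  also have "\<dots> = ennreal ((1 - \<pi> * measure \<mu> {..p}) ^ (n - 1))"
    using j0 finite_S by (simp add: prod_constant ennreal_power fit_below_le_1)
  also have "emeasure (price_dist \<Phi> j0 \<Otimes>\<^sub>M coin j0) (?A j0) = ennreal \<pi>"
  proof -
    interpret \<mu>: prob_space \<mu> by (rule \<mu>)
    have "measure \<mu> UNIV = 1" using \<mu>.prob_space sets_eq_imp_space_eq[OF \<mu>(2)] by simp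
    then show ?thesis using pair_prob(2)[OF j0(1), of UNIV] by simp
  qed
  finally have PB: "measure DD ?B = \<pi> * (1 - \<pi> * measure \<mu> {..p}) ^ (n - 1)"
    using \<pi> by (simp add: DD.emeasure_eq_measure fit_below_le_1 flip: ennreal_mult)
  let ?t = "\<lambda>z. transacts m (eq_index M \<Phi> ((fst z)(j0 := p)) (fst (snd z))) (snd (snd z)) j0"
  let ?e = "\<lambda>z. fst (snd z) \<in> ?V \<and> (fst z, snd (snd z)) \<in> ?B"
  have ae: "AE z in CS. ?t z \<longleftrightarrow> ?e z"
    using AE_CS AE_space[of CS]
  proof eventually_elim
    case (elim z)
    let ?\<sigma> = "eq_index M \<Phi> ((fst z)(j0 := p)) (fst (snd z))"
    have own: "?\<sigma> j0 = fst (snd z) * q - p - s" using index[OF j0(1)] by simp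
    have other: "?\<sigma> k = fst (snd z) * q - fst z k - s" if "k \<in> S" "k \<noteq> j0" for k
      using index[OF that(1)] that(2) by simp
    have lost: "?\<sigma> k \<le> 0" if "k < m" "k \<notin> S" for k
    proof -
      have "k \<noteq> j0" using that j0 by auto
      then show ?thesis
        using index_lost[OF that, of "fst (snd z)" "(fst z)(j0 := p)"] elim(1) that(1) by simp
    qed
    have space: "fst (snd z) \<in> space (value_dist M)" "(fst z, snd (snd z)) \<in> space DD"
      using elim(2) by (auto simp: CS_def' space_pair_measure)
    \<comment> \<open>All rivals in \<open>S\<close> have smaller numbers than \<open>j0\<close>, so
      at equal prices they come first: the inequality is weak.\<close>
    have prec: "precedes ?\<sigma> k j0 \<longleftrightarrow> k \<in> S \<and> k \<noteq> j0 \<and> fst z k \<le> p"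
      if pos: "?\<sigma> j0 > 0" and "k < m" for k
    proof (cases "k \<in> S \<and> k \<noteq> j0")
      case True
      then show ?thesis
        using j0(2)[of k] by (auto simp: precedes_def own other)
    next
      case False
      then show ?thesis using lost[OF \<open>k < m\<close>] pos by (auto simp: precedes_def)
    qed
    have "?t z \<longleftrightarrow> ?\<sigma> j0 > 0 \<and> snd (snd z) j0 \<and> (\<forall>k<m. k \<in> S \<and> k \<noteq> j0 \<and> fst z k \<le> p \<longrightarrow> \<not> snd (snd z) k)"
      using prec S_less[OF j0(1)] by (auto simp: transacts_def inspects_def)
    also have "\<dots> \<longleftrightarrow> ?e z"
      using space S_less[OF j0(1)] own by auto
    finally show ?case .
  qed
  have VB: "?V \<times> ?B \<in> sets (value_dist M \<Otimes>\<^sub>M DD)" using V B by (rule pair_measureI)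
  have unmix: "measure_preserving CS (value_dist M \<Otimes>\<^sub>M DD) (\<lambda>z. (fst (snd z), fst z, snd (snd z)))"
    unfolding CS_def'
    using measure_preserving_comp[OF measure_preserving_assoc(2)[OF prob_PP prob_value prob_FF]
        measure_preserving_comp[OF measure_preserving_map_prod[OF measure_preserving_swap[OF prob_PP prob_value]
         measure_preserving_id prob_FF prob_FF] measure_preserving_assoc(1)[OF prob_value prob_PP prob_FF]]]
    by simp
  have E: "{z \<in> space CS. ?e z} = (\<lambda>z. (fst (snd z), fst z, snd (snd z))) -` (?V \<times> ?B) \<inter> space CS" by blast
  have Em: "{z \<in> space CS. ?e z} \<in> sets CS"
    unfolding E by (rule measurable_sets[OF measure_preserving_measurable[OF unmix] VB])
  have "emeasure CS {z \<in> space CS. ?e z} = emeasure (distr CS (value_dist M \<Otimes>\<^sub>M DD) (\<lambda>z. (fst (snd z), fst z, snd (snd z)))) (?V \<times> ?B)"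
    unfolding E by (rule emeasure_distr[OF measure_preserving_measurable[OF unmix] VB, symmetric])
  also have "\<dots> = emeasure (value_dist M) ?V * emeasure DD ?B"
    using unmix V B by (simp only: measure_preserving_def DD.emeasure_pair_measure_Times)
  finally have em: "emeasure CS {z \<in> space CS. ?e z} = emeasure (value_dist M) ?V * emeasure DD ?B" .
  have "measure CS {z \<in> space CS. ?e z} = measure (value_dist M) ?V * measure DD ?B"
    unfolding measure_def em by (rule enn2real_mult)
  then have meas: "measure CS {z \<in> space CS. ?e z} = demand (p + s) * (\<pi> * (1 - \<pi> * measure \<mu> {..p}) ^ (n - 1))"
    unfolding PB demand_def .
  have P': "(\<lambda>z. eq_index M \<Phi> ((fst z)(j0 := p)) (fst (snd z)) k) \<in> borel_measurable CS" if "k < m" for k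
    using that unfolding eq_index_def search_index_def fun_upd_apply
    by (cases "k = j0") (auto intro!: borel_measurable_diff borel_measurable_times CS_components)
  have tm: "(\<lambda>z. ?t z) \<in> CS \<rightarrow>\<^sub>M count_space UNIV"
    by (rule pred_transacts[OF P' CS_components(3)])
  have "deviation_revenue M \<Phi> j0 p = (\<integral>z. (if ?t z then p else 0) \<partial>CS)"
    by (simp add: deviation_revenue_def split_beta')
  also have "\<dots> = (\<integral>z. p * indicator {z \<in> space CS. ?e z} z \<partial>CS)"
  proof (rule integral_cong_AE)
    show "(\<lambda>z. if ?t z then p else 0) \<in> borel_measurable CS"
      using tm by (intro measurable_If) (simp_all add: pred_def)
    show "(\<lambda>z. p * indicator {z \<in> space CS. ?e z} z) \<in> borel_measurable CS"
      by (intro borel_measurable_times borel_measurable_const borel_measurable_indicator Em)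
    show "AE z in CS. (if ?t z then p else 0) = p * indicator {z \<in> space CS. ?e z} z"
      using ae AE_space[of CS]
    proof eventually_elim
      case (elim z)
      then have "z \<in> {z \<in> space CS. ?e z} \<longleftrightarrow> ?t z" by blast
      then show ?case unfolding indicator_def by simp
    qed
  qed
  also have "\<dots> = p * measure CS {z \<in> space CS. ?e z}"
    using Em by simp
  finally have "deviation_revenue M \<Phi> j0 p = p * measure CS {z \<in> space CS. ?e z}" .
  from this[unfolded meas] show ?thesis unfolding j0_def by (simp add: mult_ac)
qed

text \<open>The equilibrium condition is read for \<open>Max S\<close>, whose deviation revenue has
  the closed form above. Its price distribution is the common \<mu>, so this constrains all learned
  businesses.\<close>

lemma competition: "price_competition \<pi> s demand (max_value M * q) n \<mu>"
proof (rule price_competition.intro)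
  interpret V: prob_space "value_dist M" by (rule prob_value)
  show "0 < \<pi>" "\<pi> < 1" by (rule \<pi>)+
  show "0 \<le> s" using \<pi> wf by (simp add: wf_market_def)
  show "s < max_value M * q" using viable_type by simp
  show "0 \<le> demand x" for x by (simp add: demand_def)
  show "0 < demand x" if "x < max_value M * q" for x
  proof -
    have "x / q < max_value M" using that q by (simp add: divide_less_eq)
    then have "emeasure (value_dist M) {x / q<..} > 0" by (rule value_above_pos)
    moreover have "{x / q<..} = {v \<in> space (value_dist M). x < v * q}"
      using q sets_eq_imp_space_eq[OF sets_value] by (auto simp: divide_less_eq)
    ultimately show ?thesis by (simp add: demand_def V.emeasure_eq_measure)
  qed
  show "demand x = 0" if "max_value M * q \<le> x" for x
  proof -
    have "AE v in value_dist M. \<not> x < v * q"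
      using AE_value
    proof eventually_elim
      case (elim v)
      then have "v * q \<le> max_value M * q" using q by (intro mult_right_mono) auto
      then show ?case using that by simp
    qed
    moreover have "{v \<in> space (value_dist M). x < v * q} \<in> sets (value_dist M)"
      by (rule borel_measurable_less) (simp_all add: measurable_cong_sets[OF sets_value refl])
    ultimately show ?thesis by (simp add: demand_def V.prob_eq_0)
  qed
  show "1 \<le> n" using nonempty finite_S by (simp add: Suc_le_eq card_gt_0_iff)
  show "prob_space \<mu>" "sets \<mu> = sets borel" "AE p in \<mu>. 0 \<le> p" by (rule \<mu>)+
  fix p p' :: real assume p: "p \<in> msupport \<mu>" and p': "0 \<le> p'"
  have "Max S \<in> S" using finite_S nonempty by simp
  then have "deviation_revenue M \<Phi> (Max S) p' \<le> deviation_revenue M \<Phi> (Max S) p"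
    using eq p p' types S_less[of "Max S"] by (auto simp: market_equilibrium_def)
  then show "p' * demand (p' + s) * (1 - \<pi> * measure \<mu> {..p'}) ^ (n - 1) \<le>
      p * demand (p + s) * (1 - \<pi> * measure \<mu> {..p}) ^ (n - 1)"
    unfolding deviation_revenue_Max using \<pi> by simp
qed

end

text \<open>The welfare formulas are compared under the integral. For consumers the full price
  threshold is \<open>v * q - t\<close> in both markets; for total welfare it is
  \<open>v * q\<close>, and the gain per purchase also rises, from \<open>v * q - ?s\<close> to
  \<open>v * q - ?s'\<close>.\<close>

lemma (in cost_reduction) symmetric_welfare_mono:
  assumes hi: "symmetric_equilibrium M S \<Phi> \<pi> q \<mu>" and lo: "symmetric_equilibrium Mt S' \<Phi>' \<pi> q \<mu>'"
    and S: "S \<subseteq> S'"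
  shows "consumer_welfare M \<Phi> \<le> consumer_welfare Mt \<Phi>'" "total_welfare M \<Phi> \<le> total_welfare Mt \<Phi>'"
proof -
  interpret hi: symmetric_equilibrium M S \<Phi> \<pi> q \<mu> by (rule hi)
  interpret lo: symmetric_equilibrium Mt S' \<Phi>' \<pi> q \<mu>' by (rule lo)
  let ?s = "search_cost M / \<pi>" and ?s' = "ct / \<pi>"
  have s: "?s' < ?s" using ct hi.\<pi> by (simp add: divide_strict_right_mono)
  have n: "card S \<le> card S'" using S lo.finite_S by (intro card_mono)
  have "lo.demand = hi.demand" by (simp add: fun_eq_iff hi.demand_def lo.demand_def)
  then have comp: "price_competition \<pi> ?s' hi.demand (max_value M * q) (card S') \<mu>'"
    using lo.competition by simp
  have less: "1 - (1 - \<pi> * measure \<mu> {..<y - ?s}) ^ card S \<le> 1 - (1 - \<pi> * measure \<mu>' {..<y - ?s'}) ^ card S'" for y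
    using full_price_dominance(2)[OF hi.competition comp n s, of y] by simp
  have "ennreal (consumer_welfare M \<Phi>) \<le> ennreal (consumer_welfare Mt \<Phi>')"
    unfolding hi.consumer_welfare_formula lo.consumer_welfare_formula Mt_simps
    by (intro nn_integral_mono mult_left_mono ennreal_leI less) simp
  then show "consumer_welfare M \<Phi> \<le> consumer_welfare Mt \<Phi>'"
    by (rule ennreal_le_iff[OF lo.welfare_nn_integral(3), THEN iffD1])
  have "ennreal (total_welfare M \<Phi>) \<le> ennreal (total_welfare Mt \<Phi>')"
    unfolding hi.total_welfare_formula lo.total_welfare_formula Mt_simps
    using s by (intro nn_integral_mono mult_mono ennreal_leI less) auto
  then show "total_welfare M \<Phi> \<le> total_welfare Mt \<Phi>'"
    by (rule ennreal_le_iff[OF lo.welfare_nn_integral(4), THEN iffD1])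
qed

text \<open>If no learned business of \<open>M\<close> has a positive true index at the maximal
  value, welfare in \<open>M\<close> is 0 and welfare in \<open>Mt\<close> is nonnegative. Otherwise
  symmetry extends positivity from one learned business to all, and this business belongs to both
  learned sets, which gives them a common type.\<close>

lemma (in cost_reduction) canonical_welfare_mono:
  assumes sym: "\<And>j k. j \<in> learned_set M H \<Longrightarrow> k \<in> learned_set M H \<Longrightarrow>
      fit_prob M j = fit_prob M k \<and> quality M j = quality M k"
    and sym': "\<And>j k. j \<in> learned_set Mt Ht \<Longrightarrow> k \<in> learned_set Mt Ht \<Longrightarrow>
      fit_prob M j = fit_prob M k \<and> quality M j = quality M k"
    and learned: "\<And>j. j < m \<Longrightarrow> learned M H j \<Longrightarrow>
      max_value M * quality M j - search_cost M / fit_prob M j > 0 \<Longrightarrow> learned Mt Ht j"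
    and \<Phi>: "canonical_equilibrium M H \<Phi>" and \<Phi>t: "canonical_equilibrium Mt Ht \<Phi>t"
  shows "consumer_welfare M \<Phi> \<le> consumer_welfare Mt \<Phi>t \<and> total_welfare M \<Phi> \<le> total_welfare Mt \<Phi>t"
proof -
  let ?S = "learned_set M H" and ?S' = "learned_set Mt Ht"
  interpret hi: equilibrium_market M ?S \<Phi>
    by unfold_locales (use \<Phi> in \<open>simp add: canonical_equilibrium_def\<close>)
  interpret lo: equilibrium_market Mt ?S' \<Phi>t
    by unfold_locales (use \<Phi>t in \<open>simp add: canonical_equilibrium_def\<close>)
  show ?thesis
  proof (cases "\<exists>j\<in>?S. max_value M * quality M j - search_cost M / fit_prob M j > 0")
    case False
    then have "consumer_welfare M \<Phi> = 0" "total_welfare M \<Phi> = 0"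
      by (intro hi.welfare_not_viable; force)+
    then show ?thesis using lo.welfare_nn_integral(3,4) by simp
  next
    case True
    then obtain j where j: "j \<in> ?S" and v: "max_value M * quality M j - search_cost M / fit_prob M j > 0"
      by blast
    have sub: "?S \<subseteq> ?S'"
    proof
      fix k assume k: "k \<in> ?S"
      then have "max_value M * quality M k - search_cost M / fit_prob M k > 0" using sym[OF j k] v by simp
      then show "k \<in> ?S'" using k learned[of k] by (simp add: learned_set_def)
    qed
    have fit: "0 < fit_prob M j" using high.fit_prob[of j] j by (simp add: learned_set_def)
    have v': "max_value M * quality M j - ct / fit_prob M j > 0"
      using v ct fit divide_strict_right_mono[OF ct fit] by linarith
    have "symmetric_equilibrium M ?S \<Phi> (fit_prob M j) (quality M j) (price_dist \<Phi> j)"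
    proof unfold_locales
      fix k assume k: "k \<in> ?S"
      have "price_dist \<Phi> k = price_dist \<Phi> j"
        using \<Phi> k j unfolding canonical_equilibrium_def by blast
      then show "fit_prob M k = fit_prob M j \<and> quality M k = quality M j \<and> price_dist \<Phi> k = price_dist \<Phi> j"
        using sym[OF k j] by simp
    qed (use j v in auto)
    moreover have "symmetric_equilibrium Mt ?S' \<Phi>t (fit_prob M j) (quality M j) (price_dist \<Phi>t j)"
    proof unfold_locales
      fix k assume k: "k \<in> ?S'"
      have "price_dist \<Phi>t k = price_dist \<Phi>t j"
        using \<Phi>t k j sub unfolding canonical_equilibrium_def by blast
      then show "fit_prob Mt k = fit_prob M j \<and> quality Mt k = quality M j \<and> price_dist \<Phi>t k = price_dist \<Phi>t j"
        using sym'[OF k] j sub by auto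
    qed (use j sub v' in auto)
    ultimately show ?thesis using symmetric_welfare_mono[OF _ _ sub] by blast
  qed
qed

theorem theorem7p15:
  fixes M Mt :: market and ct :: real
  assumes "wf_market M" and "wf_market Mt"
    and "learned_symmetric M" and "learned_symmetric Mt"
    and "Mt = M\<lparr>search_cost := ct\<rparr>" and "ct < search_cost M"
  shows "\<exists>K. coupling K (history_law M) (history_law Mt) \<and>
    (AE (H, Ht) in K. \<forall>\<Phi> \<Phi>t.
       canonical_equilibrium M H \<Phi> \<longrightarrow> canonical_equilibrium Mt Ht \<Phi>t \<longrightarrow>
         consumer_welfare M \<Phi> \<le> consumer_welfare Mt \<Phi>t \<and>
         total_welfare M \<Phi> \<le> total_welfare Mt \<Phi>t)"
proof -
  interpret cost_reduction M Mt ct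
    by (intro cost_reduction.intro valid_market.intro cost_reduction_axioms.intro assms)
  obtain K where K: "coupling K (history_law M) (history_law Mt)"
    and learned: "AE z in K. \<forall>j\<in>{..<nbiz M}. learned M (fst z) j \<and>
       max_value M * quality M j - search_cost M / fit_prob M j > 0 \<longrightarrow> learned Mt (snd z) j"
    by (rule coupling_of_learned_sets)
  have sets: "sets K = sets (history_law M \<Otimes>\<^sub>M history_law Mt)"
    and marginals: "distr K (history_law M) fst = history_law M" "distr K (history_law Mt) snd = history_law Mt"
    using K by (simp_all add: coupling_def)
  have mp: "measure_preserving K (history_law M) fst" "measure_preserving K (history_law Mt) snd"
    unfolding measure_preserving_def measurable_cong_sets[OF sets refl]
    by (intro conjI marginals measurable_fst measurable_snd)+
  note AE_measure_preserving[OF mp(1) assms(3)[unfolded learned_symmetric_def]]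
    AE_measure_preserving[OF mp(2) assms(4)[unfolded learned_symmetric_def]] learned
  then have "AE z in K. \<forall>\<Phi> \<Phi>t. canonical_equilibrium M (fst z) \<Phi> \<longrightarrow>
      canonical_equilibrium Mt (snd z) \<Phi>t \<longrightarrow>
      consumer_welfare M \<Phi> \<le> consumer_welfare Mt \<Phi>t \<and> total_welfare M \<Phi> \<le> total_welfare Mt \<Phi>t"
  proof eventually_elim
    case (elim z)
    have "fit_prob M j = fit_prob M k \<and> quality M j = quality M k"
      if "j \<in> learned_set M (fst z)" "k \<in> learned_set M (fst z)" for j k
      using elim(1) that by blast
    moreover have "fit_prob M j = fit_prob M k \<and> quality M j = quality M k"
      if "j \<in> learned_set Mt (snd z)" "k \<in> learned_set Mt (snd z)" for j k
      using elim(2) that unfolding Mt_simps by blast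
    moreover have "learned Mt (snd z) j" if "j < nbiz M" "learned M (fst z) j"
      "max_value M * quality M j - search_cost M / fit_prob M j > 0" for j
      using elim(3) that by simp
    ultimately show ?case
      by (intro allI impI canonical_welfare_mono[where H = "fst z" and Ht = "snd z"]) blast+
  qed
  with K show ?thesis unfolding split_beta' by blast
qed

end
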